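(* Let $S=(S_n)_{n\ge0}$ be the walk $M(2,1,2)$ on $\mathbb{Z}^2$ started at the origin, and let $R_n=|\{S_0,\ldots,S_{n-1}\}|$ for $n\ge1$. Then $$\lim_{n\to\infty}\frac{\log n}{n}R_n=\pi\quad\text{almost surely and in }L^p\text{ for every }1\le p<\infty.$$ Moreover, there is a constant $C<\infty$ such that for all sufficiently large $n$, $$\mathbb{E}\left|\frac{\log n}{n}R_n-\pi\right|\le\frac{C}{\sqrt{\log n}},\qquad \left|\frac{\log n}{n}\mathbb{E}R_n-\pi\right|\le C\,\frac{\log\log n}{\log n}.$$
   Context: The walk $M(2,1,2)$ is the nearest-neighbour process $S=(S_n)_{n\ge0}$ on $\mathbb{Z}^2$ with $S_0=0$ and the following conditional step law given $\mathcal{F}_n=\sigma(S_0,\ldots,S_n)$, where $e_1=(1,0)$, $e_2=(0,1)$. If $S_n\notin\{S_0,\ldots,S_{n-1}\}$ (first departure from the vertex $S_n$; this includes $n=0$), then $S_{n+1}-S_n$ equals $e_1$ or $-e_1$ with conditional probability $1/2$ each. If $S_n\in\{S_0,\ldots,S_{n-1}\}$ (a later departure), then $S_{n+1}-S_n$ is uniform on $\{e_1,-e_1,e_2,-e_2\}$. $R_n$ is the number of distinct vertices visited before time $n$. *)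

theory Defs
  imports "HOL-Probability.Probability"
begin

text \<open>The step law of the walk at a vertex, according to whether it departs from that vertex
  for the first time.  The lattice is \<open>int \<times> int\<close> with \<open>e\<^sub>1 = (1, 0)\<close> and \<open>e\<^sub>2 = (0, 1)\<close>.\<close>

definition step_law :: "bool \<Rightarrow> (int \<times> int) pmf" where
  "step_law first =
     (if first then pmf_of_set {(1, 0), (-1, 0)}
      else pmf_of_set {(1, 0), (-1, 0), (0, 1), (0, -1)})"

definition natural_filtration :: "'a measure \<Rightarrow> (nat \<Rightarrow> 'a \<Rightarrow> int \<times> int) \<Rightarrow> nat \<Rightarrow> 'a measure" where
  "natural_filtration M S n = sigma (space M) {S i -` A \<inter> space M | i A. i \<le> n}"

locale walk_M212 = prob_space M for M :: "'a measure" +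
  fixes S :: "nat \<Rightarrow> 'a \<Rightarrow> int \<times> int"
  assumes measurable_walk: "\<And>n. S n \<in> measurable M (count_space UNIV)"
    and walk_start: "\<And>\<omega>. \<omega> \<in> space M \<Longrightarrow> S 0 \<omega> = (0, 0)"
    and walk_step: "\<And>n e. AE \<omega> in M.
      real_cond_exp M (natural_filtration M S n)
          (indicator {\<omega> \<in> space M. S (Suc n) \<omega> - S n \<omega> = e}) \<omega>
        = pmf (step_law (S n \<omega> \<notin> {S i \<omega> | i. i < n})) e"

text \<open>\<^const>\<open>real_cond_exp\<close> is identically zero unless its second argument is a sub-sigma-algebra
  of its first; this is satisfied here.\<close>

lemma (in walk_M212) subalgebra_natural_filtration: "subalgebra M (natural_filtration M S n)"
proof -
  have "{S i -` A \<inter> space M | i A. i \<le> n} \<subseteq> sets M"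
    using measurable_sets[OF measurable_walk] by auto
  moreover from this have "{S i -` A \<inter> space M | i A. i \<le> n} \<subseteq> Pow (space M)"
    using sets.sets_into_space by auto
  ultimately show ?thesis
    unfolding subalgebra_def natural_filtration_def
    by (simp add: sets.sigma_sets_subset space_measure_of)
qed

definition range_size :: "(nat \<Rightarrow> 'a \<Rightarrow> int \<times> int) \<Rightarrow> nat \<Rightarrow> 'a \<Rightarrow> nat" where
  "range_size S n \<omega> = card {S i \<omega> | i. i < n}"

definition converges_in_Lp ::
  "'a measure \<Rightarrow> real \<Rightarrow> (nat \<Rightarrow> 'a \<Rightarrow> real) \<Rightarrow> ('a \<Rightarrow> real) \<Rightarrow> bool" where
  "converges_in_Lp M p X Y \<longleftrightarrow>
     (\<forall>n. X n \<in> borel_measurable M \<and> integrable M (\<lambda>\<omega>. \<bar>X n \<omega>\<bar> powr p)) \<and>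
     Y \<in> borel_measurable M \<and> integrable M (\<lambda>\<omega>. \<bar>Y \<omega>\<bar> powr p) \<and>
     (\<lambda>n. integral\<^sup>L M (\<lambda>\<omega>. \<bar>X n \<omega> - Y \<omega>\<bar> powr p)) \<longlonglongrightarrow> 0"

end

theory Submission
  imports Defs "HOL-Real_Asymp.Real_Asymp"
begin

text \<open>Let \<open>a\<close> be the potential kernel of simple random walk on the square lattice, so that
  \<open>a x = 1/\<pi> \<cdot> ln (\<bar>x\<bar>\<^sup>2) + O(1)\<close> and the mean of \<open>a\<close> over the neighbours of \<open>x\<close> exceeds \<open>a x\<close>
  by 1 at the origin and by 0 elsewhere.  Follow the sum \<open>X n\<close> of \<open>a (S n - y)\<close> over the visited
  vertices \<open>y\<close>.  At a later departure its conditional drift is 1; at a first departure it is a sum of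
  horizontal second differences of \<open>a\<close>, and over all first departures these add up to a quadratic form
  in the indicator of the range, which is \<open>O(R n)\<close> because its Fourier symbol is bounded.  Hence
  \<open>X n = n + O(R n) + Y n\<close> for a martingale \<open>Y\<close> with increments \<open>O(sqrt (R n))\<close>.  On the other hand
  \<open>X n\<close> is \<open>R n \<cdot> ln n / \<pi>\<close> up to \<open>O(R n \<cdot> ln (ln n))\<close>: the points of the range are distinct, which
  gives the lower bound, and at distance \<open>O(sqrt (n ln n))\<close> from \<open>S n\<close>, which gives the upper bound.
  Exponential supermartingale bounds for \<open>Y\<close> then give all the modes of convergence.\<close>

section \<open>Hyperbolic weights and the potential kernel\<close>

text \<open>The estimate for \<open>Y\<close> is circular: its quadratic variation is controlled by
  \<open>R\<close>, which is what has to be bounded. The loop closes because distinctness of the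
  visited points alone gives \<open>R n * ln n <= 10 * (n + |Y n|)\<close> for large
  \<open>n\<close>, so the variance proxy is of order \<open>n^2 * (1 + |Y n| / n) / ln n\<close>;
  it is only linear in \<open>Y\<close>, and an exponential weight absorbs it. Thus
  \<open>Y n / n\<close> lives on the scale \<open>1 / sqrt (ln n)\<close>, which is the rate in L1.
  In the expectation \<open>Y\<close> has mean 0 and drops out, and only the loss
  \<open>ln (ln n) / ln n\<close> from comparing distances with \<open>sqrt n\<close> is left. The
  tail bounds for fixed deviations are powers \<open>n powr (- c)\<close> with \<open>c\<close>
  possibly small, hence almost sure convergence is obtained along polynomial times and extended by
  monotonicity of the range. All estimates are made for a finitely supported law of histories;
  conditional expectations enter only in identifying this law with that of the given
  process.\<close>

text \<open>With \<open>s \<ge> 0\<close> defined by \<open>cosh s = 2 - cos t\<close>, that is \<open>sinh (s/2) = sin (t/2)\<close>, the three functions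
  are \<open>sinh (s/2)\<close>, \<open>cosh (s/2)\<close> and \<open>exp (- s)\<close>.  Integrating the Fourier representation of the
  potential kernel over the second frequency leaves a one-dimensional integral in these terms.\<close>

definition half_sin :: "real \<Rightarrow> real" where "half_sin t = sin (t / 2)"
definition half_cosh :: "real \<Rightarrow> real" where "half_cosh t = sqrt (1 + half_sin t ^ 2)"
definition decay :: "real \<Rightarrow> real" where "decay t = (half_cosh t - half_sin t) ^ 2"

lemma half_sin_bounds:
  assumes "t \<in> {0..pi}"
  shows "t / 4 \<le> half_sin t" "half_sin t \<le> t / 2" "0 \<le> half_sin t" "half_sin t \<le> 1"
    "\<bar>half_sin t - t / 2\<bar> \<le> t ^ 3 / 48"
proof -
  have "\<bar>sin (t/2) - (\<Sum>m<3. sin_coeff m * (t/2) ^ m)\<bar> \<le> inverse (fact 3) * \<bar>t/2\<bar> ^ 3"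
    by (rule Maclaurin_sin_bound)
  then show *: "\<bar>half_sin t - t / 2\<bar> \<le> t ^ 3 / 48"
    using assms by (simp add: half_sin_def eval_nat_numeral sin_coeff_def fact_numeral field_simps)
  have "pi \<le> 22/7" using pi_approx by simp
  then have t: "0 \<le> t" "t \<le> 22/7" using assms by auto
  have "t ^ 3 = t * (t * t)" by (simp add: eval_nat_numeral)
  also have "\<dots> \<le> t * ((22/7) * (22/7))" by (intro mult_mono) (use t in auto)
  finally have "t ^ 3 / 48 \<le> t / 4" using t by simp
  with * show "t / 4 \<le> half_sin t" by linarith
  then show "0 \<le> half_sin t" using t by linarith
  show "half_sin t \<le> t / 2" using t sin_x_le_x[of "t/2"] by (simp add: half_sin_def)
  show "half_sin t \<le> 1" by (simp add: half_sin_def)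
qed

lemma half_sin_pos: "0 < t \<Longrightarrow> t \<le> pi \<Longrightarrow> 0 < half_sin t"
  using half_sin_bounds(1)[of t] by force

lemma half_sin_mono: "0 \<le> s \<Longrightarrow> s \<le> t \<Longrightarrow> t \<le> pi \<Longrightarrow> half_sin s \<le> half_sin t"
  unfolding half_sin_def by (intro sin_monotone_2pi_le) auto

lemma half_cosh_sq: "half_cosh t ^ 2 = 1 + half_sin t ^ 2"
  by (simp add: half_cosh_def add_nonneg_nonneg)

lemma half_cosh_ge_1: "1 \<le> half_cosh t"
  by (simp add: half_cosh_def)

lemma half_cosh_pos: "0 < half_cosh t"
  using half_cosh_ge_1[of t] by linarith

lemma half_cosh_gt: "half_sin t < half_cosh t"
proof -
  have "\<bar>half_sin t\<bar> < half_cosh t"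
    unfolding half_cosh_def by (rule real_less_rsqrt) simp
  then show ?thesis by linarith
qed

lemma half_cosh_le: "half_cosh t \<le> 1 + half_sin t ^ 2 / 2"
  unfolding half_cosh_def by (rule real_le_lsqrt) (auto simp: power2_sum power_divide)

text \<open>These are \<open>1 + exp (- s)\<close> and \<open>1 - exp (- s)\<close> with
  \<open>exp (- s / 2)\<close> factored out. Their quotient is tanh (s/2), which links
  \<open>half_sin t / half_cosh t\<close> to \<open>decay t\<close> in the quadratic form.\<close>

lemma decay_alt:
  "1 + decay t = 2 * half_cosh t * (half_cosh t - half_sin t)"
  "1 - decay t = 2 * half_sin t * (half_cosh t - half_sin t)"
  using half_cosh_sq[of t] by (simp_all add: decay_def power2_eq_square algebra_simps)

lemma decay_pos: "0 < decay t"
  using half_cosh_gt[of t] by (simp add: decay_def)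

lemma decay_le_1: "t \<in> {0..pi} \<Longrightarrow> decay t \<le> 1"
proof -
  assume "t \<in> {0..pi}"
  then have "0 \<le> 1 - decay t"
    unfolding decay_alt using half_sin_bounds(3) half_cosh_gt[of t] by (simp add: less_imp_le)
  then show ?thesis by simp
qed

lemma half_cosh_diff_eq: "half_cosh t - half_sin t = 1 / (half_cosh t + half_sin t)"
proof -
  have "half_cosh t + half_sin t \<noteq> 0"
  proof -
    have "\<bar>half_sin t\<bar> < half_cosh t"
      unfolding half_cosh_def by (rule real_less_rsqrt) simp
    then show ?thesis by linarith
  qed
  then show ?thesis
    using half_cosh_sq[of t] by (simp add: field_simps power2_eq_square)
qed

text \<open>With \<open>u = half_sin t\<close> in [0, 1], \<open>exp (u / 2) <= 1 + u\<close> gives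
  \<open>exp (- s / 2) <= exp (- u / 2)\<close>. An exponent linear in \<open>t\<close> makes
  \<open>decay t ^ k\<close> a cutoff at frequency of order \<open>1 / k\<close>.\<close>

lemma decay_le_exp: "t \<in> {0..pi} \<Longrightarrow> decay t \<le> exp (- (t / 4))"
proof -
  assume t: "t \<in> {0..pi}"
  note u = half_sin_bounds[OF t]
  have "exp (half_sin t / 2) \<le> 1 + half_sin t / 2 + (half_sin t / 2)\<^sup>2"
    using u by (intro exp_bound) auto
  also have "(half_sin t / 2)\<^sup>2 \<le> half_sin t / 2 * 1"
    unfolding power2_eq_square using u by (intro mult_left_mono) auto
  finally have "exp (half_sin t / 2) \<le> 1 + half_sin t" by simp
  also have "\<dots> \<le> half_cosh t + half_sin t" using half_cosh_ge_1[of t] by simp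
  finally have "1 / (half_cosh t + half_sin t) \<le> 1 / exp (half_sin t / 2)"
    by (intro divide_left_mono) (use half_cosh_pos[of t] u in auto)
  then have "half_cosh t - half_sin t \<le> exp (- half_sin t / 2)"
    by (simp add: half_cosh_diff_eq exp_minus inverse_eq_divide)
  then have "decay t \<le> exp (- half_sin t / 2) ^ 2"
    unfolding decay_def using half_cosh_gt[of t] by (intro power_mono) auto
  also have "\<dots> = exp (- half_sin t)" by (simp add: exp_double[symmetric])
  also have "\<dots> \<le> exp (- (t/4))" using u by simp
  finally show ?thesis .
qed

lemma half_cosh_mono: "0 \<le> s \<Longrightarrow> s \<le> t \<Longrightarrow> t \<le> pi \<Longrightarrow> half_cosh s \<le> half_cosh t"
  unfolding half_cosh_def using half_sin_mono[of s t] half_sin_bounds(3)[of s]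
  by (auto intro!: power_mono)

lemma decay_antimono: "0 \<le> s \<Longrightarrow> s \<le> t \<Longrightarrow> t \<le> pi \<Longrightarrow> decay t \<le> decay s"
proof -
  assume *: "0 \<le> s" "s \<le> t" "t \<le> pi"
  have "1 / (half_cosh t + half_sin t) \<le> 1 / (half_cosh s + half_sin s)"
    using half_cosh_mono[OF *] half_sin_mono[OF *] half_cosh_pos[of s] half_cosh_pos[of t]
      half_sin_bounds(3)[of s] half_sin_bounds(3)[of t] *
    by (intro divide_left_mono) (auto intro!: mult_pos_pos add_pos_nonneg)
  then show ?thesis
    unfolding decay_def using half_cosh_gt[of t]
    by (intro power_mono) (auto simp: half_cosh_diff_eq[symmetric])
qed

lemma half_sin_measurable [measurable]: "half_sin \<in> borel_measurable borel"
  unfolding half_sin_def[abs_def] by simp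
lemma half_cosh_measurable [measurable]: "half_cosh \<in> borel_measurable borel"
  unfolding half_cosh_def[abs_def] by simp
lemma decay_measurable [measurable]: "decay \<in> borel_measurable borel"
  unfolding decay_def[abs_def] by simp

section \<open>Integral representation of the potential kernel\<close>

lemma bounded_measurable_integrable_on:
  fixes f :: "real \<Rightarrow> real"
  assumes "f \<in> borel_measurable borel" "\<And>x. x \<in> {a..b} \<Longrightarrow> \<bar>f x\<bar> \<le> B"
  shows "f integrable_on {a..b}"
proof -
  have "set_integrable lborel {a..b} f"
    unfolding set_integrable_def
    by (rule integrableI_bounded_set_indicator[where B = B])
      (use assms in \<open>auto simp: emeasure_lborel_Icc_eq\<close>)
  then show ?thesis by (rule set_borel_integral_eq_integral(1))
qed

lemma abs_sin_of_nat_mult_le: "\<bar>sin (of_nat n * x)\<bar> \<le> of_nat n * \<bar>sin (x::real)\<bar>"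
proof (induction n)
  case (Suc n)
  have "\<bar>sin (of_nat (Suc n) * x)\<bar> = \<bar>sin (of_nat n * x) * cos x + cos (of_nat n * x) * sin x\<bar>"
    by (simp add: algebra_simps sin_add)
  also have "\<dots> \<le> \<bar>sin (of_nat n * x)\<bar> * \<bar>cos x\<bar> + \<bar>cos (of_nat n * x)\<bar> * \<bar>sin x\<bar>"
    by (metis abs_mult abs_triangle_ineq)
  also have "\<dots> \<le> \<bar>sin (of_nat n * x)\<bar> * 1 + 1 * \<bar>sin x\<bar>"
    by (intro add_mono mult_mono) auto
  finally show ?case using Suc by (simp add: algebra_simps)
qed simp

text \<open>Using |sin (n x)| <= n |sin x| keeps the bound in terms of \<open>half_sin t\<close>, so
  that it cancels directly against the zero of the denominator of the potential integrand.\<close>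

lemma one_minus_cos_le: "1 - cos (real_of_int j * t) \<le> 2 * real_of_int j ^ 2 * half_sin t ^ 2"
proof -
  have "1 - cos (real_of_int j * t) = 2 * sin (real_of_int j * (t/2)) ^ 2"
    using cos_double_sin[of "real_of_int j * (t/2)"] by (simp add: algebra_simps)
  also have "sin (real_of_int j * (t/2)) ^ 2 = \<bar>sin (real (nat \<bar>j\<bar>) * (t/2))\<bar> ^ 2"
    by (cases "j \<ge> 0") (auto simp: power2_eq_square)
  also have "\<dots> \<le> (real (nat \<bar>j\<bar>) * \<bar>sin (t/2)\<bar>) ^ 2"
    by (intro power_mono abs_sin_of_nat_mult_le) auto
  also have "\<dots> = real_of_int j ^ 2 * half_sin t ^ 2"
    by (simp add: half_sin_def power_mult_distrib)
  finally show ?thesis by simp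
qed

text \<open>The denominator is sinh s: the mean of cos (k v) / (cosh s - cos v) over the second
  frequency v is \<open>decay t ^ nat |k|\<close> / sinh s. At \<open>t = 0\<close> it vanishes, and
  HOL division makes the value 0; one point does not affect the integral.\<close>

definition potential_integrand :: "int \<Rightarrow> int \<Rightarrow> real \<Rightarrow> real" where
  "potential_integrand j k t = (1 - decay t ^ nat \<bar>k\<bar> * cos (of_int j * t)) / (2 * half_sin t * half_cosh t)"

definition potential :: "int \<Rightarrow> int \<Rightarrow> real" where
  "potential j k = 2 / pi * integral {0..pi} (potential_integrand j k)"

lemma potential_integrand_measurable [measurable]: "potential_integrand j k \<in> borel_measurable borel"
  unfolding potential_integrand_def[abs_def] by measurable

text \<open>The numerator splits as
  \<open>(1 - decay t ^ k) + decay t ^ k * (1 - cos (j t))\<close>. Bernoulli's inequality bounds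
  the first part and \<open>one_minus_cos_le\<close> the second, each by a multiple of the
  denominator.\<close>

lemma potential_integrand_bounds:
  assumes "t \<in> {0..pi}"
  shows "0 \<le> potential_integrand j k t" "potential_integrand j k t \<le> of_int \<bar>k\<bar> + of_int j ^ 2"
proof -
  let ?k = "nat \<bar>k\<bar>" let ?u = "half_sin t" let ?q = "half_cosh t"
  note u = half_sin_bounds[OF assms]
  have d: "0 \<le> decay t" "decay t \<le> 1" using decay_pos[of t] decay_le_1[OF assms] by auto
  have p: "decay t ^ ?k \<le> 1" "0 \<le> decay t ^ ?k" using d by (auto intro: power_le_one)
  have "decay t ^ ?k * cos (of_int j * t) \<le> 1 * 1"
    using mult_left_mono[OF cos_le_one[of "of_int j * t"] p(2)] p(1) by simp
  then have "0 \<le> 1 - decay t ^ ?k * cos (of_int j * t)" by simp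
  then show "0 \<le> potential_integrand j k t"
    unfolding potential_integrand_def using u half_cosh_pos[of t] by simp
  have "1 + real ?k * (decay t - 1) \<le> (1 + (decay t - 1)) ^ ?k"
    by (rule Bernoulli_inequality) (use d in auto)
  then have b: "1 - decay t ^ ?k \<le> real ?k * (1 - decay t)" by (simp add: algebra_simps)
  also have "1 - decay t \<le> 2 * ?u * ?q"
    unfolding decay_alt using u by (intro mult_left_mono) auto
  finally have b: "1 - decay t ^ ?k \<le> real ?k * (2 * ?u * ?q)" by (simp add: mult_left_mono)
  have "decay t ^ ?k * (1 - cos (of_int j * t)) \<le> 1 * (2 * of_int j ^ 2 * ?u ^ 2)"
    by (intro mult_mono one_minus_cos_le) (use p in auto)
  also have "\<dots> = of_int j ^ 2 * (2 * ?u * ?u)" by (simp add: power2_eq_square)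
  also have "\<dots> \<le> of_int j ^ 2 * (2 * ?u * ?q)"
    using u half_cosh_ge_1[of t] by (intro mult_left_mono) auto
  finally have "1 - decay t ^ ?k * cos (of_int j * t) \<le> (real ?k + of_int j ^ 2) * (2 * ?u * ?q)"
    using b by (simp add: algebra_simps)
  then show "potential_integrand j k t \<le> of_int \<bar>k\<bar> + of_int j ^ 2"
    unfolding potential_integrand_def using u half_cosh_pos[of t]
    by (cases "?u = 0") (auto simp: divide_le_eq)
qed

lemma potential_integrand_integrable: "potential_integrand j k integrable_on {0..pi}"
  using potential_integrand_bounds
  by (intro bounded_measurable_integrable_on[where B = "of_int \<bar>k\<bar> + of_int j ^ 2"])
    (auto intro: abs_leI order_trans[OF _ potential_integrand_bounds(1)])

lemma potential_even: "potential (- j) k = potential j k" "potential j (- k) = potential j k"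
  by (simp_all add: potential_def potential_integrand_def[abs_def])

lemma potential_0_0: "potential 0 0 = 0"
  by (simp add: potential_def potential_integrand_def[abs_def])

lemma integral_cos_int:
  "integral {0..pi} (\<lambda>t. cos (of_int j * t)) = (if j = 0 then pi else 0)"
proof (cases "j = 0")
  case False
  have "((\<lambda>t. cos (of_int j * t)) has_integral (sin (of_int j * pi) / of_int j - sin (of_int j * 0) / of_int j)) {0..pi}"
    by (rule fundamental_theorem_of_calculus)
      (use False in \<open>auto intro!: derivative_eq_intros simp: has_real_derivative_iff_has_vector_derivative[symmetric]\<close>)
  then show ?thesis using False by (simp add: integral_unique sin_zero_iff_int2) 
qed simp

text \<open>At 0 the integrands take default values of division by zero, so algebraic identities
  between them are only available for positive \<open>t\<close>.\<close>

lemma integral_cong_pos: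
  fixes f :: "real \<Rightarrow> real"
  assumes "\<And>t. 0 < t \<Longrightarrow> t \<le> pi \<Longrightarrow> f t = g t"
  shows "integral {0..pi} f = integral {0..pi} g"
  by (rule integral_spike[of "{0}"]) (use assms in auto)

lemma cos_eq_half_sin: "cos t = 1 - 2 * half_sin t ^ 2"
  using cos_double_sin[of "t/2"] by (simp add: half_sin_def)

lemma cos_shift:
  "cos (of_int (j + 1) * t) + cos (of_int (j - 1) * t) = 2 * cos (t::real) * cos (of_int j * t)"
  by (simp only: of_int_add of_int_diff of_int_1 distrib_right left_diff_distrib mult_1_left cos_add cos_diff)
    (simp add: algebra_simps)

text \<open>\<open>decay t\<close> is a root of z^2 - 2 (cosh s) z + 1, so the recurrence is
  homogeneous away from \<open>k = 0\<close>. The kink of |k| at 0 leaves the extra term, the source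
  of the unit mass in the Laplacian.\<close>

lemma decay_shift:
  "decay t ^ nat \<bar>k + 1\<bar> + decay t ^ nat \<bar>k - 1\<bar>
    = (2 + 4 * half_sin t ^ 2) * decay t ^ nat \<bar>k\<bar> - (if k = 0 then 4 * half_sin t * half_cosh t else 0)"
proof (cases "k = 0")
  case True
  then show ?thesis
    using decay_alt(2)[of t] by (simp add: power2_eq_square algebra_simps)
next
  case False
  have q: "half_cosh t ^ 2 = 1 + half_sin t ^ 2" by (rule half_cosh_sq)
  have "decay t ^ 2 + 1 = (2 + 4 * half_sin t ^ 2) * decay t"
    unfolding decay_def using q by algebra
  then have "(decay t ^ 2 + 1) * decay t ^ m = (2 + 4 * half_sin t ^ 2) * decay t * decay t ^ m" for m
    by simp
  then have *: "decay t ^ (Suc (Suc m)) + decay t ^ m = (2 + 4 * half_sin t ^ 2) * decay t ^ (Suc m)" for m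
    by (simp only: power_Suc power2_eq_square distrib_right mult.assoc mult_1_left)
  obtain m where m: "nat \<bar>k\<bar> = Suc m" using False by (cases "nat \<bar>k\<bar>") auto
  have "{nat \<bar>k + 1\<bar>, nat \<bar>k - 1\<bar>} = {Suc (Suc m), m} \<and> nat \<bar>k + 1\<bar> \<noteq> nat \<bar>k - 1\<bar>"
    using m by (cases "k > 0") auto
  then have "decay t ^ nat \<bar>k + 1\<bar> + decay t ^ nat \<bar>k - 1\<bar> = decay t ^ (Suc (Suc m)) + decay t ^ m"
    by (auto simp: doubleton_eq_iff)
  then show ?thesis using False m * by simp
qed

text \<open>Five terms are what the Laplacian needs; shorter combinations are padded with zero
  coefficients.\<close>

lemma potential_linear_combination:
  "c1 * potential j1 k1 + c2 * potential j2 k2 + c3 * potential j3 k3 + c4 * potential j4 k4 + c5 * potential j5 k5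
   = 2 / pi * integral {0..pi} (\<lambda>t. c1 * potential_integrand j1 k1 t + c2 * potential_integrand j2 k2 t
       + c3 * potential_integrand j3 k3 t + c4 * potential_integrand j4 k4 t + c5 * potential_integrand j5 k5 t)"
proof -
  have "((\<lambda>t. c1 * potential_integrand j1 k1 t + c2 * potential_integrand j2 k2 t
       + c3 * potential_integrand j3 k3 t + c4 * potential_integrand j4 k4 t + c5 * potential_integrand j5 k5 t)
     has_integral (c1 * integral {0..pi} (potential_integrand j1 k1) + c2 * integral {0..pi} (potential_integrand j2 k2)
       + c3 * integral {0..pi} (potential_integrand j3 k3) + c4 * integral {0..pi} (potential_integrand j4 k4)
       + c5 * integral {0..pi} (potential_integrand j5 k5))) {0..pi}"
    by (intro has_integral_add has_integral_mult_right integrable_integral potential_integrand_integrable)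
  then show ?thesis
    by (simp only: integral_unique potential_def) (simp add: field_simps)
qed

lemma potential_laplacian:
  "(potential (j + 1) k + potential (j - 1) k + potential j (k + 1) + potential j (k - 1)) / 4 - potential j k
    = (if j = 0 \<and> k = 0 then 1 else 0)"
proof -
  have "(potential (j + 1) k + potential (j - 1) k + potential j (k + 1) + potential j (k - 1)) / 4 - potential j k
     = 1/4 * potential (j + 1) k + 1/4 * potential (j - 1) k + 1/4 * potential j (k + 1) + 1/4 * potential j (k - 1) + (-1) * potential j k"
    by simp
  also have "\<dots> = 2 / pi * integral {0..pi} (\<lambda>t. (if k = 0 then 1 else 0) * cos (of_int j * t) / 2)"
    unfolding potential_linear_combination
  proof (intro arg_cong2[where f = "(*)"] refl integral_cong_pos)
    fix t :: real assume t: "0 < t" "t \<le> pi"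
    have pos: "half_sin t \<noteq> 0" "half_cosh t \<noteq> 0" using half_sin_pos[OF t] half_cosh_pos[of t] by auto
    let ?D = "2 * half_sin t * half_cosh t"
    let ?c = "\<lambda>j. cos (of_int j * t)" let ?r = "\<lambda>k. decay t ^ nat \<bar>k\<bar>"
    have "1/4 * potential_integrand (j + 1) k t + 1/4 * potential_integrand (j - 1) k t
       + 1/4 * potential_integrand j (k + 1) t + 1/4 * potential_integrand j (k - 1) t + (-1) * potential_integrand j k t
      = (4 * (?r k * ?c j) - ?r k * (?c (j + 1) + ?c (j - 1)) - (?r (k + 1) + ?r (k - 1)) * ?c j) / (4 * ?D)"
      unfolding potential_integrand_def using pos by (simp add: field_simps)
    \<comment> \<open>By \<open>cos t + cosh s = 2\<close> everything cancels except the kink term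
      at \<open>k = 0\<close>; its integral over \<open>t\<close> then selects
      \<open>j = 0\<close>.\<close>
    also have "\<dots> = (if k = 0 then 1 else 0) * cos (of_int j * t) / 2"
      unfolding cos_shift decay_shift cos_eq_half_sin[of t] using pos by (simp add: field_simps)
    finally show "1/4 * potential_integrand (j + 1) k t + 1/4 * potential_integrand (j - 1) k t
       + 1/4 * potential_integrand j (k + 1) t + 1/4 * potential_integrand j (k - 1) t + (-1) * potential_integrand j k t
      = (if k = 0 then 1 else 0) * cos (of_int j * t) / 2" .
  qed
  also have "\<dots> = (if j = 0 \<and> k = 0 then 1 else 0)"
    using integral_cos_int[of j] by (cases "k = 0") auto
  finally show ?thesis .
qed

section \<open>Gradient bounds by damping and oscillation\<close>

lemma abs_integral_antimono_mult_le:
  fixes f g :: "real \<Rightarrow> real"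
  assumes f: "f integrable_on {0..pi}" and B: "\<And>c. c \<in> {0..pi} \<Longrightarrow> \<bar>integral {0..c} f\<bar> \<le> B"
    and g: "\<And>s t. 0 \<le> s \<Longrightarrow> s \<le> t \<Longrightarrow> t \<le> pi \<Longrightarrow> g t \<le> g s"
    and g0: "g 0 \<le> 1" "0 \<le> g pi"
  shows "\<bar>integral {0..pi} (\<lambda>t. g t * f t)\<bar> \<le> 3 * B"
proof -
  \<comment> \<open>The second mean value theorem, applied to the increasing function
    \<open>- g\<close>, leaves an initial integral of \<open>f\<close>, at most \<open>B\<close>,
    and a final one, at most \<open>2 * B\<close> as a difference of two initial ones; hence the
    factor 3.\<close>
  obtain c where c: "c \<in> {0..pi}"
    "integral {0..pi} (\<lambda>t. - g t * f t) = - g 0 * integral {0..c} f + - g pi * integral {c..pi} f"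
    using second_mean_value_theorem[OF f, of "\<lambda>t. - g t"] g by auto
  have "integral {0..c} f + integral {c..pi} f = integral {0..pi} f"
    using c(1) f by (intro Henstock_Kurzweil_Integration.integral_combine) auto
  then have 2: "\<bar>integral {c..pi} f\<bar> \<le> 2 * B" using B[OF c(1)] B[of pi] by auto
  have g': "0 \<le> g 0" "g pi \<le> 1" using g[of 0 pi] g0 by auto
  have "\<bar>g 0 * integral {0..c} f\<bar> \<le> 1 * B" "\<bar>g pi * integral {c..pi} f\<bar> \<le> 1 * (2 * B)"
    unfolding abs_mult by (intro mult_mono; use g' g0 2 B[OF c(1)] in simp)+
  then show ?thesis using c(2) by auto
qed

lemma half_ratio_mono:
  "0 \<le> s \<Longrightarrow> s \<le> t \<Longrightarrow> t \<le> pi \<Longrightarrow> half_sin s / half_cosh s \<le> half_sin t / half_cosh t"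
proof -
  assume *: "0 \<le> s" "s \<le> t" "t \<le> pi"
  have "half_sin s * half_cosh t \<le> half_sin t * half_cosh s"
  proof (rule power2_le_imp_le)
    have "half_sin s ^ 2 \<le> half_sin t ^ 2"
      using half_sin_mono[OF *] half_sin_bounds(3)[of s] * by (intro power_mono) auto
    then show "(half_sin s * half_cosh t)\<^sup>2 \<le> (half_sin t * half_cosh s)\<^sup>2"
      by (simp add: power_mult_distrib half_cosh_sq distrib_left)
    show "0 \<le> half_sin t * half_cosh s"
      using half_sin_bounds(3)[of t] half_cosh_pos[of s] * by simp
  qed
  then show ?thesis using half_cosh_pos[of s] half_cosh_pos[of t] by (simp add: field_simps)
qed

lemma half_ratio_bounds: "t \<in> {0..pi} \<Longrightarrow> 0 \<le> half_sin t / half_cosh t" "half_sin t / half_cosh t \<le> 1"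
  using half_sin_bounds(3)[of t] half_cosh_pos[of t] half_cosh_gt[of t] by (auto simp: divide_le_eq)

lemma decay_power_antimono:
  "0 \<le> s \<Longrightarrow> s \<le> t \<Longrightarrow> t \<le> pi \<Longrightarrow> decay t ^ n \<le> decay s ^ n"
  using decay_antimono decay_pos[of t] by (intro power_mono) (auto intro: less_imp_le)

lemma decay_power_bounds: "t \<in> {0..pi} \<Longrightarrow> 0 \<le> decay t ^ n" "t \<in> {0..pi} \<Longrightarrow> decay t ^ n \<le> 1"
  using decay_pos[of t] decay_le_1[of t] by (auto simp: power_le_one)

lemma decay_power_le_exp: "t \<in> {0..pi} \<Longrightarrow> decay t ^ n \<le> exp (- (of_nat n * t / 4))"
proof -
  assume "t \<in> {0..pi}"
  then have "decay t ^ n \<le> exp (- (t / 4)) ^ n"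
    using decay_le_exp decay_pos[of t] by (intro power_mono) (auto intro: less_imp_le)
  then show ?thesis by (simp add: exp_of_nat_mult[symmetric])
qed

lemma integral_exp_le:
  assumes "0 < c" "0 \<le> a" "a \<le> b"
  shows "integral {a..b} (\<lambda>t. exp (- (c * t))) \<le> 1 / (c::real)"
proof -
  have "((\<lambda>t. exp (- (c * t))) has_integral (- exp (- (c * b)) / c - (- exp (- (c * a)) / c))) {a..b}"
    by (rule fundamental_theorem_of_calculus)
      (use assms in \<open>auto intro!: derivative_eq_intros simp: has_real_derivative_iff_has_vector_derivative[symmetric]\<close>)
  then have "integral {a..b} (\<lambda>t. exp (- (c * t))) = (exp (- (c * a)) - exp (- (c * b))) / c"
    using integral_unique by (force simp: diff_divide_distrib)
  also have "\<dots> \<le> 1 / c"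
  proof (intro divide_right_mono)
    have "exp (- (c * a)) \<le> 1" using assms by simp
    then show "exp (- (c * a)) - exp (- (c * b)) \<le> 1" using exp_gt_zero[of "- (c * b)"] by linarith
  qed (use assms in simp)
  finally show ?thesis .
qed

lemma abs_integral_decay_le:
  fixes f :: "real \<Rightarrow> real"
  assumes [measurable]: "f \<in> borel_measurable borel" and f: "\<And>t. t \<in> {0..pi} \<Longrightarrow> \<bar>f t\<bar> \<le> 1"
  shows "\<bar>integral {0..pi} (\<lambda>t. decay t ^ n * f t)\<bar> \<le> pi"
    and "n > 0 \<Longrightarrow> \<bar>integral {0..pi} (\<lambda>t. decay t ^ n * f t)\<bar> \<le> 4 / n"
proof -
  have le: "\<bar>decay t ^ n * f t\<bar> \<le> exp (- (of_nat n / 4 * t))" if "t \<in> {0..pi}" for t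
  proof -
    have "\<bar>decay t ^ n * f t\<bar> \<le> exp (- (of_nat n * t / 4)) * 1"
      unfolding abs_mult using decay_power_le_exp[OF that, of n] decay_power_bounds[OF that, of n] f[OF that]
      by (intro mult_mono) auto
    then show ?thesis by simp
  qed
  have le1: "\<bar>decay t ^ n * f t\<bar> \<le> 1" if "t \<in> {0..pi}" for t
    using le[OF that] that by (auto intro: order_trans)
  have int: "(\<lambda>t. decay t ^ n * f t) integrable_on {0..pi}"
    by (rule bounded_measurable_integrable_on[OF _ le1]) simp_all
  have "norm (integral {0..pi} (\<lambda>t. decay t ^ n * f t)) \<le> integral {0..pi} (\<lambda>t. 1)"
    by (rule integral_norm_bound_integral[OF int]) (use le1 in auto)
  then show "\<bar>integral {0..pi} (\<lambda>t. decay t ^ n * f t)\<bar> \<le> pi" by simp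
  assume n: "n > 0"
  have "norm (integral {0..pi} (\<lambda>t. decay t ^ n * f t)) \<le> integral {0..pi} (\<lambda>t. exp (- (of_nat n / 4 * t)))"
    by (rule integral_norm_bound_integral[OF int])
      (use le in \<open>auto intro!: integrable_continuous_interval continuous_intros\<close>)
  also have "\<dots> \<le> 1 / (of_nat n / 4)"
    by (rule integral_exp_le) (use n in auto)
  finally show "\<bar>integral {0..pi} (\<lambda>t. decay t ^ n * f t)\<bar> \<le> 4 / n" by simp
qed

lemma integral_sin_cos_initial_le:
  fixes a c :: real
  assumes "a \<noteq> 0" "0 \<le> c"
  shows "\<bar>integral {0..c} (\<lambda>t. cos (a * t))\<bar> \<le> 1 / \<bar>a\<bar>"
    "\<bar>integral {0..c} (\<lambda>t. sin (a * t))\<bar> \<le> 2 / \<bar>a\<bar>"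
proof -
  have "((\<lambda>t. cos (a * t)) has_integral (sin (a * c) / a - sin (a * 0) / a)) {0..c}"
    by (rule fundamental_theorem_of_calculus[where f = "\<lambda>t. sin (a * t) / a"])
      (use assms in \<open>auto intro!: derivative_eq_intros simp: has_real_derivative_iff_has_vector_derivative[symmetric]\<close>)
  then have "integral {0..c} (\<lambda>t. cos (a * t)) = sin (a * c) / a" by (simp add: integral_unique)
  then show "\<bar>integral {0..c} (\<lambda>t. cos (a * t))\<bar> \<le> 1 / \<bar>a\<bar>"
    by (simp add: divide_right_mono)
  have "((\<lambda>t. sin (a * t)) has_integral (- cos (a * c) / a - (- cos (a * 0) / a))) {0..c}"
    by (rule fundamental_theorem_of_calculus[where f = "\<lambda>t. - cos (a * t) / a"])
      (use assms in \<open>auto intro!: derivative_eq_intros simp: has_real_derivative_iff_has_vector_derivative[symmetric]\<close>)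
  then have "integral {0..c} (\<lambda>t. sin (a * t)) = (1 - cos (a * c)) / a"
    by (simp add: integral_unique diff_divide_distrib)
  moreover have "\<bar>1 - cos (a * c)\<bar> \<le> 2" using cos_ge_minus_one[of "a * c"] cos_le_one[of "a*c"] by linarith
  ultimately show "\<bar>integral {0..c} (\<lambda>t. sin (a * t))\<bar> \<le> 2 / \<bar>a\<bar>"
    by (simp add: divide_right_mono)
qed

lemma potential_diff_eq:
  "potential j1 k1 - potential j2 k2
   = 2 / pi * integral {0..pi} (\<lambda>t. potential_integrand j1 k1 t - potential_integrand j2 k2 t)"
  using potential_linear_combination[of 1 j1 k1 "-1" j2 k2 0 0 0 0 0 0 0 0 0] by simp

text \<open>The difference of the integrands is
  \<open>decay t ^ k * (1 - tanh (s/2)) * cos (j t)\<close>. Exponential damping bounds the integral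
  by \<open>4 / k\<close>; since the weight is decreasing, oscillation of the cosine bounds it by
  \<open>3 / |j|\<close>. The condition \<open>0 <= k\<close> ensures |k + 1| = |k| + 1.\<close>

lemma vertical_gradient_le:
  fixes j k :: int
  assumes "0 \<le> k"
  shows "\<bar>potential j (k + 1) - potential j k\<bar> \<le> 24 / (1 + of_int (max \<bar>j\<bar> \<bar>k\<bar>))"
proof -
  let ?g = "\<lambda>t. decay t ^ nat k * (1 - half_sin t / half_cosh t)"
  let ?I = "integral {0..pi} (\<lambda>t. ?g t * cos (of_int j * t))"
  have E: "potential j (k + 1) - potential j k = 2 / pi * ?I"
    unfolding potential_diff_eq
  proof (intro arg_cong2[where f = "(*)"] refl integral_cong_pos)
    fix t :: real assume t: "0 < t" "t \<le> pi"
    have pos: "half_sin t \<noteq> 0" "half_cosh t \<noteq> 0" using half_sin_pos[OF t] half_cosh_pos[of t] by auto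
    have k: "nat \<bar>k + 1\<bar> = Suc (nat k)" "nat \<bar>k\<bar> = nat k" using assms by auto
    have "potential_integrand j (k + 1) t - potential_integrand j k t
      = decay t ^ nat k * (1 - decay t) * cos (of_int j * t) / (2 * half_sin t * half_cosh t)"
      unfolding potential_integrand_def k using pos by (simp add: field_simps)
    also have "\<dots> = ?g t * cos (of_int j * t)"
      unfolding decay_alt using pos by (simp add: field_simps)
    finally show "potential_integrand j (k + 1) t - potential_integrand j k t = ?g t * cos (of_int j * t)" .
  qed
  have F: "\<bar>2 / pi * ?I\<bar> \<le> 1 * \<bar>?I\<bar>"
    unfolding abs_mult using pi_ge_two by (intro mult_right_mono) auto
  have A: "\<bar>?I\<bar> \<le> pi" "k \<noteq> 0 \<Longrightarrow> \<bar>?I\<bar> \<le> 4 / nat k"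
  proof -
    let ?f = "\<lambda>t. (1 - half_sin t / half_cosh t) * cos (of_int j * t)"
    have "\<bar>?f t\<bar> \<le> 1 * 1" if "t \<in> {0..pi}" for t
      unfolding abs_mult using half_ratio_bounds[of t] that by (intro mult_mono) auto
    then have f: "\<bar>?f t\<bar> \<le> 1" if "t \<in> {0..pi}" for t using that by simp
    have "?f \<in> borel_measurable borel" by measurable
    from abs_integral_decay_le[OF this f, of "nat k"] assms
    show "\<bar>?I\<bar> \<le> pi" "k \<noteq> 0 \<Longrightarrow> \<bar>?I\<bar> \<le> 4 / nat k" by (simp_all add: mult.assoc)
  qed
  have B: "\<bar>?I\<bar> \<le> 3 / \<bar>of_int j\<bar>" if "j \<noteq> 0"
  proof -
    have "\<bar>?I\<bar> \<le> 3 * (1 / \<bar>of_int j\<bar>)"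
    proof (rule abs_integral_antimono_mult_le)
      show "(\<lambda>t. cos (real_of_int j * t)) integrable_on {0..pi}"
        by (intro integrable_continuous_interval continuous_intros)
      show "?g t \<le> ?g s" if "0 \<le> s" "s \<le> t" "t \<le> pi" for s t
        using decay_power_antimono[OF that] half_ratio_mono[OF that] half_ratio_bounds[of t]
          decay_power_bounds[of s "nat k"] that
        by (intro mult_mono) auto
    qed (use that integral_sin_cos_initial_le[of "of_int j"] in \<open>auto simp: half_sin_def half_cosh_def decay_def\<close>)
    then show ?thesis by simp
  qed
  have *: "\<bar>potential j (k + 1) - potential j k\<bar> \<le> \<bar>?I\<bar>" using F unfolding E by linarith
  \<comment> \<open>12 dominates the constants 4 and 3 of the two bounds; replacing \<open>m\<close>
    by \<open>1 + m\<close>, which admits the origin, doubles it to 24.\<close>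
  have mono: "12 / m \<le> 24 / (1 + m)" if "m \<ge> 1" for m :: real using that by (simp add: field_simps)
  consider "j = 0" "k = 0" | "\<bar>j\<bar> \<le> \<bar>k\<bar>" "k \<noteq> 0" | "\<bar>k\<bar> < \<bar>j\<bar>" "j \<noteq> 0" by linarith
  then show ?thesis
  proof cases
    case 1
    then show ?thesis using * A(1) pi_less_4 by simp
  next
    case 2
    have "\<bar>?I\<bar> \<le> 12 / of_int k" using A(2)[OF 2(2)] assms 2 by (simp add: field_simps)
    also have "\<dots> \<le> 24 / (1 + of_int k)" using assms 2 by (intro mono) auto
    finally show ?thesis using * 2 assms by (simp add: max_def)
  next
    case 3
    have "\<bar>?I\<bar> \<le> 12 / of_int \<bar>j\<bar>" using B[OF 3(2)] 3 by (simp add: field_simps)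
    also have "\<dots> \<le> 24 / (1 + of_int \<bar>j\<bar>)" using 3 by (intro mono) auto
    finally show ?thesis using * 3 by (simp add: max_def)
  qed
qed

text \<open>A difference of neighbouring cosines is
  \<open>2 * sin ((j + 1/2) t) * half_sin t\<close>; the last factor cancels the zero of the
  denominator and leaves the decreasing weight \<open>decay t ^ nat |k| / half_cosh t\<close>.
  Damping then gives the decay in \<open>k\<close>, oscillation the decay in
  \<open>j\<close>.\<close>

lemma horizontal_gradient_le:
  fixes j k :: int
  shows "\<bar>potential (j + 1) k - potential j k\<bar> \<le> 24 / (1 + of_int (max \<bar>j\<bar> \<bar>k\<bar>))"
proof -
  let ?a = "of_int j + 1 / 2 :: real"
  let ?g = "\<lambda>t. decay t ^ nat \<bar>k\<bar> * (1 / half_cosh t)"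
  let ?I = "integral {0..pi} (\<lambda>t. ?g t * sin (?a * t))"
  have E: "potential (j + 1) k - potential j k = 2 / pi * ?I"
    unfolding potential_diff_eq
  proof (intro arg_cong2[where f = "(*)"] refl integral_cong_pos)
    fix t :: real assume t: "0 < t" "t \<le> pi"
    have pos: "half_sin t \<noteq> 0" "half_cosh t \<noteq> 0" using half_sin_pos[OF t] half_cosh_pos[of t] by auto
    have "cos (of_int j * t) - cos (of_int (j + 1) * t) = cos (?a * t - t / 2) - cos (?a * t + t / 2)"
      by (intro arg_cong2[where f = "(-)"] arg_cong[where f = cos]) (simp_all add: algebra_simps)
    also have "\<dots> = 2 * sin (?a * t) * half_sin t"
      unfolding half_sin_def cos_add cos_diff by simp
    finally have c: "cos (of_int j * t) - cos (of_int (j + 1) * t) = 2 * sin (?a * t) * half_sin t" .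
    have "potential_integrand (j + 1) k t - potential_integrand j k t
      = decay t ^ nat \<bar>k\<bar> * (cos (of_int j * t) - cos (of_int (j + 1) * t)) / (2 * half_sin t * half_cosh t)"
      unfolding potential_integrand_def using pos by (simp add: field_simps)
    also have "\<dots> = ?g t * sin (?a * t)"
      unfolding c using pos by (simp add: field_simps)
    finally show "potential_integrand (j + 1) k t - potential_integrand j k t = ?g t * sin (?a * t)" .
  qed
  have F: "\<bar>2 / pi * ?I\<bar> \<le> 1 * \<bar>?I\<bar>"
    unfolding abs_mult using pi_ge_two by (intro mult_right_mono) auto
  have A: "\<bar>?I\<bar> \<le> pi" "k \<noteq> 0 \<Longrightarrow> \<bar>?I\<bar> \<le> 4 / nat \<bar>k\<bar>"
  proof -
    let ?f = "\<lambda>t. 1 / half_cosh t * sin (?a * t)"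
    have "\<bar>?f t\<bar> \<le> 1 * 1" if "t \<in> {0..pi}" for t
      unfolding abs_mult using half_cosh_ge_1[of t] that by (intro mult_mono) auto
    then have f: "\<bar>?f t\<bar> \<le> 1" if "t \<in> {0..pi}" for t using that by simp
    have "?f \<in> borel_measurable borel" by measurable
    from abs_integral_decay_le[OF this f, of "nat \<bar>k\<bar>"]
    show "\<bar>?I\<bar> \<le> pi" "k \<noteq> 0 \<Longrightarrow> \<bar>?I\<bar> \<le> 4 / nat \<bar>k\<bar>" by (simp_all add: mult.assoc)
  qed
  have B: "\<bar>?I\<bar> \<le> 12 / \<bar>of_int j\<bar>" if "j \<noteq> 0"
  proof -
    have ja: "\<bar>of_int j\<bar> / 2 \<le> \<bar>?a\<bar>"
    proof (cases "j > 0")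
      case False
      then have "real_of_int j \<le> -1" using that by linarith
      then show ?thesis by linarith
    qed simp
    then have a0: "?a \<noteq> 0" using that by auto
    have "\<bar>?I\<bar> \<le> 3 * (2 / \<bar>?a\<bar>)"
    proof (rule abs_integral_antimono_mult_le)
      show "(\<lambda>t. sin (?a * t)) integrable_on {0..pi}"
        by (intro integrable_continuous_interval continuous_intros)
      show "?g t \<le> ?g s" if "0 \<le> s" "s \<le> t" "t \<le> pi" for s t
        using decay_power_antimono[OF that] half_cosh_mono[OF that] half_cosh_pos[of s] half_cosh_pos[of t]
          decay_power_bounds[of s "nat \<bar>k\<bar>"] that
        by (intro mult_mono divide_left_mono) auto
      show "\<bar>integral {0..c} (\<lambda>t. sin (?a * t))\<bar> \<le> 2 / \<bar>?a\<bar>" if "c \<in> {0..pi}" for c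
        using integral_sin_cos_initial_le(2)[OF a0, of c] that by simp
    qed (auto simp: half_sin_def half_cosh_def decay_def)
    also have "\<dots> \<le> 3 * (2 / (\<bar>of_int j\<bar> / 2))"
      using ja that by (intro mult_left_mono divide_left_mono) auto
    finally show ?thesis by simp
  qed
  have *: "\<bar>potential (j + 1) k - potential j k\<bar> \<le> \<bar>?I\<bar>" using F unfolding E by linarith
  have mono: "12 / m \<le> 24 / (1 + m)" if "m \<ge> 1" for m :: real using that by (simp add: field_simps)
  consider "j = 0" "k = 0" | "\<bar>j\<bar> \<le> \<bar>k\<bar>" "k \<noteq> 0" | "\<bar>k\<bar> < \<bar>j\<bar>" "j \<noteq> 0" by linarith
  then show ?thesis
  proof cases
    case 1
    then show ?thesis using * A(1) pi_less_4 by simp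
  next
    case 2
    have "\<bar>?I\<bar> \<le> 12 / of_int \<bar>k\<bar>" using A(2)[OF 2(2)] 2 by (simp add: field_simps)
    also have "\<dots> \<le> 24 / (1 + of_int \<bar>k\<bar>)" using 2 by (intro mono) auto
    finally show ?thesis using * 2 by (simp add: max_def)
  next
    case 3
    have "\<bar>?I\<bar> \<le> 12 / of_int \<bar>j\<bar>" using B[OF 3(2)] 3 by (simp add: field_simps)
    also have "\<dots> \<le> 24 / (1 + of_int \<bar>j\<bar>)" using 3 by (intro mono) auto
    finally show ?thesis using * 3 by (simp add: max_def)
  qed
qed

text \<open>Below the frequency \<open>c = 1 / k\<close> the integrand is at most \<open>k\<close>
  and contributes at most 1. Above it, it is \<open>1 / t\<close> up to an error whose integral is
  bounded uniformly in \<open>k\<close>, and \<open>1 / t\<close> integrates over [c, pi] to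
  \<open>ln k + ln pi\<close>.\<close>

lemma potential_0_bounds:
  assumes "k > 0"
  shows "\<bar>potential 0 (int k) - 2 / pi * ln k\<bar> \<le> 12"
proof -
  let ?f = "potential_integrand 0 (int k)"
  define c where "c = 1 / real k"
  have c: "0 < c" "c \<le> 1" using assms by (auto simp: c_def field_simps)
  then have "c \<le> pi" using pi_ge_two by linarith
  note c = c this
  have fint: "?f integrable_on {0..pi}" by (rule potential_integrand_integrable)
  have i1: "?f integrable_on {0..c}" "?f integrable_on {c..pi}"
    using fint c by (auto intro: integrable_subinterval_real)
  have split: "integral {0..pi} ?f = integral {0..c} ?f + integral {c..pi} ?f"
    using c fint by (intro Henstock_Kurzweil_Integration.integral_combine[symmetric]) auto
  have "integral {0..c} ?f \<le> integral {0..c} (\<lambda>_. real k)"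
    using potential_integrand_bounds(2)[of _ 0 "int k"] c by (intro integral_le i1) auto
  then have u1: "integral {0..c} ?f \<le> 1" using c assms by (simp add: c_def)
  have l1: "0 \<le> integral {0..c} ?f"
    using potential_integrand_bounds(1) c by (intro integral_nonneg i1) auto
  have il: "((\<lambda>t. 1 / t) has_integral (ln pi - ln c)) {c..pi}"
    by (rule fundamental_theorem_of_calculus)
      (use c in \<open>auto intro!: derivative_eq_intros simp: has_real_derivative_iff_has_vector_derivative[symmetric]\<close>)
  have lc: "ln c = - ln k" using assms by (simp add: c_def ln_div)
  have ptw: "?f t \<le> 1 / t + 1" "1 / t - 1 - 2 * real k * exp (- (real k / 4 * t)) \<le> ?f t" if "t \<in> {c..pi}" for t
  proof -
    have t0: "t \<in> {0..pi}" "0 < t" "t < 4" using that c pi_less_4 by auto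
    note u = half_sin_bounds[OF t0(1)]
    let ?u = "half_sin t" let ?q = "half_cosh t"
    have up: "0 < ?u" using u(1) t0 by linarith
    have q: "1 \<le> ?q" by (rule half_cosh_ge_1)
    have f: "?f t = (1 - decay t ^ k) / (2 * ?u * ?q)" by (simp add: potential_integrand_def)
    have dk: "0 \<le> decay t ^ k" "decay t ^ k \<le> 1" using decay_power_bounds t0 by auto
    have "?f t \<le> 1 / (2 * ?u)"
    proof -
      have "?f t \<le> 1 / (2 * ?u * ?q)" unfolding f using dk up q by (intro divide_right_mono) auto
      also have "\<dots> \<le> 1 / (2 * ?u)" using up q by (intro divide_left_mono) auto
      finally show ?thesis .
    qed
    also have "\<dots> \<le> 1 / t + 1"
    proof -
      have a: "t - 2 * ?u \<le> t ^ 3 / 24" using u(5) by linarith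
      also have "\<dots> = t * (t * t) / 24" by (simp add: eval_nat_numeral)
      also have "\<dots> \<le> t * (4 * t) / 24" using t0 by (intro divide_right_mono mult_left_mono mult_right_mono) auto
      also have "\<dots> \<le> t * (t / 4 * 2)" using t0 by simp
      also have "\<dots> \<le> t * (2 * ?u)" using u(1) t0 by (intro mult_left_mono) auto
      finally show ?thesis using t0 up by (simp add: field_simps)
    qed
    finally show "?f t \<le> 1 / t + 1" .
    have b1: "1 / t - 1 \<le> 1 / (2 * ?u * ?q)"
    proof -
      have uu: "?u ^ 2 \<le> (t/2) ^ 2" using u by (intro power_mono) auto
      have "2 * ?u * ?q \<le> 2 * (t / 2) * (1 + (t/2)^2/2)"
        using u half_cosh_le[of t] uu q t0 by (intro mult_mono) (linarith | simp)+
      also have "\<dots> = t * (1 + t * t / 8)" by (simp add: power2_eq_square)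
      also have "\<dots> \<le> t * (1 + t)" using t0 by (intro mult_left_mono) auto
      finally have "1 / (t * (1 + t)) \<le> 1 / (2 * ?u * ?q)"
        using up half_cosh_pos[of t] t0 by (intro divide_left_mono) auto
      moreover have "1 / t - 1 \<le> 1 / (t * (1 + t))"
      proof -
        have "(1 - t) * (1 + t) \<le> 1" by (simp add: algebra_simps)
        then have "1 - t \<le> 1 / (1 + t)" using t0 by (simp add: le_divide_eq)
        then have "(1 - t) / t \<le> (1 / (1 + t)) / t" using t0 by (intro divide_right_mono) auto
        then show ?thesis using t0 by (simp add: diff_divide_distrib mult.commute)
      qed
      ultimately show ?thesis by linarith
    qed
    have "decay t ^ k / (2 * ?u * ?q) \<le> exp (- (real k / 4 * t)) / (2 * ?u * ?q)"
      using decay_power_le_exp[OF t0(1), of k] up q by (intro divide_right_mono) auto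
    \<comment> \<open>For \<open>t >= c\<close> the denominator is at least
      \<open>2 * (c / 4)\<close>. The exponential integrates to at most \<open>4 / k\<close>, so
      this term costs at most 8.\<close>
    also have "\<dots> \<le> exp (- (real k / 4 * t)) / (2 * (c / 4) * 1)"
      using up q c u(1) that by (intro divide_left_mono mult_mono) auto
    also have "\<dots> = 2 * real k * exp (- (real k / 4 * t))" using assms by (simp add: c_def)
    finally show "1 / t - 1 - 2 * real k * exp (- (real k / 4 * t)) \<le> ?f t"
      using b1 unfolding f diff_divide_distrib by linarith
  qed
  have "((\<lambda>t. 1 / t + 1) has_integral (ln pi - ln c + (pi - c))) {c..pi}"
    using has_integral_add[OF il has_integral_const_real[of 1 c pi]] c by simp
  then have u2: "integral {c..pi} ?f \<le> ln pi - ln c + (pi - c)"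
    using has_integral_le[OF integrable_integral[OF i1(2)]] ptw(1) by blast
  have d: "((\<lambda>t. 1 / t - 1) has_integral (ln pi - ln c - (pi - c))) {c..pi}"
    using has_integral_diff[OF il has_integral_const_real[of 1 c pi]] c by simp
  have "((\<lambda>t. 2 * real k * exp (- (real k / 4 * t))) has_integral
      2 * real k * integral {c..pi} (\<lambda>t. exp (- (real k / 4 * t)))) {c..pi}"
    by (intro has_integral_mult_right integrable_integral integrable_continuous_interval continuous_intros)
  from has_integral_diff[OF d this]
  have l2: "ln pi - ln c - (pi - c) - 2 * real k * integral {c..pi} (\<lambda>t. exp (- (real k / 4 * t))) \<le> integral {c..pi} ?f"
    by (rule has_integral_le[OF _ integrable_integral[OF i1(2)]]) (rule ptw(2))
  have "integral {c..pi} (\<lambda>t. exp (- (real k / 4 * t))) \<le> 1 / (real k / 4)"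
    by (rule integral_exp_le) (use c assms in auto)
  then have "2 * real k * integral {c..pi} (\<lambda>t. exp (- (real k / 4 * t))) \<le> 2 * real k * (1 / (real k / 4))"
    by (intro mult_left_mono) auto
  also have "\<dots> = 8" using assms by simp
  finally have e: "2 * real k * integral {c..pi} (\<lambda>t. exp (- (real k / 4 * t))) \<le> 8" .
  have "ln pi \<le> pi - 1" "0 \<le> ln pi" using ln_le_minus_one[of pi] pi_ge_two by auto
  then have "\<bar>integral {0..pi} ?f - ln k\<bar> \<le> 12"
    using u1 l1 u2 l2 e split lc c pi_less_4 by linarith
  then have "2 / pi * \<bar>integral {0..pi} ?f - ln k\<bar> \<le> 1 * 12"
    using pi_ge_two by (intro mult_mono) auto
  then have "\<bar>2 / pi * (integral {0..pi} ?f - ln k)\<bar> \<le> 12"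
    unfolding abs_mult by simp
  then show ?thesis by (simp add: potential_def right_diff_distrib)
qed

section \<open>Estimates for the potential kernel on the lattice\<close>

definition pot :: "int \<times> int \<Rightarrow> real" where "pot x = potential (fst x) (snd x)"

definition sup_norm :: "int \<times> int \<Rightarrow> int" where "sup_norm x = max \<bar>fst x\<bar> \<bar>snd x\<bar>"

definition nbrs :: "(int \<times> int) set" where "nbrs = {(1, 0), (-1, 0), (0, 1), (0, -1)}"

lemma sup_norm_nonneg [simp]: "0 \<le> sup_norm x" by (simp add: sup_norm_def)

lemma sup_norm_triangle_diff: "sup_norm (x - y) \<le> sup_norm x + sup_norm y"
  by (auto simp: sup_norm_def)

lemma pot_minus [simp]: "pot (- x) = pot x"
  by (simp add: pot_def potential_even)

lemma pot_0 [simp]: "pot 0 = 0" "pot (0, 0) = 0"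
  by (simp_all add: pot_def potential_0_0)

lemma potential_abs: "potential \<bar>j\<bar> \<bar>k\<bar> = potential j k"
  by (auto simp: abs_if potential_even)

text \<open>A backward step is a forward step from a neighbour whose norm is smaller by at most one,
  and vertical steps below the axis are reflected. The change of \<open>1 + sup_norm x\<close> is
  absorbed by the factor 4 between 24 and 96.\<close>

lemma pot_gradient_le:
  assumes "e \<in> nbrs"
  shows "\<bar>pot (x + e) - pot x\<bar> \<le> 96 / (1 + of_int (sup_norm x))"
proof -
  have shrink: "24 / (1 + of_int m) \<le> (96 :: real) / (1 + of_int n)" if "n \<le> m + 1" "0 \<le> m" "0 \<le> n" for m n :: int
  proof -
    have "1 + n \<le> 4 * (1 + m)" using that by simp
    then have "real_of_int (1 + n) \<le> real_of_int (4 * (1 + m))" by (simp only: of_int_le_iff)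
    then have "1 + real_of_int n \<le> 4 * (1 + of_int m)" by simp
    then show ?thesis using that by (simp add: field_simps)
  qed
  obtain j k where x: "x = (j, k)" by (cases x)
  note bounds = order_trans[OF horizontal_gradient_le shrink] order_trans[OF vertical_gradient_le shrink]
  have "\<bar>potential (j - 1) k - potential j k\<bar> \<le> 96 / (1 + of_int (max \<bar>j\<bar> \<bar>k\<bar>))"
  proof -
    have "\<bar>potential (j - 1 + 1) k - potential (j - 1) k\<bar> \<le> 96 / (1 + of_int (max \<bar>j\<bar> \<bar>k\<bar>))"
      by (rule bounds(1)) (auto simp: max_def)
    then show ?thesis by (simp add: abs_minus_commute)
  qed
  moreover have "\<bar>potential (j + 1) k - potential j k\<bar> \<le> 96 / (1 + of_int (max \<bar>j\<bar> \<bar>k\<bar>))"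
    by (rule bounds(1)) auto
  moreover have up: "\<bar>potential j (k + 1) - potential j k\<bar> \<le> 96 / (1 + of_int (max \<bar>j\<bar> \<bar>k\<bar>))" for k
  proof (cases "0 \<le> k")
    case False
    have "potential j (k + 1) = potential j (- k - 1)" "potential j k = potential j (- k - 1 + 1)"
      using potential_even(2)[of j "k + 1"] potential_even(2)[of j k] by simp_all
    moreover have "\<bar>potential j (- k - 1 + 1) - potential j (- k - 1)\<bar> \<le> 96 / (1 + of_int (max \<bar>j\<bar> \<bar>k\<bar>))"
      by (rule bounds(2)) (use False in \<open>auto simp: max_def\<close>)
    ultimately show ?thesis by (simp only: abs_minus_commute)
  qed (rule bounds(2), auto)
  moreover have "\<bar>potential j (k - 1) - potential j k\<bar> \<le> 96 / (1 + of_int (max \<bar>j\<bar> \<bar>k\<bar>))"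
    using up[of "- k"] potential_even(2)[of j "k - 1"] potential_even(2)[of j k] by simp
  ultimately show ?thesis
    using assms by (auto simp: nbrs_def x pot_def sup_norm_def)
qed

lemma telescope_le:
  fixes f :: "nat \<Rightarrow> real"
  assumes "\<And>i. i < n \<Longrightarrow> \<bar>f (Suc i) - f i\<bar> \<le> c"
  shows "\<bar>f n - f 0\<bar> \<le> of_nat n * c"
proof -
  have "f n - f 0 = (\<Sum>i<n. f (Suc i) - f i)" by (simp add: sum_lessThan_telescope)
  also have "\<bar>\<dots>\<bar> \<le> (\<Sum>i<n. \<bar>f (Suc i) - f i\<bar>)" by (rule sum_abs)
  also have "\<dots> \<le> of_nat (card {..<n}) * c" by (rule sum_bounded_above) (use assms in auto)
  finally show ?thesis by simp
qed

text \<open>A path along the boundary of the box of radius \<open>m\<close> joins the point to (0,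
  m). Gradients there are at most \<open>24 / (1 + m)\<close>, so each stretch of at most
  \<open>m\<close> steps costs 24; three stretches and the axis estimate 12 make 84.\<close>

lemma potential_nat_bounds:
  fixes j k m :: nat
  assumes "j \<le> m" "k \<le> m" "max j k = m" "0 < m"
  shows "\<bar>potential (int j) (int k) - 2 / pi * ln m\<bar> \<le> 84"
proof -
  have frac: "real n * (24 / (1 + real m)) \<le> 24" if "n \<le> m" for n
    using that by (simp add: field_simps)
  have H: "\<bar>potential (int i) (int m) - potential 0 (int m)\<bar> \<le> 24" if "i \<le> m" for i
  proof -
    have "\<bar>potential (int i) (int m) - potential (int 0) (int m)\<bar> \<le> real i * (24 / (1 + real m))"
    proof (rule telescope_le)
      fix l assume "l < i"
      then show "\<bar>potential (int (Suc l)) (int m) - potential (int l) (int m)\<bar> \<le> 24 / (1 + real m)"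
        using horizontal_gradient_le[of "int l" "int m"] that by (simp add: max_def add.commute)
    qed
    then show ?thesis using frac[OF that] by simp
  qed
  have V: "\<bar>potential (int m) (int i) - potential (int m) 0\<bar> \<le> 24" if "i \<le> m" for i
  proof -
    have "\<bar>potential (int m) (int i) - potential (int m) (int 0)\<bar> \<le> real i * (24 / (1 + real m))"
    proof (rule telescope_le)
      fix l assume "l < i"
      then show "\<bar>potential (int m) (int (Suc l)) - potential (int m) (int l)\<bar> \<le> 24 / (1 + real m)"
        using vertical_gradient_le[of "int l" "int m"] that by (simp add: max_def add.commute split: if_splits)
    qed
    then show ?thesis using frac[OF that] by simp
  qed
  have 0: "\<bar>potential 0 (int m) - 2 / pi * ln m\<bar> \<le> 12" using assms by (intro potential_0_bounds)
  show ?thesis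
  proof (cases "k = m")
    case True
    then show ?thesis using H[OF assms(1)] 0 by simp
  next
    case False
    then have "j = m" using assms by (auto simp: max_def split: if_splits)
    then show ?thesis using V[OF assms(2)] V[of m] H[of m] 0 by simp
  qed
qed

lemma pot_bounds: "\<bar>pot x - 2 / pi * ln (1 + of_int (sup_norm x))\<bar> \<le> 85"
proof (cases "sup_norm x = 0")
  case True
  then have "x = 0" by (auto simp: sup_norm_def prod_eq_iff max_def split: if_splits)
  then show ?thesis by (simp add: sup_norm_def)
next
  case False
  then have m: "0 < sup_norm x" using sup_norm_nonneg[of x] by linarith
  define m where "m = nat (sup_norm x)"
  have m0: "0 < m" "real m = of_int (sup_norm x)" using m by (auto simp: m_def)
  have "\<bar>potential (int (nat \<bar>fst x\<bar>)) (int (nat \<bar>snd x\<bar>)) - 2 / pi * ln m\<bar> \<le> 84"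
    by (rule potential_nat_bounds) (use m in \<open>auto simp: m_def sup_norm_def max_def\<close>)
  then have 1: "\<bar>pot x - 2 / pi * ln m\<bar> \<le> 84" by (simp add: pot_def potential_abs)
  have "ln (1 + real m) - ln m = ln (1 + 1 / real m)"
  proof -
    have "1 + 1 / real m = (1 + real m) / real m" using m0(1) by (simp add: field_simps)
    then show ?thesis using m0(1) by (simp add: ln_div)
  qed
  also have "\<dots> \<le> 1 / real m" by (rule ln_add_one_self_le_self) auto
  also have "\<dots> \<le> 1" using m0 by simp
  finally have "ln (1 + real m) - ln m \<le> 1" .
  moreover have "0 \<le> ln (1 + real m) - ln m" using m0 by simp
  ultimately have "\<bar>2 / pi * (ln (1 + real m) - ln m)\<bar> \<le> 1 * 1"
    unfolding abs_mult using pi_ge_two by (intro mult_mono) auto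
  then have "\<bar>2 / pi * ln (1 + real m) - 2 / pi * ln m\<bar> \<le> 1" by (simp add: right_diff_distrib)
  with 1 show ?thesis unfolding m0(2)[symmetric] by linarith
qed

lemma pot_laplacian: "(\<Sum>e\<in>nbrs. pot (x + e)) / 4 - pot x = (if x = 0 then 1 else 0)"
  using potential_laplacian[of "fst x" "snd x"]
  by (simp add: nbrs_def pot_def prod_eq_iff add_ac)

section \<open>Horizontal second differences and their quadratic form\<close>

definition hdiff :: "int \<times> int \<Rightarrow> real" where
  "hdiff x = (pot (x + (1, 0)) + pot (x + (-1, 0))) / 2 - pot x"

lemma hdiff_minus: "hdiff (- x) = hdiff x"
proof -
  have "pot (- x + (1, 0)) = pot (x + (-1, 0))" "pot (- x + (-1, 0)) = pot (x + (1, 0))"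
    using pot_minus[of "x + (-1, 0)"] pot_minus[of "x + (1, 0)"] by simp_all
  then show ?thesis by (simp add: hdiff_def)
qed

text \<open>The second difference puts the factor \<open>1 - cos t = 2 * half_sin t ^ 2\<close> into
  the numerator, which cancels the singularity and leaves tanh (s/2). This bounded factor is why
  first departures cost only O(R).\<close>

lemma hdiff_eq_integral:
  "hdiff x = 2 / pi * integral {0..pi}
     (\<lambda>t. half_sin t / half_cosh t * (decay t ^ nat \<bar>snd x\<bar> * cos (of_int (fst x) * t)))"
proof -
  obtain j k where x: "x = (j, k)" by (cases x)
  have "hdiff x = 1/2 * potential (j + 1) k + 1/2 * potential (j - 1) k + (-1) * potential j k
      + 0 * potential 0 0 + 0 * potential 0 0"
    by (simp add: hdiff_def pot_def x)
  also have "\<dots> = 2 / pi * integral {0..pi} (\<lambda>t. half_sin t / half_cosh t * (decay t ^ nat \<bar>k\<bar> * cos (of_int j * t)))"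
    unfolding potential_linear_combination
  proof (intro arg_cong2[where f = "(*)"] refl integral_cong_pos)
    fix t :: real assume t: "0 < t" "t \<le> pi"
    have pos: "half_sin t \<noteq> 0" "half_cosh t \<noteq> 0" using half_sin_pos[OF t] half_cosh_pos[of t] by auto
    have "1/2 * potential_integrand (j + 1) k t + 1/2 * potential_integrand (j - 1) k t
       + (-1) * potential_integrand j k t + 0 * potential_integrand 0 0 t + 0 * potential_integrand 0 0 t
      = decay t ^ nat \<bar>k\<bar> * (2 * cos (of_int j * t) - (cos (of_int (j + 1) * t) + cos (of_int (j - 1) * t)))
         / (4 * half_sin t * half_cosh t)"
      unfolding potential_integrand_def using pos by (simp add: field_simps)
    also have "\<dots> = half_sin t / half_cosh t * (decay t ^ nat \<bar>k\<bar> * cos (of_int j * t))"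
      unfolding cos_shift cos_eq_half_sin[of t] using pos by (simp add: field_simps power2_eq_square)
    finally show "1/2 * potential_integrand (j + 1) k t + 1/2 * potential_integrand (j - 1) k t
       + (-1) * potential_integrand j k t + 0 * potential_integrand 0 0 t + 0 * potential_integrand 0 0 t
      = half_sin t / half_cosh t * (decay t ^ nat \<bar>k\<bar> * cos (of_int j * t))" .
  qed
  finally show ?thesis by (simp add: x)
qed

text \<open>The sum over all integers is (1 + b) / (1 - b); multiplied out, the bound also covers
  \<open>b = 1\<close>, which occurs at frequency 0. A finite \<open>K\<close> is shifted into a
  symmetric box, where the sum has a closed form.\<close>

lemma geometric_sum_int_le:
  fixes b :: real
  assumes "0 \<le> b" "b \<le> 1" "finite K"
  shows "(1 - b) * (\<Sum>l\<in>K. b ^ nat \<bar>k - l\<bar>) \<le> 1 + b"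
proof -
  have box: "(1 - b) * (\<Sum>l\<in>{- int n..int n}. b ^ nat \<bar>l\<bar>) = 1 + b - 2 * b ^ Suc n" for n
  proof (induction n)
    case (Suc n)
    have "{- int (Suc n)..int (Suc n)} = {- int n..int n} \<union> {int (Suc n), - int (Suc n)}" by auto
    then have "(\<Sum>l\<in>{- int (Suc n)..int (Suc n)}. b ^ nat \<bar>l\<bar>)
      = (\<Sum>l\<in>{- int n..int n}. b ^ nat \<bar>l\<bar>) + (\<Sum>l\<in>{int (Suc n), - int (Suc n)}. b ^ nat \<bar>l\<bar>)"
      by (simp only:) (intro sum.union_disjoint; auto)
    moreover have "(\<Sum>l\<in>{int (Suc n), - int (Suc n)}. b ^ nat \<bar>l\<bar>) = 2 * b ^ Suc n"
      by (simp add: nat_add_distrib)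
    ultimately have "(\<Sum>l\<in>{- int (Suc n)..int (Suc n)}. b ^ nat \<bar>l\<bar>)
      = (\<Sum>l\<in>{- int n..int n}. b ^ nat \<bar>l\<bar>) + 2 * b ^ Suc n" by simp
    then have "(1 - b) * (\<Sum>l\<in>{- int (Suc n)..int (Suc n)}. b ^ nat \<bar>l\<bar>)
      = 1 + b - 2 * b ^ Suc n + (1 - b) * (2 * b ^ Suc n)"
      by (simp only: distrib_left Suc)
    then show ?case by (simp add: algebra_simps)
  qed (simp add: algebra_simps)
  define n where "n = Max (insert 0 ((\<lambda>l. nat \<bar>k - l\<bar>) ` K))"
  have "(\<lambda>l. k - l) ` K \<subseteq> {- int n..int n}"
  proof safe
    fix l assume "l \<in> K"
    then have "nat \<bar>k - l\<bar> \<le> n" unfolding n_def using assms by (intro Max_ge) auto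
    then show "k - l \<in> {- int n..int n}" by auto
  qed
  then have "(\<Sum>l\<in>(\<lambda>l. k - l) ` K. b ^ nat \<bar>l\<bar>) \<le> (\<Sum>l\<in>{- int n..int n}. b ^ nat \<bar>l\<bar>)"
    using assms by (intro sum_mono2) auto
  also have "(\<Sum>l\<in>(\<lambda>l. k - l) ` K. b ^ nat \<bar>l\<bar>) = (\<Sum>l\<in>K. b ^ nat \<bar>k - l\<bar>)"
    by (subst sum.reindex) (auto simp: inj_on_def)
  finally have "(1 - b) * (\<Sum>l\<in>K. b ^ nat \<bar>k - l\<bar>) \<le> (1 - b) * (\<Sum>l\<in>{- int n..int n}. b ^ nat \<bar>l\<bar>)"
    using assms by (intro mult_left_mono) auto
  moreover have "0 \<le> b ^ Suc n" using assms by simp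
  ultimately show ?thesis unfolding box by linarith
qed

text \<open>Schur's test: \<open>|w k * w l|\<close> is split by the arithmetic-geometric mean
  inequality, and symmetry of the kernel leaves only its row sums.\<close>

lemma toeplitz_form_le:
  fixes w :: "int \<Rightarrow> real"
  assumes b: "0 \<le> b" "b \<le> 1" and K: "finite K"
  shows "(1 - b) * \<bar>\<Sum>k\<in>K. \<Sum>l\<in>K. b ^ nat \<bar>k - l\<bar> * (w k * w l)\<bar> \<le> (1 + b) * (\<Sum>k\<in>K. w k ^ 2)"
proof -
  let ?B = "\<lambda>k l. b ^ nat \<bar>k - l\<bar>"
  have "\<bar>\<Sum>k\<in>K. \<Sum>l\<in>K. ?B k l * (w k * w l)\<bar> \<le> (\<Sum>k\<in>K. \<Sum>l\<in>K. \<bar>?B k l * (w k * w l)\<bar>)"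
    by (rule order_trans[OF sum_abs sum_mono[OF sum_abs]])
  also have "\<dots> \<le> (\<Sum>k\<in>K. \<Sum>l\<in>K. ?B k l * (w k ^ 2) / 2 + ?B k l * (w l ^ 2) / 2)"
  proof (intro sum_mono)
    fix k l
    have "\<bar>w k * w l\<bar> \<le> (w k ^ 2 + w l ^ 2) / 2"
      using zero_le_power2[of "\<bar>w k\<bar> - \<bar>w l\<bar>"] by (simp add: power2_diff abs_mult)
    then have "?B k l * \<bar>w k * w l\<bar> \<le> ?B k l * ((w k ^ 2 + w l ^ 2) / 2)"
      using b by (intro mult_left_mono) auto
    then show "\<bar>?B k l * (w k * w l)\<bar> \<le> ?B k l * (w k ^ 2) / 2 + ?B k l * (w l ^ 2) / 2"
      using b by (simp add: abs_mult algebra_simps add_divide_distrib)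
  qed
  also have "\<dots> = (\<Sum>k\<in>K. \<Sum>l\<in>K. ?B k l * (w k ^ 2) / 2) + (\<Sum>k\<in>K. \<Sum>l\<in>K. ?B k l * (w l ^ 2) / 2)"
    by (simp add: sum.distrib)
  also have "(\<Sum>k\<in>K. \<Sum>l\<in>K. ?B k l * (w l ^ 2) / 2) = (\<Sum>k\<in>K. \<Sum>l\<in>K. ?B k l * (w k ^ 2) / 2)"
    by (subst sum.swap) (simp add: abs_minus_commute)
  finally have "\<bar>\<Sum>k\<in>K. \<Sum>l\<in>K. ?B k l * (w k * w l)\<bar> \<le> (\<Sum>k\<in>K. w k ^ 2 * (\<Sum>l\<in>K. ?B k l))"
    by (simp add: sum_distrib_left sum.distrib[symmetric] mult.commute)
  then have "(1 - b) * \<bar>\<Sum>k\<in>K. \<Sum>l\<in>K. ?B k l * (w k * w l)\<bar> \<le> (1 - b) * (\<Sum>k\<in>K. w k ^ 2 * (\<Sum>l\<in>K. ?B k l))"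
    using b by (intro mult_left_mono) auto
  also have "\<dots> = (\<Sum>k\<in>K. w k ^ 2 * ((1 - b) * (\<Sum>l\<in>K. ?B k l)))"
    by (simp add: sum_distrib_left mult_ac)
  also have "\<dots> \<le> (\<Sum>k\<in>K. w k ^ 2 * (1 + b))"
    using geometric_sum_int_le[OF b K] by (intro sum_mono mult_left_mono) auto
  finally show ?thesis by (simp add: sum_distrib_left mult.commute)
qed

lemma sum_rows:
  fixes f :: "int \<times> int \<Rightarrow> real" and B :: "int \<Rightarrow> int \<Rightarrow> real"
  assumes "finite A"
  shows "(\<Sum>x\<in>A. \<Sum>y\<in>A. B (snd x) (snd y) * (f x * f y))
    = (\<Sum>k\<in>snd ` A. \<Sum>l\<in>snd ` A. B k l * ((\<Sum>x\<in>{x\<in>A. snd x = k}. f x) * (\<Sum>x\<in>{x\<in>A. snd x = l}. f x)))"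
proof -
  have g: "(\<Sum>x\<in>A. h x) = (\<Sum>k\<in>snd ` A. \<Sum>x\<in>{x\<in>A. snd x = k}. h x)" for h :: "int \<times> int \<Rightarrow> real"
    using sum.group[of A "snd ` A" snd h] assms by simp
  have "(\<Sum>x\<in>A. \<Sum>y\<in>A. B (snd x) (snd y) * (f x * f y))
    = (\<Sum>k\<in>snd ` A. \<Sum>x\<in>{x\<in>A. snd x = k}. \<Sum>l\<in>snd ` A. \<Sum>y\<in>{x\<in>A. snd x = l}. B k l * (f x * f y))"
    by (subst g, subst g) (intro sum.cong refl; auto)
  also have "\<dots> = (\<Sum>k\<in>snd ` A. \<Sum>l\<in>snd ` A. \<Sum>x\<in>{x\<in>A. snd x = k}. \<Sum>y\<in>{x\<in>A. snd x = l}. B k l * (f x * f y))"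
    by (intro sum.cong refl) (rule sum.swap)
  finally show ?thesis
    unfolding sum_product by (simp only: sum_distrib_left)
qed

text \<open>Horizontal second differences of the potential form a positive definite kernel whose Fourier
  symbol is at most 2; in mixed coordinates this is Schur's test across rows and Parseval's identity
  along rows.\<close>

lemma hdiff_form_le:
  fixes A :: "(int \<times> int) set"
  assumes A: "finite A"
  shows "\<bar>\<Sum>x\<in>A. \<Sum>y\<in>A. hdiff (x - y)\<bar> \<le> 2 * card A"
proof -
  let ?R = "\<lambda>k. {x\<in>A. snd x = k}"
  let ?\<tau> = "\<lambda>t. half_sin t / half_cosh t"
  \<comment> \<open>\<open>F\<close> is the integrand of the form, \<open>H\<close> a majorant in
    which only pairs in the same row survive. Within a row the first coordinates are distinct, so by
    orthogonality of cosines \<open>H\<close> integrates to \<open>pi * card A\<close>.\<close>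
  define F where "F t = (\<Sum>x\<in>A. \<Sum>y\<in>A. ?\<tau> t * (decay t ^ nat \<bar>snd x - snd y\<bar> * cos (of_int (fst x - fst y) * t)))" for t
  define H where "H t = (\<Sum>k\<in>snd ` A. \<Sum>x\<in>?R k. \<Sum>y\<in>?R k. cos (of_int (fst x - fst y) * t))" for t :: real
  have int: "(\<lambda>t. ?\<tau> t * (decay t ^ n * cos (of_int j * t))) integrable_on {0..pi}" for n j
  proof (rule bounded_measurable_integrable_on[where B = 1])
    fix t assume t: "t \<in> {0..pi}"
    have "\<bar>?\<tau> t\<bar> * (\<bar>decay t ^ n\<bar> * \<bar>cos (of_int j * t)\<bar>) \<le> 1 * (1 * 1)"
      using half_ratio_bounds(1)[OF t] half_ratio_bounds(2)[of t] decay_power_bounds[OF t, of n] by (intro mult_mono) auto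
    then show "\<bar>?\<tau> t * (decay t ^ n * cos (of_int j * t))\<bar> \<le> 1" by (simp add: abs_mult)
  qed measurable
  have sumF: "(\<Sum>x\<in>A. \<Sum>y\<in>A. hdiff (x - y)) = 2 / pi * integral {0..pi} F"
  proof -
    have "integral {0..pi} F = (\<Sum>x\<in>A. \<Sum>y\<in>A. integral {0..pi}
        (\<lambda>t. ?\<tau> t * (decay t ^ nat \<bar>snd x - snd y\<bar> * cos (of_int (fst x - fst y) * t))))"
      unfolding F_def
      by (simp add: integral_sum A integrable_sum int del: of_int_diff times_divide_eq_left times_divide_eq_right)
    then show ?thesis by (simp only: hdiff_eq_integral sum_distrib_left fst_diff snd_diff)
  qed
  have intc: "(\<lambda>t. cos (of_int j * t)) integrable_on {0..pi}" for j :: int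
    by (intro integrable_continuous_interval continuous_intros)
  have "integral {0..pi} H = (\<Sum>k\<in>snd ` A. \<Sum>x\<in>?R k. \<Sum>y\<in>?R k. if fst x - fst y = 0 then pi else 0)"
    unfolding H_def using A
    by (simp add: integral_sum integrable_sum intc integral_cos_int del: of_int_diff)
  also have "\<dots> = (\<Sum>k\<in>snd ` A. \<Sum>x\<in>?R k. pi)"
  proof (intro sum.cong refl)
    fix k x assume x: "x \<in> ?R k"
    have "(\<Sum>y\<in>?R k. if fst x - fst y = 0 then pi else 0) = (\<Sum>y\<in>?R k. if y = x then pi else 0)"
      by (intro sum.cong refl) (use x in \<open>auto simp: prod_eq_iff\<close>)
    then show "(\<Sum>y\<in>?R k. if fst x - fst y = 0 then pi else 0) = pi" using x A by simp
  qed
  also have "\<dots> = (\<Sum>x\<in>A. pi)" using sum.group[of A "snd ` A" snd "\<lambda>_. pi"] A by simp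
  finally have intH: "integral {0..pi} H = pi * card A" by simp
  have "\<bar>F t\<bar> \<le> H t" if t: "t \<in> {0..pi}" for t
  proof -
    define c where "c k = (\<Sum>x\<in>?R k. cos (of_int (fst x) * t))" for k
    define s where "s k = (\<Sum>x\<in>?R k. sin (of_int (fst x) * t))" for k
    let ?b = "decay t"
    let ?Q = "\<lambda>w. \<Sum>k\<in>snd ` A. \<Sum>l\<in>snd ` A. ?b ^ nat \<bar>k - l\<bar> * (w k * w l)"
    have b: "0 \<le> ?b" "?b \<le> 1" using decay_pos[of t] decay_le_1[OF t] by auto
    have cc: "cos (of_int (fst x - fst y) * t)
      = cos (of_int (fst x) * t) * cos (of_int (fst y) * t) + sin (of_int (fst x) * t) * sin (of_int (fst y) * t)"
      for x y :: "int \<times> int" by (simp add: left_diff_distrib cos_diff)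
    have "F t = ?\<tau> t * ((\<Sum>x\<in>A. \<Sum>y\<in>A. ?b ^ nat \<bar>snd x - snd y\<bar> * (cos (of_int (fst x) * t) * cos (of_int (fst y) * t)))
        + (\<Sum>x\<in>A. \<Sum>y\<in>A. ?b ^ nat \<bar>snd x - snd y\<bar> * (sin (of_int (fst x) * t) * sin (of_int (fst y) * t))))"
      unfolding F_def cc by (simp add: sum_distrib_left sum.distrib distrib_left)
    also have "\<dots> = ?\<tau> t * (?Q c + ?Q s)"
      unfolding c_def s_def
        sum_rows[OF A, of "\<lambda>k l. ?b ^ nat \<bar>k - l\<bar>" "\<lambda>x. cos (of_int (fst x) * t)"]
        sum_rows[OF A, of "\<lambda>k l. ?b ^ nat \<bar>k - l\<bar>" "\<lambda>x. sin (of_int (fst x) * t)"] ..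
    finally have Ft: "F t = ?\<tau> t * (?Q c + ?Q s)" .
    \<comment> \<open>tanh (s/2) is exactly the reciprocal of the Schur constant, so the bound is
      uniform in the frequency.\<close>
    have "?\<tau> t = (1 - ?b) / (1 + ?b)"
      unfolding decay_alt using half_cosh_gt[of t] half_cosh_pos[of t] by simp
    then have "\<bar>F t\<bar> = (1 - ?b) * \<bar>?Q c + ?Q s\<bar> / (1 + ?b)"
      unfolding Ft abs_mult using b by simp
    also have "\<dots> \<le> ((1 - ?b) * \<bar>?Q c\<bar> + (1 - ?b) * \<bar>?Q s\<bar>) / (1 + ?b)"
      unfolding distrib_left[symmetric] using b by (intro divide_right_mono mult_left_mono) auto
    also have "\<dots> \<le> ((1 + ?b) * (\<Sum>k\<in>snd ` A. c k ^ 2) + (1 + ?b) * (\<Sum>k\<in>snd ` A. s k ^ 2)) / (1 + ?b)"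
      using b A by (intro divide_right_mono add_mono toeplitz_form_le) auto
    also have "\<dots> = (\<Sum>k\<in>snd ` A. c k ^ 2 + s k ^ 2)"
      using b by (simp add: sum.distrib distrib_left[symmetric])
    also have "\<dots> = H t"
      unfolding H_def cc c_def s_def power2_eq_square sum_product sum.distrib ..
    finally show ?thesis .
  qed
  moreover have "F integrable_on {0..pi}" "H integrable_on {0..pi}"
    unfolding F_def H_def using A by (auto intro!: integrable_sum int intc simp del: of_int_diff times_divide_eq_left times_divide_eq_right)
  ultimately have "\<bar>integral {0..pi} F\<bar> \<le> pi * card A"
    using integral_norm_bound_integral[of F "{0..pi}" H] intH by simp
  then have "2 / pi * \<bar>integral {0..pi} F\<bar> \<le> 2 / pi * (pi * card A)"
    by (intro mult_left_mono) auto
  then show ?thesis unfolding sumF by (simp add: abs_mult)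
qed

section \<open>Packing bounds for sums over finite sets\<close>

definition inv_norm :: "int \<times> int \<Rightarrow> real" where "inv_norm x = 1 / (1 + of_int (sup_norm x))"

text \<open>The shell at distance \<open>r + 1\<close> has \<open>8 * (r + 1)\<close> points of
  weight \<open>1 / (r + 2)\<close>, so each shell adds at most 8.\<close>

lemma sum_inv_norm_box: "(\<Sum>x\<in>{- int r..int r} \<times> {- int r..int r}. inv_norm x) \<le> 8 * real r + 1"
proof (induction r)
  case 0
  then show ?case by (simp add: inv_norm_def sup_norm_def)
next
  case (Suc r)
  let ?B = "\<lambda>r. {- int r..int r} \<times> {- int r..int r}"
  have sub: "?B r \<subseteq> ?B (Suc r)" by auto
  have "(\<Sum>x\<in>?B (Suc r). inv_norm x) = (\<Sum>x\<in>?B (Suc r) - ?B r. inv_norm x) + (\<Sum>x\<in>?B r. inv_norm x)"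
    by (rule sum.subset_diff[OF sub]) auto
  also have "(\<Sum>x\<in>?B (Suc r) - ?B r. inv_norm x) = (\<Sum>x\<in>?B (Suc r) - ?B r. 1 / (2 + real r))"
  proof (intro sum.cong refl)
    fix x assume "x \<in> ?B (Suc r) - ?B r"
    then have "sup_norm x = int (Suc r)" by (cases x) (auto simp: sup_norm_def max_def)
    then show "inv_norm x = 1 / (2 + real r)" by (simp add: inv_norm_def)
  qed
  also have "\<dots> = real (card (?B (Suc r) - ?B r)) / (2 + real r)" by simp
  also have "card (?B (Suc r) - ?B r) = card (?B (Suc r)) - card (?B r)"
    by (rule card_Diff_subset) (use sub in auto)
  also have "\<dots> = 8 * r + 8"
    by (simp add: card_cartesian_product nat_add_distrib algebra_simps) 
  also have "real (8 * r + 8) / (2 + real r) \<le> 8" by (simp add: field_simps)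
  finally show ?case using Suc by simp
qed

text \<open>Points inside the box of radius \<open>r\<close>, the integer part of
  \<open>sqrt (card A)\<close>, contribute at most the box sum \<open>8 * r + 1\<close>; those
  outside weigh at most \<open>1 / (1 + r)\<close> each, in total at most
  \<open>sqrt (card A)\<close>.\<close>

lemma sum_inv_norm_le:
  assumes A: "finite A"
  shows "(\<Sum>x\<in>A. inv_norm x) \<le> 10 * sqrt (card A)"
proof (cases "A = {}")
  case False
  define r where "r = nat \<lfloor>sqrt (card A)\<rfloor>"
  have s: "1 \<le> sqrt (card A)" using False A by (simp add: Suc_le_eq card_gt_0_iff)
  then have r: "real r \<le> sqrt (card A)" "sqrt (card A) \<le> real r + 1" unfolding r_def by linarith+
  let ?B = "{- int r..int r} \<times> {- int r..int r}"
  have "(\<Sum>x\<in>A. inv_norm x) = (\<Sum>x\<in>A \<inter> ?B. inv_norm x) + (\<Sum>x\<in>A - ?B. inv_norm x)"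
    using A by (metis sum.Int_Diff)
  also have "(\<Sum>x\<in>A \<inter> ?B. inv_norm x) \<le> (\<Sum>x\<in>?B. inv_norm x)"
    by (intro sum_mono2) (auto simp: inv_norm_def)
  also have "\<dots> \<le> 8 * real r + 1" by (rule sum_inv_norm_box)
  also have "(\<Sum>x\<in>A - ?B. inv_norm x) \<le> real (card (A - ?B)) * (1 / (1 + real r))"
  proof (rule sum_bounded_above)
    fix x assume "x \<in> A - ?B"
    then have "int r \<le> sup_norm x" by (cases x) (auto simp: sup_norm_def max_def)
    then show "inv_norm x \<le> 1 / (1 + real r)" unfolding inv_norm_def
      by (intro divide_left_mono) (auto intro!: mult_pos_pos add_pos_nonneg)
  qed
  also have "\<dots> \<le> real (card A) * (1 / sqrt (card A))"
    using A r s by (intro mult_mono divide_left_mono) (auto intro: card_mono)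
  also have "\<dots> = sqrt (card A)" by (simp add: real_div_sqrt)
  finally show ?thesis using r(1) s by linarith
qed simp

lemma sum_shift:
  fixes f :: "int \<times> int \<Rightarrow> real"
  shows "(\<Sum>y\<in>A. f (x - y)) = (\<Sum>z\<in>(\<lambda>y. x - y) ` A. f z)" "card ((\<lambda>y. x - y) ` A) = card A"
  by (auto simp: sum.reindex card_image inj_on_def)

lemma sum_inv_norm_shift_le:
  "finite A \<Longrightarrow> (\<Sum>y\<in>A. inv_norm (x - y)) \<le> 10 * sqrt (card A)"
  using sum_inv_norm_le[of "(\<lambda>y. x - y) ` A"] by (simp add: sum_shift)

text \<open>\<open>ln x <= x - 1\<close> at \<open>x = sqrt (card A) / m\<close> bounds
  \<open>ln m\<close> below by an affine function of \<open>1 / m\<close>, so the packing bound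
  replaces any rearrangement of \<open>A\<close>. The constant is 85 from \<open>pot_bounds\<close>
  plus 10 from packing.\<close>

lemma sum_pot_ge:
  assumes A: "finite A"
  shows "real (card A) * (ln (card A) / pi - 95) \<le> (\<Sum>y\<in>A. pot (x - y))"
proof (cases "A = {}")
  case False
  then have N: "0 < real (card A)" using A by (simp add: card_gt_0_iff)
  have p: "2 / pi * (ln (card A) / 2 - sqrt (card A) * inv_norm z) - 85 \<le> pot z" for z
  proof -
    let ?m = "1 + real_of_int (sup_norm z)"
    have m: "0 < ?m" using sup_norm_nonneg[of z] by linarith
    have "ln (sqrt (card A) / ?m) \<le> sqrt (card A) / ?m - 1"
      using N m by (intro ln_le_minus_one) auto
    then have "ln (card A) / 2 - sqrt (card A) * inv_norm z \<le> ln ?m"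
      using N m by (simp add: ln_div ln_sqrt inv_norm_def)
    then have "2 / pi * (ln (card A) / 2 - sqrt (card A) * inv_norm z) \<le> 2 / pi * ln ?m"
      by (intro mult_left_mono) auto
    then show ?thesis using pot_bounds[of z] by linarith
  qed
  have "sqrt (card A) * (\<Sum>y\<in>A. inv_norm (x - y)) \<le> sqrt (card A) * (10 * sqrt (card A))"
    by (intro mult_left_mono sum_inv_norm_shift_le A) auto
  also have "\<dots> = 10 * real (card A)" by simp
  finally have S: "sqrt (card A) * (\<Sum>y\<in>A. inv_norm (x - y)) \<le> 10 * real (card A)" .
  have "0 \<le> sqrt (card A) * (\<Sum>y\<in>A. inv_norm (x - y))"
    by (intro mult_nonneg_nonneg sum_nonneg) (auto simp: inv_norm_def)
  then have "2 / pi * (sqrt (card A) * (\<Sum>y\<in>A. inv_norm (x - y))) \<le> 1 * (sqrt (card A) * (\<Sum>y\<in>A. inv_norm (x - y)))"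
    using pi_ge_two by (intro mult_right_mono) auto
  with S have "2 / pi * (sqrt (card A) * (\<Sum>y\<in>A. inv_norm (x - y))) \<le> 10 * real (card A)" by linarith
  then have "real (card A) * (ln (card A) / pi - 95)
     \<le> real (card A) * (2 / pi * (ln (card A) / 2)) - 2 / pi * (sqrt (card A) * (\<Sum>y\<in>A. inv_norm (x - y))) - 85 * real (card A)"
    by (simp add: algebra_simps)
  also have "\<dots> = (\<Sum>y\<in>A. 2 / pi * (ln (card A) / 2 - sqrt (card A) * inv_norm (x - y)) - 85)"
    by (simp add: sum_subtractf sum_distrib_left right_diff_distrib)
  also have "\<dots> \<le> (\<Sum>y\<in>A. pot (x - y))" by (intro sum_mono p)
  finally show ?thesis .
qed simp

section \<open>The walk as a Markov chain of histories\<close>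

text \<open>Histories are listed backwards: the head of the list is the current position.\<close>

definition departure_law :: "(int \<times> int) list \<Rightarrow> (int \<times> int) pmf" where
  "departure_law h = step_law (hd h \<notin> set (tl h))"

text \<open>A history at time n has n + 1 entries, and \<open>set (tl h)\<close> is the set of
  vertices visited before time n, so its cardinality is the range. Finite support makes
  integrability automatic.\<close>

primrec walk_law :: "nat \<Rightarrow> (int \<times> int) list pmf" where
  "walk_law 0 = return_pmf [0]"
| "walk_law (Suc n) = bind_pmf (walk_law n) (\<lambda>h. map_pmf (\<lambda>e. (hd h + e) # h) (departure_law h))"

abbreviation walk_expectation :: "nat \<Rightarrow> ((int \<times> int) list \<Rightarrow> real) \<Rightarrow> real" where
  "walk_expectation n f \<equiv> measure_pmf.expectation (walk_law n) f"

abbreviation walk_prob :: "nat \<Rightarrow> (int \<times> int) list set \<Rightarrow> real" where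
  "walk_prob n \<equiv> measure_pmf.prob (walk_law n)"

lemma set_step_law: "set_pmf (step_law b) \<subseteq> nbrs"
  by (auto simp: step_law_def nbrs_def)

lemma finite_nbrs [simp]: "finite nbrs" by (simp add: nbrs_def)

lemma set_departure_law: "set_pmf (departure_law h) \<subseteq> nbrs"
  unfolding departure_law_def by (rule set_step_law)

lemma finite_departure_law [simp]: "finite (set_pmf (departure_law h))"
  using set_departure_law finite_nbrs by (rule finite_subset)

lemma finite_walk_law [simp]: "finite (set_pmf (walk_law n))"
  by (induction n) auto

lemma integrable_walk_law [simp]: "integrable (measure_pmf (walk_law n)) (f :: _ \<Rightarrow> real)"
  by (rule integrable_measure_pmf_finite) simp

lemma integrable_departure_law [simp]: "integrable (measure_pmf (departure_law h)) (f :: _ \<Rightarrow> real)"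
  by (rule integrable_measure_pmf_finite) simp

lemma length_walk_law: "h \<in> set_pmf (walk_law n) \<Longrightarrow> length h = Suc n"
  by (induction n arbitrary: h) auto

lemma walk_law_not_Nil: "h \<in> set_pmf (walk_law n) \<Longrightarrow> h \<noteq> []"
  using length_walk_law by fastforce

lemma walk_expectation_Suc:
  "walk_expectation (Suc n) f
    = walk_expectation n (\<lambda>h. measure_pmf.expectation (departure_law h) (\<lambda>e. f ((hd h + e) # h)))"
  by (simp add: pmf_expectation_bind[of "set_pmf (walk_law n)"]
      integral_measure_pmf[of "set_pmf (walk_law n)"])

lemma walk_expectation_mono:
  "(\<And>h. h \<in> set_pmf (walk_law n) \<Longrightarrow> f h \<le> g h) \<Longrightarrow> walk_expectation n f \<le> walk_expectation n g"
  by (intro integral_mono_AE) (auto simp: AE_measure_pmf_iff)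

lemma walk_prob_eq_expectation: "walk_prob n A = walk_expectation n (indicator A)"
  by simp

lemma walk_law_tl: "map_pmf tl (walk_law (Suc n)) = walk_law n"
  by (simp add: map_bind_pmf pmf.map_comp o_def map_pmf_const bind_return_pmf')

lemma expectation_departure_law:
  "measure_pmf.expectation (departure_law h) f =
    (if hd h \<notin> set (tl h) then (f (1, 0) + f (-1, 0)) / 2 else (\<Sum>e\<in>nbrs. f e) / 4 :: real)"
  by (simp add: departure_law_def step_law_def integral_pmf_of_set nbrs_def)

lemma expectation_abs_le:
  assumes "\<And>e. e \<in> set_pmf p \<Longrightarrow> \<bar>g e\<bar> \<le> (c::real)" "finite (set_pmf p)"
  shows "\<bar>measure_pmf.expectation p g\<bar> \<le> c"
proof -
  have "\<bar>measure_pmf.expectation p g\<bar> \<le> measure_pmf.expectation p (\<lambda>e. \<bar>g e\<bar>)" by (rule integral_abs_bound)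
  also have "\<dots> \<le> measure_pmf.expectation p (\<lambda>_. c)"
    by (intro integral_mono_AE integrable_measure_pmf_finite assms) (use assms in \<open>auto simp: AE_measure_pmf_iff\<close>)
  finally show ?thesis by simp
qed

lemma exp_centered_le:
  assumes c: "\<And>e. e \<in> set_pmf p \<Longrightarrow> \<bar>g e\<bar> \<le> (c::real)" and fin: "finite (set_pmf p)"
  shows "measure_pmf.expectation p (\<lambda>e. exp (l * (g e - measure_pmf.expectation p g))) \<le> exp (l\<^sup>2 * c\<^sup>2 / 2)"
proof -
  have pos: "measure_pmf.expectation p (\<lambda>e. exp (l * (g e - measure_pmf.expectation p g))) \<le> exp (l\<^sup>2 * c\<^sup>2 / 2)"
    if "l > 0" and c: "\<And>e. e \<in> set_pmf p \<Longrightarrow> \<bar>g e\<bar> \<le> c" for l g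
  proof -
    \<comment> \<open>Hoeffding's lemma on an interval of length \<open>2 * c\<close> gives
      \<open>l^2 * (2 * c)^2 / 8\<close>. It is applied for \<open>l > 0\<close>; negative
      \<open>l\<close> is reduced to this by changing the sign of \<open>g\<close>.\<close>
    interpret interval_bounded_random_variable "measure_pmf p" g "-c" c
      by unfold_locales (use c in \<open>force simp: AE_measure_pmf_iff abs_le_iff\<close>)+
    have "(\<integral>\<^sup>+e. exp (l * (g e - measure_pmf.expectation p g)) \<partial>measure_pmf p)
        = measure_pmf.expectation p (\<lambda>e. exp (l * (g e - measure_pmf.expectation p g)))"
      by (intro nn_integral_eq_integral integrable_measure_pmf_finite fin) auto
    with Hoeffdings_lemma_nn_integral[OF \<open>l > 0\<close>]
    have "ennreal (measure_pmf.expectation p (\<lambda>e. exp (l * (g e - measure_pmf.expectation p g))))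
      \<le> ennreal (exp (l\<^sup>2 * (c - - c)\<^sup>2 / 8))" by simp
    then show ?thesis by (simp add: power2_eq_square mult_ac)
  qed
  consider "l > 0" | "l = 0" | "- l > 0" by linarith
  then show ?thesis
  proof cases
    case 3
    show ?thesis using pos[OF 3, of "\<lambda>e. - g e"] c by (simp add: right_diff_distrib)
  qed (use pos c in auto)
qed

text \<open>In place of the conditional variance, \<open>V\<close> accumulates the squared bounds
  \<open>(c h)^2\<close>, which are known before the step. The lemma serves both
  \<open>walk_mart\<close> and the coordinates of the walk.\<close>

lemma exp_supermartingale:
  fixes F V :: "(int \<times> int) list \<Rightarrow> real"
  assumes F: "\<And>h e. h \<noteq> [] \<Longrightarrow> F ((hd h + e) # h) = F h + (g h e - measure_pmf.expectation (departure_law h) (g h))"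
    and V: "\<And>h e. h \<noteq> [] \<Longrightarrow> V ((hd h + e) # h) = V h + (c h)\<^sup>2"
    and g: "\<And>h e. h \<noteq> [] \<Longrightarrow> e \<in> nbrs \<Longrightarrow> \<bar>g h e\<bar> \<le> c h"
    and init: "F [0] = 0" "V [0] = 0"
  shows "walk_expectation n (\<lambda>h. exp (l * F h - l\<^sup>2 / 2 * V h)) \<le> 1"
proof (induction n)
  case 0
  then show ?case by (simp add: init)
next
  case (Suc n)
  let ?Z = "\<lambda>h. exp (l * F h - l\<^sup>2 / 2 * V h)"
  have "walk_expectation (Suc n) ?Z \<le> walk_expectation n ?Z"
    unfolding walk_expectation_Suc
  proof (rule walk_expectation_mono)
    fix h assume "h \<in> set_pmf (walk_law n)"
    then have h: "h \<noteq> []" by (rule walk_law_not_Nil)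
    let ?G = "\<lambda>e. exp (l * (g h e - measure_pmf.expectation (departure_law h) (g h)))"
    have "?Z ((hd h + e) # h) = ?Z h * exp (- (l\<^sup>2 * (c h)\<^sup>2 / 2)) * ?G e" for e
      unfolding F[OF h] V[OF h] by (simp add: exp_add[symmetric] algebra_simps)
    then have "measure_pmf.expectation (departure_law h) (\<lambda>e. ?Z ((hd h + e) # h))
       = ?Z h * exp (- (l\<^sup>2 * (c h)\<^sup>2 / 2)) * measure_pmf.expectation (departure_law h) ?G"
      by simp
    also have "\<dots> \<le> ?Z h * exp (- (l\<^sup>2 * (c h)\<^sup>2 / 2)) * exp (l\<^sup>2 * (c h)\<^sup>2 / 2)"
      using set_departure_law g[OF h]
      by (intro mult_left_mono exp_centered_le) auto
    also have "\<dots> = ?Z h" by (simp add: exp_minus)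
    finally show "measure_pmf.expectation (departure_law h) (\<lambda>e. ?Z ((hd h + e) # h)) \<le> ?Z h" .
  qed
  with Suc show ?case by linarith
qed

section \<open>The martingale built from the potential\<close>

definition total_pot :: "(int \<times> int) list \<Rightarrow> real" where
  "total_pot h = (\<Sum>y\<in>set (tl h). pot (hd h - y))"

text \<open>Halved because the double sum counts each pair of distinct vertices twice, whereas the
  drift counts it once, when the later of the two is first left.\<close>

definition hdiff_form :: "(int \<times> int) set \<Rightarrow> real" where
  "hdiff_form A = (\<Sum>x\<in>A. \<Sum>y\<in>A. hdiff (x - y)) / 2"

text \<open>The compensator of \<^const>\<open>total_pot\<close>: one unit per step, and at first departures the horizontal
  second differences, whose sum over all first departures telescopes to the quadratic form
  \<^const>\<open>hdiff_form\<close> of the range.\<close>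

definition walk_mart :: "(int \<times> int) list \<Rightarrow> real" where
  "walk_mart h = total_pot h - (real (length h) - 1) - hdiff_form (set (tl h))
     - (hdiff 0 / 2 - 1) * card (set (tl h))"

definition pot_incr :: "(int \<times> int) list \<Rightarrow> int \<times> int \<Rightarrow> real" where
  "pot_incr h e = (\<Sum>y\<in>set h. pot (hd h - y + e) - pot (hd h - y))"

text \<open>Up to the factor \<open>960^2\<close>, the accumulated squared increment bounds of
  \<open>walk_mart\<close>: each is proportional to the current number of visited vertices.\<close>

primrec range_sum :: "(int \<times> int) list \<Rightarrow> nat" where
  "range_sum [] = 0"
| "range_sum (x # h) = range_sum h + card (set h)"

lemma hdiff_form_insert:
  assumes "finite A" "s \<notin> A"
  shows "hdiff_form (insert s A) = hdiff_form A + (\<Sum>y\<in>A. hdiff (s - y)) + hdiff 0 / 2"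
proof -
  have "(\<Sum>x\<in>A. hdiff (x - s)) = (\<Sum>y\<in>A. hdiff (s - y))"
    using hdiff_minus[of "_ - s"] by (intro sum.cong refl) (metis minus_diff_eq)
  then show ?thesis using assms by (simp add: hdiff_form_def sum.distrib add_divide_distrib)
qed

text \<open>The vertex being left joins the summation set. Since \<open>pot 0 = 0\<close> it may be
  counted before the step already, so that only the displacement changes the sum.\<close>

lemma total_pot_Cons:
  assumes "h \<noteq> []"
  shows "total_pot ((hd h + e) # h) = total_pot h + pot_incr h e"
proof -
  obtain s A where h: "h = s # A" using assms by (cases h) auto
  have "total_pot h = (\<Sum>y\<in>set h. pot (s - y))"
    unfolding total_pot_def h by (cases "s \<in> set A") (auto simp: insert_absorb)
  moreover have "(\<Sum>y\<in>set h. pot (s + e - y)) = (\<Sum>y\<in>set h. pot (s - y + e))"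
    by (intro sum.cong refl arg_cong[where f = pot]) simp
  ultimately show ?thesis
    by (simp add: total_pot_def pot_incr_def sum_subtractf h)
qed

text \<open>The Laplacian of \<open>pot\<close> is a unit mass at 0, and exactly one
  \<open>y\<close> in \<open>set h\<close> is the current position; hence drift 1 when all four
  steps are allowed.\<close>

lemma expectation_pot_incr:
  assumes "h \<noteq> []"
  shows "measure_pmf.expectation (departure_law h) (pot_incr h)
    = (if hd h \<in> set (tl h) then 1 else (\<Sum>y\<in>set h. hdiff (hd h - y)))"
proof (cases "hd h \<in> set (tl h)")
  case True
  have "(\<Sum>e\<in>nbrs. pot_incr h e) / 4 = (\<Sum>y\<in>set h. (\<Sum>e\<in>nbrs. pot (hd h - y + e)) / 4 - pot (hd h - y))"
    unfolding pot_incr_def by (subst sum.swap) (simp add: sum_subtractf sum_divide_distrib diff_divide_distrib nbrs_def)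
  also have "\<dots> = (\<Sum>y\<in>set h. if hd h = y then 1 else 0)"
    by (simp add: pot_laplacian)
  also have "\<dots> = 1" using assms by simp
  finally show ?thesis using True by (simp add: expectation_departure_law)
next
  case False
  have "(pot_incr h (1, 0) + pot_incr h (-1, 0)) / 2 = (\<Sum>y\<in>set h. hdiff (hd h - y))"
    unfolding pot_incr_def hdiff_def
    by (simp add: sum_subtractf sum.distrib[symmetric] sum_divide_distrib add_divide_distrib diff_divide_distrib)
  then show ?thesis using False by (simp add: expectation_departure_law)
qed

text \<open>At a first departure the drift contains the diagonal term \<open>hdiff 0\<close>. Half
  of it comes from \<open>hdiff_form\<close>; the cardinality term supplies the other half and takes
  back the unit already counted by the length.\<close>

lemma walk_mart_Cons:
  assumes "h \<noteq> []"
  shows "walk_mart ((hd h + e) # h)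
    = walk_mart h + (pot_incr h e - measure_pmf.expectation (departure_law h) (pot_incr h))"
proof -
  obtain s A where h: "h = s # A" using assms by (cases h) auto
  show ?thesis
  proof (cases "s \<in> set A")
    case True
    then show ?thesis
      using total_pot_Cons[OF assms, of e] expectation_pot_incr[OF assms]
      by (simp add: walk_mart_def h insert_absorb)
  next
    case False
    then show ?thesis
      using total_pot_Cons[OF assms, of e] expectation_pot_incr[OF assms] hdiff_form_insert[OF _ False]
      by (simp add: walk_mart_def h algebra_simps)
  qed
qed

text \<open>The gradient bound is summed by packing, \<open>960 = 96 * 10\<close>. Distinctness of
  the visited vertices yields the square root of their number instead of the number itself.\<close>

lemma abs_pot_incr_le:
  assumes "e \<in> nbrs"
  shows "\<bar>pot_incr h e\<bar> \<le> 960 * sqrt (card (set h))"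
proof -
  have "\<bar>pot_incr h e\<bar> \<le> (\<Sum>y\<in>set h. \<bar>pot (hd h - y + e) - pot (hd h - y)\<bar>)"
    unfolding pot_incr_def by (rule sum_abs)
  also have "\<dots> \<le> (\<Sum>y\<in>set h. 96 * inv_norm (hd h - y))"
    using pot_gradient_le[OF assms] by (intro sum_mono) (simp add: inv_norm_def)
  also have "\<dots> = 96 * (\<Sum>y\<in>set h. inv_norm (hd h - y))" by (simp add: sum_distrib_left)
  also have "\<dots> \<le> 96 * (10 * sqrt (card (set h)))"
    by (intro mult_left_mono sum_inv_norm_shift_le) auto
  finally show ?thesis by simp
qed

lemma walk_mart_0: "walk_mart [0] = 0"
  by (simp add: walk_mart_def total_pot_def hdiff_form_def)

lemma walk_mart_mean: "walk_expectation n walk_mart = 0"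
proof (induction n)
  case (Suc n)
  have "walk_expectation (Suc n) walk_mart = walk_expectation n walk_mart"
    unfolding walk_expectation_Suc
    by (intro integral_cong_AE)
      (auto simp: AE_measure_pmf_iff walk_mart_Cons walk_law_not_Nil)
  with Suc show ?case by simp
qed (simp add: walk_mart_0)

lemma range_sum_le: "range_sum h \<le> length h * card (set (tl h))"
proof (induction h)
  case (Cons x h)
  have "card (set (tl h)) \<le> card (set h)" by (cases h) (auto intro!: card_mono)
  then have "length h * card (set (tl h)) \<le> length h * card (set h)" by simp
  with Cons have "range_sum h \<le> length h * card (set h)" by (rule order_trans)
  then show ?case by simp
qed simp

lemma exp_walk_mart:
  "walk_expectation n (\<lambda>h. exp (l * walk_mart h - l\<^sup>2 / 2 * (960\<^sup>2 * real (range_sum h)))) \<le> 1"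
  by (rule exp_supermartingale[where g = pot_incr and c = "\<lambda>h. 960 * sqrt (card (set h))"])
    (auto simp: walk_mart_Cons abs_pot_incr_le walk_mart_0 power_mult_distrib distrib_left)

section \<open>Gaussian tails for the displacement\<close>

lemma exp_coordinate:
  assumes "\<phi> = fst \<or> \<phi> = (snd :: int \<times> int \<Rightarrow> int)"
  shows "walk_expectation n (\<lambda>h. exp (l * of_int (\<phi> (hd h)))) \<le> exp (l\<^sup>2 / 2 * n)"
proof -
  have [simp]: "\<phi> (x + y) = \<phi> x + \<phi> y" "\<phi> 0 = 0" for x y using assms by auto
  \<comment> \<open>Both step laws are symmetric, so each coordinate is a martingale with increments
    at most 1, whatever the history.\<close>
  have E: "measure_pmf.expectation (departure_law h) (\<lambda>e. real_of_int (\<phi> e)) = 0" for h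
    using assms by (auto simp: expectation_departure_law nbrs_def)
  have "walk_expectation n (\<lambda>h. exp (l * of_int (\<phi> (hd h)) - l\<^sup>2 / 2 * (real (length h) - 1))) \<le> 1"
    by (rule exp_supermartingale[where g = "\<lambda>h e. of_int (\<phi> e)" and c = "\<lambda>_. 1"])
      (use assms in \<open>auto simp: E nbrs_def\<close>)
  also have "walk_expectation n (\<lambda>h. exp (l * of_int (\<phi> (hd h)) - l\<^sup>2 / 2 * (real (length h) - 1)))
     = walk_expectation n (\<lambda>h. exp (l * of_int (\<phi> (hd h))) / exp (l\<^sup>2 / 2 * n))"
  proof (rule integral_cong_AE)
    show "AE h in walk_law n. exp (l * of_int (\<phi> (hd h)) - l\<^sup>2 / 2 * (real (length h) - 1))
        = exp (l * of_int (\<phi> (hd h))) / exp (l\<^sup>2 / 2 * n)"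
      unfolding AE_measure_pmf_iff exp_diff using length_walk_law[of _ n] by simp
  qed auto
  finally show ?thesis by simp
qed

lemma walk_prob_le_expectation:
  assumes "\<And>h. h \<in> set_pmf (walk_law n) \<Longrightarrow> 0 \<le> f h" "\<And>h. h \<in> set_pmf (walk_law n) \<Longrightarrow> h \<in> A \<Longrightarrow> c \<le> f h" "0 < c"
  shows "walk_prob n A \<le> walk_expectation n f / c"
proof -
  have "walk_prob n A \<le> walk_expectation n (\<lambda>h. f h / c)"
    unfolding walk_prob_eq_expectation
    by (rule walk_expectation_mono) (use assms in \<open>auto simp: indicator_def field_simps\<close>)
  then show ?thesis by simp
qed

lemma walk_prob_coordinate_le:
  fixes k n :: nat
  assumes "\<phi> = fst \<or> \<phi> = (snd :: int \<times> int \<Rightarrow> int)" and "k \<le> n" "0 < n" "0 < t" "\<sigma> = 1 \<or> \<sigma> = (-1::real)"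
  shows "walk_prob k {h. t < \<sigma> * of_int (\<phi> (hd h))} \<le> exp (- (t\<^sup>2 / (2 * n)))"
proof -
  \<comment> \<open>The minimiser of \<open>l^2 * n / 2 - l * t\<close> over
    \<open>l\<close>.\<close>
  let ?l = "t / n"
  have "walk_prob k {h. t < \<sigma> * of_int (\<phi> (hd h))}
      \<le> walk_expectation k (\<lambda>h. exp ((\<sigma> * ?l) * of_int (\<phi> (hd h)))) / exp (?l * t)"
  proof (rule walk_prob_le_expectation)
    fix h assume "h \<in> {h. t < \<sigma> * of_int (\<phi> (hd h))}"
    then have "?l * t \<le> ?l * (\<sigma> * of_int (\<phi> (hd h)))"
      using assms by (intro mult_left_mono) auto
    then show "exp (?l * t) \<le> exp ((\<sigma> * ?l) * of_int (\<phi> (hd h)))" by (simp add: mult_ac)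
  qed auto
  also have "\<dots> \<le> exp ((\<sigma> * ?l)\<^sup>2 / 2 * k) / exp (?l * t)"
    by (intro divide_right_mono exp_coordinate assms) auto
  also have "(\<sigma> * ?l)\<^sup>2 = ?l\<^sup>2" using assms(5) by auto
  also have "exp (?l\<^sup>2 / 2 * k) / exp (?l * t) \<le> exp (?l\<^sup>2 / 2 * n) / exp (?l * t)"
    using assms by (intro divide_right_mono) (auto intro!: mult_left_mono)
  also have "\<dots> = exp (- (t\<^sup>2 / (2 * n)))"
    unfolding exp_diff[symmetric] using assms by (simp add: power2_eq_square field_simps)
  finally show ?thesis .
qed

lemma walk_prob_sup_norm_le:
  fixes k n :: nat
  assumes "k \<le> n" "0 < n" "0 < t"
  shows "walk_prob k {h. t < of_int (sup_norm (hd h))} \<le> 4 * exp (- (t\<^sup>2 / (2 * n)))"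
proof -
  let ?E = "\<lambda>\<sigma> (\<phi> :: int \<times> int \<Rightarrow> int). {h. t < \<sigma> * of_int (\<phi> (hd h))}"
  have "{h. t < of_int (sup_norm (hd h))} \<subseteq> (?E 1 fst \<union> ?E (-1) fst) \<union> (?E 1 snd \<union> ?E (-1) snd)"
    by (auto simp: sup_norm_def max_def abs_if split: if_splits)
  then have "walk_prob k {h. t < of_int (sup_norm (hd h))}
     \<le> walk_prob k ((?E 1 fst \<union> ?E (-1) fst) \<union> (?E 1 snd \<union> ?E (-1) snd))"
    by (intro measure_pmf.finite_measure_mono) auto
  also have "\<dots> \<le> (walk_prob k (?E 1 fst) + walk_prob k (?E (-1) fst)) + (walk_prob k (?E 1 snd) + walk_prob k (?E (-1) snd))"
    by (intro order_trans[OF measure_Un_le] add_mono) auto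
  also have "\<dots> \<le> 4 * exp (- (t\<^sup>2 / (2 * n)))"
    using walk_prob_coordinate_le[of fst k n t 1] walk_prob_coordinate_le[of fst k n t "-1"]
      walk_prob_coordinate_le[of snd k n t 1] walk_prob_coordinate_le[of snd k n t "-1"] assms by simp
  finally show ?thesis .
qed

text \<open>Union bound over times: deleting the head of a history at time \<open>k + 1\<close>
  gives the law at time \<open>k\<close>. The variance parameter \<open>n\<close> stays fixed in the
  induction.\<close>

lemma walk_prob_max_sup_norm_le:
  fixes k n :: nat
  assumes "k \<le> n" "0 < n" "0 < t"
  shows "walk_prob k {h. \<exists>x\<in>set h. t < of_int (sup_norm x)} \<le> real (k + 1) * (4 * exp (- (t\<^sup>2 / (2 * n))))"
  using assms(1)
proof (induction k)
  case 0
  then show ?case using assms by (simp add: sup_norm_def)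
next
  case (Suc k)
  let ?A = "{h. \<exists>x\<in>set h. t < of_int (sup_norm x)}"
  have "walk_prob (Suc k) ?A \<le> walk_prob (Suc k) ({h. t < of_int (sup_norm (hd h))} \<union> tl -` ?A)"
    by (rule measure_pmf.finite_measure_mono_AE)
      (auto simp: AE_measure_pmf_iff dest!: walk_law_not_Nil simp del: walk_law.simps, (metis list.exhaust_sel set_ConsD)+)
  also have "\<dots> \<le> walk_prob (Suc k) {h. t < of_int (sup_norm (hd h))} + walk_prob (Suc k) (tl -` ?A)"
    by (rule measure_Un_le) auto
  also have "walk_prob (Suc k) (tl -` ?A) = walk_prob k ?A"
    unfolding measure_map_pmf[symmetric] walk_law_tl ..
  also have "walk_prob (Suc k) {h. t < of_int (sup_norm (hd h))} \<le> 4 * exp (- (t\<^sup>2 / (2 * n)))"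
    using Suc assms by (intro walk_prob_sup_norm_le) auto
  also have "walk_prob k ?A \<le> real (k + 1) * (4 * exp (- (t\<^sup>2 / (2 * n))))" using Suc by simp
  finally show ?case by (simp add: algebra_simps)
qed

text \<open>A crude deterministic bound, for expectations over the rare histories that are not
  \<open>diffusive\<close>.\<close>

lemma abs_walk_mart_le: "h \<in> set_pmf (walk_law n) \<Longrightarrow> \<bar>walk_mart h\<bar> \<le> 1920 * real n * real n"
proof (induction n arbitrary: h)
  case 0
  then show ?case by (simp add: walk_mart_0)
next
  case (Suc n)
  then obtain h' e where h: "h' \<in> set_pmf (walk_law n)" "e \<in> set_pmf (departure_law h')" "h = (hd h' + e) # h'"
    by auto
  have ne: "h' \<noteq> []" using h(1) by (rule walk_law_not_Nil)
  have "card (set h') \<le> Suc n" using card_length[of h'] length_walk_law[OF h(1)] by simp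
  also have "\<dots> \<le> (Suc n)\<^sup>2" by (simp add: power2_eq_square)
  finally have "real (card (set h')) \<le> (real (Suc n))\<^sup>2" by (metis of_nat_le_iff of_nat_power)
  then have s: "sqrt (card (set h')) \<le> real (Suc n)" by (intro real_le_lsqrt) auto
  have "\<bar>pot_incr h' e\<bar> \<le> 960 * sqrt (card (set h'))" "\<bar>measure_pmf.expectation (departure_law h') (pot_incr h')\<bar> \<le> 960 * sqrt (card (set h'))"
    using h set_departure_law by (auto intro!: expectation_abs_le abs_pot_incr_le)
  moreover have "\<bar>a + (b - c)\<bar> \<le> \<bar>a\<bar> + 1920 * r" if "\<bar>b\<bar> \<le> 960 * q" "\<bar>c\<bar> \<le> 960 * q" "q \<le> r" for a b c q r :: real
  proof -
    have "\<bar>a + (b - c)\<bar> \<le> \<bar>a\<bar> + \<bar>b - c\<bar>" by (rule abs_triangle_ineq)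
    also have "\<bar>b - c\<bar> \<le> \<bar>b\<bar> + \<bar>c\<bar>" by (rule abs_triangle_ineq4)
    also have "\<bar>b\<bar> + \<bar>c\<bar> \<le> 960 * r + 960 * r" using that by (intro add_mono) (auto intro: order_trans)
    finally show ?thesis by simp
  qed
  ultimately have "\<bar>walk_mart h\<bar> \<le> \<bar>walk_mart h'\<bar> + 1920 * real (Suc n)"
    unfolding h(3) walk_mart_Cons[OF ne] using s by blast
  also have "\<bar>walk_mart h'\<bar> \<le> 1920 * real n * real n" using Suc h by simp
  finally show ?case by (simp add: algebra_simps)
qed

section \<open>Consequences of the martingale estimate\<close>

lemma abs_hdiff_0_le: "\<bar>hdiff 0\<bar> \<le> 2"
  using hdiff_form_le[of "{0}"] by simp

lemma total_pot_compensated: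
  assumes "h \<in> set_pmf (walk_law n)"
  shows "\<bar>total_pot h - real n - walk_mart h\<bar> \<le> 3 * card (set (tl h))"
proof -
  let ?R = "real (card (set (tl h)))"
  have "\<bar>hdiff_form (set (tl h))\<bar> \<le> ?R"
    using hdiff_form_le[of "set (tl h)"] by (simp add: hdiff_form_def)
  moreover have "\<bar>(hdiff 0 / 2 - 1) * ?R\<bar> \<le> 2 * ?R"
    unfolding abs_mult using abs_hdiff_0_le by (intro mult_mono) auto
  moreover have "total_pot h - real n - walk_mart h = hdiff_form (set (tl h)) + (hdiff 0 / 2 - 1) * ?R"
    using length_walk_law[OF assms] by (simp add: walk_mart_def)
  ultimately show ?thesis by linarith
qed

text \<open>\<open>ln x <= x - 1\<close> at \<open>x = n / (R * L)\<close>. It replaces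
  \<open>ln R\<close> by \<open>ln n\<close> without an a priori lower bound on \<open>R\<close>:
  for small \<open>R\<close> the loss is covered by \<open>n / L\<close>. Later uses take
  \<open>L = ln n\<close>.\<close>

lemma mult_ln_ge:
  fixes R n L :: real
  assumes "0 \<le> R" "0 < n" "0 < L"
  shows "R * (ln n - ln L) - n / L \<le> R * ln R"
proof (cases "R = 0")
  case False
  then have R: "0 < R" using assms by simp
  have "ln (n / (R * L)) \<le> n / (R * L) - 1"
    using assms R by (intro ln_le_minus_one) auto
  then have "R * (ln n - (ln R + ln L)) \<le> R * (n / (R * L) - 1)"
    using assms R by (intro mult_left_mono) (auto simp: ln_div ln_mult)
  also have "\<dots> = n / L - R" using R by (simp add: field_simps)
  finally show ?thesis using R by (simp add: algebra_simps)
qed (use assms in simp)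

text \<open>The lower bound is on \<open>total_pot\<close>, from distinctness of the points; for
  \<open>R\<close> it amounts to an upper bound. The constant 400 covers
  \<open>4 * (95 + 3)\<close>, with \<open>pi < 4\<close>.\<close>

lemma range_lower:
  assumes h: "h \<in> set_pmf (walk_law n)" and n: "0 < n" and L: "0 < L"
  defines "R \<equiv> real (card (set (tl h)))"
  shows "R * ln n - pi * (n + walk_mart h) \<le> R * (ln L + 400) + n / L"
proof -
  have R: "0 \<le> R" by (simp add: R_def)
  have "R * (ln R / pi - 95) \<le> total_pot h"
    unfolding R_def total_pot_def by (rule sum_pot_ge) simp
  also have "\<dots> \<le> n + walk_mart h + 3 * R"
    using total_pot_compensated[OF h] unfolding R_def by linarith
  finally have "pi * (R * (ln R / pi - 95)) \<le> pi * (n + walk_mart h + 3 * R)"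
    by (intro mult_left_mono) auto
  then have "R * ln R \<le> pi * (n + walk_mart h) + pi * (98 * R)" by (simp add: algebra_simps)
  moreover have "R * (ln n - ln L) - n / L \<le> R * ln R" using mult_ln_ge[OF R, of n L] n L by simp
  moreover have "pi * (98 * R) \<le> 4 * (98 * R)" using R pi_less_4 by (intro mult_right_mono) auto
  ultimately have "R * ln n - R * ln L - n / L \<le> pi * (n + walk_mart h) + 392 * R"
    by (simp add: algebra_simps)
  then show ?thesis using R by (simp add: algebra_simps)
qed

text \<open>At this radius the Gaussian tail is \<open>exp (- 3 * ln n)\<close>, that is
  \<open>1 / n^3\<close>, which survives the union over n + 1 times.\<close>

definition diffusive :: "nat \<Rightarrow> (int \<times> int) list \<Rightarrow> bool" where
  "diffusive n h \<longleftrightarrow> (\<forall>x\<in>set h. of_int (sup_norm x) \<le> sqrt (6 * real n * ln n))"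

text \<open>All visited points are within \<open>5 * sqrt (n * ln n)\<close> of the current one, so
  each \<open>pot\<close> is at most \<open>(ln n + ln (ln n)) / pi\<close> plus a constant; for
  \<open>R\<close> this is a lower bound. 400 covers \<open>35 + 4 * (85 + 3)\<close>.\<close>

lemma range_upper:
  assumes h: "h \<in> set_pmf (walk_law n)" and n: "1 \<le> ln n" "diffusive n h"
  defines "R \<equiv> real (card (set (tl h)))"
  shows "pi * (n + walk_mart h) - R * ln n \<le> R * (ln (ln n) + 400)"
proof -
  have n0: "1 \<le> real n" using n(1) by (cases n) auto
  let ?L = "ln (real n)"
  let ?s = "sqrt (n * ?L)"
  have nL: "1 * 1 \<le> n * ?L" using n0 n(1) by (intro mult_mono) auto
  then have s: "1 \<le> ?s" by simp
  have ne: "h \<noteq> []" using h by (rule walk_law_not_Nil)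
  have sq: "sqrt (6 * real n * ?L) \<le> 5 / 2 * ?s"
  proof (rule real_le_lsqrt)
    show "6 * real n * ?L \<le> (5 / 2 * ?s)\<^sup>2" using nL by (simp add: power_mult_distrib power_divide)
  qed (use s in auto)
  have p: "pot (hd h - y) \<le> (ln 36 + ?L + ln ?L) / pi + 85" if "y \<in> set (tl h)" for y
  proof -
    let ?m = "1 + real_of_int (sup_norm (hd h - y))"
    have "y \<in> set h" using that ne by (auto simp: list.set_sel(2))
    moreover have "real_of_int (sup_norm x) \<le> 5 / 2 * ?s" if "x \<in> set h" for x
      using n(2) that sq unfolding diffusive_def by (meson order_trans)
    ultimately have "real_of_int (sup_norm (hd h)) \<le> 5 / 2 * ?s" "real_of_int (sup_norm y) \<le> 5 / 2 * ?s"
      using ne by auto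
    moreover have "real_of_int (sup_norm (hd h - y)) \<le> real_of_int (sup_norm (hd h)) + real_of_int (sup_norm y)"
      using sup_norm_triangle_diff[of "hd h" y] by linarith
    ultimately have "?m \<le> 6 * ?s" using s by linarith
    moreover have m: "0 < ?m" using sup_norm_nonneg[of "hd h - y"] by linarith
    ultimately have "?m\<^sup>2 \<le> (6 * ?s)\<^sup>2" by (intro power_mono) auto
    also have "\<dots> = 36 * (n * ?L)" using nL by (simp add: power_mult_distrib)
    finally have "ln (?m\<^sup>2) \<le> ln (36 * (n * ?L))"
      using zero_less_power[OF m, of 2] by (meson ln_le_cancel_iff order_less_le_trans)
    moreover have "ln (?m\<^sup>2) = 2 * ln ?m" using m by (simp add: ln_realpow)
    moreover have "ln (36 * (n * ?L)) = ln 36 + ?L + ln ?L"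
    proof -
      have "0 < ?L" using n(1) by linarith
      then show ?thesis using n0 by (simp add: ln_mult)
    qed
    ultimately have "2 * ln ?m \<le> ln 36 + ?L + ln ?L" by simp
    then have "2 * ln ?m / pi \<le> (ln 36 + ?L + ln ?L) / pi" by (intro divide_right_mono) auto
    then show ?thesis using pot_bounds[of "hd h - y"] by simp
  qed
  have "total_pot h \<le> R * ((ln 36 + ?L + ln ?L) / pi + 85)"
    unfolding total_pot_def R_def by (rule sum_bounded_above[OF p])
  moreover have "n + walk_mart h \<le> total_pot h + 3 * R"
    using total_pot_compensated[OF h] unfolding R_def by linarith
  ultimately have "pi * (n + walk_mart h) \<le> pi * (R * ((ln 36 + ?L + ln ?L) / pi + 85) + 3 * R)"
    by (intro mult_left_mono) auto
  also have "\<dots> = R * (ln 36 + ?L + ln ?L) + pi * (88 * R)"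
  proof -
    have "pi * (R * (z / pi + 85) + 3 * R) = R * z + pi * (88 * R)" for z by (simp add: algebra_simps)
    then show ?thesis .
  qed
  finally have "pi * (n + walk_mart h) \<le> R * (ln 36 + ?L + ln ?L) + pi * (88 * R)" .
  moreover have "pi * (88 * R) \<le> 4 * (88 * R)" using pi_less_4 by (intro mult_right_mono) (auto simp: R_def)
  moreover have "R * ln 36 \<le> R * 35"
    using ln_le_minus_one[of 36] by (intro mult_left_mono) (auto simp: R_def)
  moreover have "0 \<le> R" by (simp add: R_def)
  ultimately show ?thesis by (simp add: algebra_simps)
qed

text \<open>This breaks the circularity between range and martingale. In \<open>range_lower\<close>
  with \<open>L = ln n\<close>, half of the left-hand side absorbs the term in \<open>R\<close>, and
  the rest is at most \<open>5 * (n + |walk_mart h|)\<close>.\<close>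

lemma range_le_mart:
  "\<forall>\<^sub>F n in sequentially. \<forall>h\<in>set_pmf (walk_law n).
     real (card (set (tl h))) * ln n \<le> 10 * (n + \<bar>walk_mart h\<bar>)"
proof -
  have "\<forall>\<^sub>F n in sequentially. ln (ln (real n)) + 400 \<le> ln (real n) / 2"
    "\<forall>\<^sub>F n in sequentially. 1 \<le> ln (real n)"
    by real_asymp+
  then show ?thesis
    using eventually_gt_at_top[of 0]
  proof eventually_elim
    case (elim n)
    show ?case
    proof
      fix h assume h: "h \<in> set_pmf (walk_law n)"
      let ?R = "real (card (set (tl h)))"
      have "?R * (ln (ln (real n)) + 400) \<le> ?R * (ln (real n) / 2)"
        using elim by (intro mult_left_mono) auto
      moreover have "real n / ln n \<le> real n / 1" using elim(2) by (intro divide_left_mono) auto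
      moreover have "pi * (n + walk_mart h) \<le> 4 * (n + \<bar>walk_mart h\<bar>)"
        using pi_less_4 by (intro order_trans[OF mult_left_mono mult_right_mono]) auto
      moreover have "?R * ln n - pi * (n + walk_mart h) \<le> ?R * (ln (ln n) + 400) + n / ln n"
        using elim(2) by (intro range_lower[OF h elim(3)]) linarith
      ultimately show "?R * ln n \<le> 10 * (n + \<bar>walk_mart h\<bar>)"
        unfolding distrib_left times_divide_eq_right using abs_ge_zero[of "walk_mart h"] by linarith
    qed
  qed
qed

section \<open>Rescaled range and martingale\<close>

definition scaled_range :: "nat \<Rightarrow> (int \<times> int) list \<Rightarrow> real" where
  "scaled_range n h = ln n / n * card (set (tl h))"

definition scaled_mart :: "nat \<Rightarrow> (int \<times> int) list \<Rightarrow> real" where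
  "scaled_mart n h = walk_mart h / n"

text \<open>The first bound, free of any control on the displacement, serves exponential moments and
  rare histories; the second gives the rate. With 10 from \<open>range_le_mart\<close>,
  \<open>14 = 10 + 4\<close> and \<open>21 = 2 * 10 + 1\<close>.\<close>

lemma scaled_range_approx:
  "\<forall>\<^sub>F n in sequentially. \<forall>h\<in>set_pmf (walk_law n).
     \<bar>scaled_range n h - pi - pi * scaled_mart n h\<bar> \<le> 14 * (1 + \<bar>scaled_mart n h\<bar>) \<and>
     (diffusive n h \<longrightarrow> \<bar>scaled_range n h - pi - pi * scaled_mart n h\<bar>
        \<le> 21 * (ln (ln n) / ln n) * (1 + \<bar>scaled_mart n h\<bar>))"
proof -
  have "\<forall>\<^sub>F n in sequentially. 400 \<le> ln (ln (real n))"
    "\<forall>\<^sub>F n in sequentially. 1 \<le> ln (real n)"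
    by real_asymp+
  then show ?thesis
    using eventually_gt_at_top[of 0] range_le_mart
  proof eventually_elim
    case (elim n)
    show ?case
    proof
      fix h assume h: "h \<in> set_pmf (walk_law n)"
      let ?R = "real (card (set (tl h)))" and ?Y = "walk_mart h"
      let ?l = "ln (ln n)" and ?L = "ln n"
      let ?D = "?R * ?L - pi * (n + ?Y)"
      have n: "0 < real n" using elim by simp
      have le: "?R * ?L \<le> 10 * (n + \<bar>?Y\<bar>)" using elim h by blast
      have D: "scaled_range n h - pi - pi * scaled_mart n h = ?D / n"
        using n by (simp add: scaled_range_def scaled_mart_def field_simps)
      have Yn: "(n + \<bar>?Y\<bar>) / n = 1 + \<bar>scaled_mart n h\<bar>"
        using n by (simp add: scaled_mart_def add_divide_distrib)
      have "\<bar>pi * (n + ?Y)\<bar> \<le> 4 * (n + \<bar>?Y\<bar>)"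
        unfolding abs_mult using pi_less_4 by (intro mult_mono) auto
      moreover have "0 \<le> ?R * ?L" using elim by simp
      ultimately have "\<bar>?D\<bar> \<le> 14 * (n + \<bar>?Y\<bar>)" using le by linarith
      then have "\<bar>?D\<bar> / n \<le> 14 * (n + \<bar>?Y\<bar>) / n" using n by (intro divide_right_mono) auto
      then have 1: "\<bar>scaled_range n h - pi - pi * scaled_mart n h\<bar> \<le> 14 * (1 + \<bar>scaled_mart n h\<bar>)"
        unfolding D Yn[symmetric] using n by simp
      have 2: "\<bar>scaled_range n h - pi - pi * scaled_mart n h\<bar> \<le> 21 * (?l / ?L) * (1 + \<bar>scaled_mart n h\<bar>)"
        if "diffusive n h"
      proof -
        have L: "0 < ?L" using elim(2) by linarith
        have "?D \<le> ?R * (?l + 400) + n / ?L" by (rule range_lower[OF h elim(3) L])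
        moreover have "- ?D \<le> ?R * (?l + 400)" using range_upper[OF h elim(2) that] by simp
        moreover have "0 \<le> n / ?L" using L by simp
        ultimately have "\<bar>?D\<bar> \<le> ?R * (?l + 400) + n / ?L" by linarith
        also have "?R * (?l + 400) \<le> ?R * (2 * ?l)" using elim by (intro mult_left_mono) auto
        also have "?R * (2 * ?l) = 2 * (?R * ?L) * (?l / ?L)" using L by simp
        also have "\<dots> \<le> 2 * (10 * (n + \<bar>?Y\<bar>)) * (?l / ?L)"
          using le elim L by (intro mult_right_mono mult_left_mono) auto
        finally have "\<bar>?D\<bar> \<le> 2 * (10 * (n + \<bar>?Y\<bar>)) * (?l / ?L) + n / ?L" by simp
        also have "n / ?L \<le> (n + \<bar>?Y\<bar>) * (?l / ?L)"
        proof -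
          have "real n * 1 \<le> (n + \<bar>?Y\<bar>) * ?l" using elim by (intro mult_mono) auto
          then show ?thesis using L by (simp add: divide_right_mono)
        qed
        finally have "\<bar>?D\<bar> \<le> 2 * (10 * (n + \<bar>?Y\<bar>)) * (?l / ?L) + (n + \<bar>?Y\<bar>) * (?l / ?L)" by simp
        moreover have "2 * (10 * s) * E + s * E = 21 * E * s" for s E :: real by simp
        ultimately have "\<bar>?D\<bar> \<le> 21 * (?l / ?L) * (n + \<bar>?Y\<bar>)" by (metis (no_types))
        then have "\<bar>?D\<bar> / n \<le> 21 * (?l / ?L) * (n + \<bar>?Y\<bar>) / n" using n by (intro divide_right_mono) auto
        then show ?thesis unfolding D Yn[symmetric] using n by simp
      qed
      show "\<bar>scaled_range n h - pi - pi * scaled_mart n h\<bar> \<le> 14 * (1 + \<bar>scaled_mart n h\<bar>) \<and>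
        (diffusive n h \<longrightarrow> \<bar>scaled_range n h - pi - pi * scaled_mart n h\<bar> \<le> 21 * (?l / ?L) * (1 + \<bar>scaled_mart n h\<bar>))"
        using 1 2 by simp
    qed
  qed
qed

text \<open>\<open>range_le_mart\<close> expresses the variance term through
  \<open>|scaled_mart n h|\<close> itself, and only linearly. Adding the bounds for
  \<open>b / n\<close> and \<open>- b / n\<close> gives the absolute value and the constant 2.
  Uniformity in \<open>b\<close> lets \<open>b\<close> depend on \<open>n\<close> later.\<close>

lemma exp_scaled_mart:
  obtains K :: real where "0 < K"
    "\<forall>\<^sub>F n in sequentially. \<forall>b. walk_expectation n
       (\<lambda>h. exp (b * \<bar>scaled_mart n h\<bar> - b\<^sup>2 * K * (1 + \<bar>scaled_mart n h\<bar>) / ln n)) \<le> 2"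
proof
  show "0 < (10 * 960\<^sup>2 :: real)" by simp
  have "\<forall>\<^sub>F n in sequentially. 1 \<le> ln (real n)" by real_asymp
  then show "\<forall>\<^sub>F n in sequentially. \<forall>b. walk_expectation n
       (\<lambda>h. exp (b * \<bar>scaled_mart n h\<bar> - b\<^sup>2 * (10 * 960\<^sup>2) * (1 + \<bar>scaled_mart n h\<bar>) / ln n)) \<le> 2"
    using eventually_gt_at_top[of 0] range_le_mart
  proof eventually_elim
    case (elim n)
    have n: "1 \<le> real n" using elim by simp
    have L: "0 < ln (real n)" using elim(1) by linarith
    show ?case
    proof
      fix b :: real
      let ?E = "\<lambda>l h. exp (l * walk_mart h - l\<^sup>2 / 2 * (960\<^sup>2 * real (range_sum h)))"
      have "walk_expectation n (\<lambda>h. exp (b * \<bar>scaled_mart n h\<bar> - b\<^sup>2 * (10 * 960\<^sup>2) * (1 + \<bar>scaled_mart n h\<bar>) / ln n))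
         \<le> walk_expectation n (\<lambda>h. ?E (b / n) h + ?E (- b / n) h)"
      proof (rule walk_expectation_mono)
        fix h assume h: "h \<in> set_pmf (walk_law n)"
        let ?R = "real (card (set (tl h)))" and ?y = "\<bar>scaled_mart n h\<bar>"
        have "real (range_sum h) \<le> real (Suc n * card (set (tl h)))"
          using range_sum_le[of h] length_walk_law[OF h] by (simp only: of_nat_le_iff)
        also have "\<dots> = (real n + 1) * ?R" by (simp add: algebra_simps)
        also have "\<dots> \<le> (2 * n) * ?R" using n by (intro mult_right_mono) auto
        also have "?R \<le> 10 * (n + \<bar>walk_mart h\<bar>) / ln n" using elim h L by (simp add: le_divide_eq)
        also have "n + \<bar>walk_mart h\<bar> = n * (1 + ?y)" using n by (simp add: scaled_mart_def field_simps)
        finally have "real (range_sum h) \<le> 2 * n * (10 * (n * (1 + ?y)) / ln n)"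
          using n by (simp add: mult_left_mono)
        then have "(b / n)\<^sup>2 / 2 * (960\<^sup>2 * real (range_sum h)) \<le> (b / n)\<^sup>2 / 2 * (960\<^sup>2 * (2 * n * (10 * (n * (1 + ?y)) / ln n)))"
          by (intro mult_left_mono) auto
        also have "\<dots> = b\<^sup>2 * (10 * 960\<^sup>2) * (1 + ?y) / ln n"
          using n L by (simp add: power2_eq_square field_simps)
        finally have V: "(b / n)\<^sup>2 / 2 * (960\<^sup>2 * real (range_sum h)) \<le> b\<^sup>2 * (10 * 960\<^sup>2) * (1 + ?y) / ln n" .
        have "b * ?y = (b / n) * walk_mart h \<or> b * ?y = (- b / n) * walk_mart h"
          using n by (auto simp: scaled_mart_def abs_if)
        moreover have "(- b / n)\<^sup>2 = (b / n)\<^sup>2" by (simp add: power2_eq_square)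
        ultimately have "exp (b * ?y - b\<^sup>2 * (10 * 960\<^sup>2) * (1 + ?y) / ln n) \<le> ?E (b / n) h
            \<or> exp (b * ?y - b\<^sup>2 * (10 * 960\<^sup>2) * (1 + ?y) / ln n) \<le> ?E (- b / n) h"
          using V by auto
        moreover have "0 \<le> ?E (b / n) h" "0 \<le> ?E (- b / n) h" by simp_all
        ultimately show "exp (b * ?y - b\<^sup>2 * (10 * 960\<^sup>2) * (1 + ?y) / ln n) \<le> ?E (b / n) h + ?E (- b / n) h"
          by linarith
      qed
      also have "\<dots> = walk_expectation n (?E (b / n)) + walk_expectation n (?E (- b / n))"
        by (intro Bochner_Integration.integral_add) auto
      also have "\<dots> \<le> 2" using exp_walk_mart[of n "b / n"] exp_walk_mart[of n "- b / n"] by linarith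
      finally show "walk_expectation n (\<lambda>h. exp (b * \<bar>scaled_mart n h\<bar> - b\<^sup>2 * (10 * 960\<^sup>2) * (1 + \<bar>scaled_mart n h\<bar>) / ln n)) \<le> 2" .
    qed
  qed
qed

text \<open>The choice \<open>b = sqrt (ln n)\<close> turns the variance term into
  \<open>K * (1 + |scaled_mart n h|)\<close>; once \<open>2 * K <= sqrt (ln n)\<close>, half of the
  main term absorbs its linear part.\<close>

lemma scaled_mart_exp_moment:
  obtains K :: real where "\<forall>\<^sub>F n in sequentially.
    walk_expectation n (\<lambda>h. exp (sqrt (ln n) / 2 * \<bar>scaled_mart n h\<bar>)) \<le> K"
proof -
  obtain K :: real where K: "0 < K"
    and ev: "\<forall>\<^sub>F n in sequentially. \<forall>b. walk_expectation n
       (\<lambda>h. exp (b * \<bar>scaled_mart n h\<bar> - b\<^sup>2 * K * (1 + \<bar>scaled_mart n h\<bar>) / ln n)) \<le> 2"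
    by (rule exp_scaled_mart)
  have "\<forall>\<^sub>F n in sequentially. 2 * K \<le> sqrt (ln (real n))" "\<forall>\<^sub>F n in sequentially. 1 \<le> ln (real n)"
    by real_asymp+
  then have "\<forall>\<^sub>F n in sequentially.
    walk_expectation n (\<lambda>h. exp (sqrt (ln n) / 2 * \<bar>scaled_mart n h\<bar>)) \<le> 2 * exp K"
    using ev
  proof eventually_elim
    case (elim n)
    let ?b = "sqrt (ln (real n))"
    have L: "0 < ln (real n)" using elim(2) by linarith
    then have b: "?b\<^sup>2 = ln n" by simp
    have "walk_expectation n (\<lambda>h. exp (?b / 2 * \<bar>scaled_mart n h\<bar>))
      \<le> walk_expectation n (\<lambda>h. exp K * exp (?b * \<bar>scaled_mart n h\<bar> - ?b\<^sup>2 * K * (1 + \<bar>scaled_mart n h\<bar>) / ln n))"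
    proof (rule walk_expectation_mono)
      fix h
      have *: "K * \<bar>scaled_mart n h\<bar> \<le> ?b / 2 * \<bar>scaled_mart n h\<bar>"
        using elim by (intro mult_right_mono) auto
      have "?b / 2 * \<bar>scaled_mart n h\<bar> \<le> K + (?b * \<bar>scaled_mart n h\<bar> - ?b\<^sup>2 * K * (1 + \<bar>scaled_mart n h\<bar>) / ln n)"
      proof -
        have "?b\<^sup>2 * K * (1 + \<bar>scaled_mart n h\<bar>) / ln n = K + K * \<bar>scaled_mart n h\<bar>"
          unfolding b using L by (simp add: field_simps)
        moreover have "?b * \<bar>scaled_mart n h\<bar> = ?b / 2 * \<bar>scaled_mart n h\<bar> + ?b / 2 * \<bar>scaled_mart n h\<bar>" by simp
        ultimately show ?thesis using * by linarith
      qed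
      then show "exp (?b / 2 * \<bar>scaled_mart n h\<bar>) \<le> exp K * exp (?b * \<bar>scaled_mart n h\<bar> - ?b\<^sup>2 * K * (1 + \<bar>scaled_mart n h\<bar>) / ln n)"
        unfolding exp_add[symmetric] by simp
    qed
    also have "\<dots> = exp K * walk_expectation n (\<lambda>h. exp (?b * \<bar>scaled_mart n h\<bar> - ?b\<^sup>2 * K * (1 + \<bar>scaled_mart n h\<bar>) / ln n))"
      by simp
    also have "\<dots> \<le> exp K * 2" by (intro mult_left_mono elim(3)[rule_format]) auto
    finally show ?case by simp
  qed
  then show ?thesis by (rule that)
qed

lemma scaled_mart_tail:
  fixes \<epsilon> :: real
  assumes "0 < \<epsilon>" "\<epsilon> \<le> 1"
  obtains c :: real where "0 < c" "\<forall>\<^sub>F n in sequentially. walk_prob n {h. \<epsilon> \<le> \<bar>scaled_mart n h\<bar>} \<le> 2 * n powr (- c)"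
proof -
  obtain K :: real where K: "0 < K"
    and ev: "\<forall>\<^sub>F n in sequentially. \<forall>b. walk_expectation n
       (\<lambda>h. exp (b * \<bar>scaled_mart n h\<bar> - b\<^sup>2 * K * (1 + \<bar>scaled_mart n h\<bar>) / ln n)) \<le> 2"
    by (rule exp_scaled_mart)
  \<comment> \<open>Here \<open>b = a * ln n\<close>. With \<open>a * K = \<epsilon> / 4\<close> and
    \<open>\<epsilon> \<le> 1\<close> the exponent is at least
    \<open>a * \<epsilon> / 2 * ln n\<close> wherever the rescaled martingale reaches
    \<open>\<epsilon>\<close>, which yields a power of \<open>n\<close>.\<close>
  define a where "a = \<epsilon> / (4 * K)"
  have a: "0 < a" "a * K = \<epsilon> / 4" using assms K by (simp_all add: a_def)
  have "\<forall>\<^sub>F n in sequentially. 1 \<le> ln (real n)" by real_asymp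
  then have "\<forall>\<^sub>F n in sequentially. walk_prob n {h. \<epsilon> \<le> \<bar>scaled_mart n h\<bar>} \<le> 2 * n powr (- (a * \<epsilon> / 2))"
    using ev eventually_gt_at_top[of 0]
  proof eventually_elim
    case (elim n)
    let ?b = "a * ln n"
    have "walk_prob n {h. \<epsilon> \<le> \<bar>scaled_mart n h\<bar>}
      \<le> walk_expectation n (\<lambda>h. exp (?b * \<bar>scaled_mart n h\<bar> - ?b\<^sup>2 * K * (1 + \<bar>scaled_mart n h\<bar>) / ln n)) / exp (a * \<epsilon> / 2 * ln n)"
    proof (rule walk_prob_le_expectation)
      fix h assume h: "h \<in> {h. \<epsilon> \<le> \<bar>scaled_mart n h\<bar>}"
      let ?y = "\<bar>scaled_mart n h\<bar>"
      have "\<epsilon> * ?y \<le> 1 * ?y" using assms by (intro mult_right_mono) auto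
      moreover have "\<epsilon> / 4 * (1 + ?y) = \<epsilon> / 4 + \<epsilon> * ?y / 4" by (simp add: algebra_simps)
      moreover have "\<epsilon> \<le> ?y" using h by simp
      ultimately have "\<epsilon> / 2 \<le> ?y - \<epsilon> / 4 * (1 + ?y)" by linarith
      then have "a * ln n * (\<epsilon> / 2) \<le> a * ln n * (?y - a * K * (1 + ?y))"
        unfolding a(2) using a elim by (intro mult_left_mono) auto
      also have "\<dots> = ?b * ?y - ?b\<^sup>2 * K * (1 + ?y) / ln n"
      proof -
        have "a * L * (y - a * K * (1 + y)) = a * L * y - (a * L)\<^sup>2 * K * (1 + y) / L" if "L \<noteq> 0" for L y :: real
          using that by (simp add: power2_eq_square field_simps)
        moreover have "ln (real n) \<noteq> 0" using elim(1) by linarith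
        ultimately show ?thesis by blast
      qed
      finally show "exp (a * \<epsilon> / 2 * ln n) \<le> exp (?b * ?y - ?b\<^sup>2 * K * (1 + ?y) / ln n)"
        by (simp add: mult_ac)
    qed auto
    also have "\<dots> \<le> 2 / exp (a * \<epsilon> / 2 * ln n)" using elim by (intro divide_right_mono) auto
    also have "\<dots> = 2 * n powr (- (a * \<epsilon> / 2))" using elim by (simp add: powr_def exp_minus field_simps)
    finally show ?case .
  qed
  then show ?thesis using that[of "a * \<epsilon> / 2"] a assms by simp
qed

lemma walk_prob_not_diffusive:
  assumes "1 \<le> ln (real n)"
  shows "walk_prob n {h. \<not> diffusive n h} \<le> 8 / (real n)\<^sup>2"
proof -
  have n: "1 \<le> real n" using assms by (cases n) auto
  let ?t = "sqrt (6 * real n * ln n)"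
  have "0 < ln (real n)" using assms by linarith
  then have "0 < real n * ln n" using n by (intro mult_pos_pos) auto
  then have t: "?t\<^sup>2 = 6 * real n * ln n" "0 < ?t" by (simp_all only: real_sqrt_gt_0_iff real_sqrt_pow2 mult.assoc)
  have "{h. \<not> diffusive n h} = {h. \<exists>x\<in>set h. ?t < of_int (sup_norm x)}"
    by (auto simp: diffusive_def not_le)
  then have "walk_prob n {h. \<not> diffusive n h} \<le> real (n + 1) * (4 * exp (- (?t\<^sup>2 / (2 * n))))"
    using walk_prob_max_sup_norm_le[of n n ?t] n t(2) by simp
  also have "- (?t\<^sup>2 / (2 * n)) = - (3 * ln n)" unfolding t using n by simp
  also have "exp (- (3 * ln n)) = 1 / (real n) ^ 3"
    using n exp_of_nat_mult[of 3 "ln (real n)"] by (simp add: exp_minus inverse_eq_divide)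
  also have "real (n + 1) * (4 * (1 / (real n) ^ 3)) \<le> (2 * real n) * (4 * (1 / (real n) ^ 3))"
    using n by (intro mult_right_mono) auto
  also have "\<dots> = 8 / (real n)\<^sup>2" using n by (simp add: power2_eq_square power3_eq_cube)
  finally show ?thesis .
qed

lemma abs_scaled_mart_le: "h \<in> set_pmf (walk_law n) \<Longrightarrow> \<bar>scaled_mart n h\<bar> \<le> 1920 * n"
  using abs_walk_mart_le[of h n] by (cases "n = 0") (auto simp: scaled_mart_def divide_le_eq)

lemma scaled_range_rates:
  obtains C :: real where "\<forall>\<^sub>F n in sequentially.
     walk_expectation n (\<lambda>h. \<bar>scaled_range n h - pi\<bar>) \<le> C / sqrt (ln n) \<and>
     \<bar>walk_expectation n (scaled_range n) - pi\<bar> \<le> C * (ln (ln n) / ln n)"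
proof -
  obtain K where K: "\<forall>\<^sub>F n in sequentially.
    walk_expectation n (\<lambda>h. exp (sqrt (ln n) / 2 * \<bar>scaled_mart n h\<bar>)) \<le> K"
    by (rule scaled_mart_exp_moment)
  have "\<forall>\<^sub>F n in sequentially. 14 * 1921 * 8 / real n \<le> ln (ln n) / ln n"
    "\<forall>\<^sub>F n in sequentially. ln (ln n) / ln n \<le> 1 / sqrt (ln (real n))"
    "\<forall>\<^sub>F n in sequentially. 1 \<le> ln (real n)" "\<forall>\<^sub>F n in sequentially. 0 \<le> ln (ln (real n))"
    "\<forall>\<^sub>F n in sequentially. 2 * K / sqrt (ln (real n)) \<le> 1"
    by real_asymp+
  then have "\<forall>\<^sub>F n in sequentially.
     walk_expectation n (\<lambda>h. \<bar>scaled_range n h - pi\<bar>) \<le> (43 + 8 * \<bar>K\<bar>) / sqrt (ln n) \<and>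
     \<bar>walk_expectation n (scaled_range n) - pi\<bar> \<le> (43 + 8 * \<bar>K\<bar>) * (ln (ln n) / ln n)"
    using K scaled_range_approx eventually_gt_at_top[of 0]
  proof eventually_elim
    case (elim n)
    let ?y = "scaled_mart n" and ?Z = "scaled_range n" and ?e = "ln (ln (real n)) / ln n"
    let ?D = "\<lambda>h. ?Z h - pi - pi * ?y h"
    have n: "1 \<le> real n" using elim by simp
    have L: "0 < ln (real n)" using elim(3) by linarith
    then have s: "0 < sqrt (ln (real n))" by (simp only: real_sqrt_gt_0_iff)
    have e: "0 \<le> ?e" using elim by simp
    have "walk_expectation n (\<lambda>h. sqrt (ln n) / 2 * \<bar>?y h\<bar>) \<le> walk_expectation n (\<lambda>h. exp (sqrt (ln n) / 2 * \<bar>?y h\<bar>))"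
    proof (rule walk_expectation_mono)
      fix h show "sqrt (ln n) / 2 * \<bar>?y h\<bar> \<le> exp (sqrt (ln n) / 2 * \<bar>?y h\<bar>)"
        using exp_ge_add_one_self[of "sqrt (ln n) / 2 * \<bar>?y h\<bar>"] by linarith
    qed
    then have "sqrt (ln n) / 2 * walk_expectation n (\<lambda>h. \<bar>?y h\<bar>) \<le> K" using elim by simp
    then have Ey: "walk_expectation n (\<lambda>h. \<bar>?y h\<bar>) \<le> 2 * K / sqrt (ln n)"
      using s by (simp add: field_simps)
    then have Ey1: "walk_expectation n (\<lambda>h. \<bar>?y h\<bar>) \<le> 1" using elim by linarith
    \<comment> \<open>Off the diffusive event the error is at most of order \<open>n\<close>; the
      probability \<open>8 / n^2\<close> of that event reduces this to O(1/n).\<close>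
    have "walk_expectation n (\<lambda>h. \<bar>?D h\<bar>)
      \<le> walk_expectation n (\<lambda>h. 21 * ?e * (1 + \<bar>?y h\<bar>) + 14 * (1921 * real n) * indicator {h. \<not> diffusive n h} h)"
    proof (rule walk_expectation_mono)
      fix h assume h: "h \<in> set_pmf (walk_law n)"
      have 1: "\<bar>?D h\<bar> \<le> 14 * (1 + \<bar>?y h\<bar>)" "diffusive n h \<Longrightarrow> \<bar>?D h\<bar> \<le> 21 * ?e * (1 + \<bar>?y h\<bar>)"
        using elim h by auto
      have "0 \<le> 21 * ?e * (1 + \<bar>?y h\<bar>)" by (intro mult_nonneg_nonneg e) auto
      moreover have "1 + \<bar>?y h\<bar> \<le> 1921 * real n" using abs_scaled_mart_le[OF h] n by linarith
      ultimately show "\<bar>?D h\<bar> \<le> 21 * ?e * (1 + \<bar>?y h\<bar>) + 14 * (1921 * real n) * indicator {h. \<not> diffusive n h} h"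
        using 1 by (cases "diffusive n h") auto
    qed
    also have "\<dots> = 21 * ?e * (1 + walk_expectation n (\<lambda>h. \<bar>?y h\<bar>)) + 14 * (1921 * real n) * walk_prob n {h. \<not> diffusive n h}"
      by (simp add: distrib_left)
    also have "\<dots> \<le> 21 * ?e * (1 + 1) + 14 * (1921 * real n) * (8 / (real n)\<^sup>2)"
      using Ey1 e elim by (intro add_mono mult_left_mono walk_prob_not_diffusive) auto
    also have "14 * (1921 * real n) * (8 / (real n)\<^sup>2) = 14 * 1921 * 8 / n"
      using n by (simp add: power2_eq_square)
    also have "21 * ?e * (1 + 1) + 14 * 1921 * 8 / n \<le> 43 * ?e"
    proof -
      have "21 * E * (1 + 1) + c \<le> 43 * E" if "c \<le> E" for E c :: real using that by simp
      then show ?thesis using elim(1) by blast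
    qed
    finally have ED: "walk_expectation n (\<lambda>h. \<bar>?D h\<bar>) \<le> 43 * ?e" .
    \<comment> \<open>The term of order \<open>1 / sqrt (ln n)\<close> is centred, which is why the
      expectation converges at the better rate.\<close>
    have EY: "walk_expectation n ?y = 0"
      using walk_mart_mean[of n] by (simp add: scaled_mart_def[abs_def])
    have "walk_expectation n ?D = walk_expectation n ?Z - pi"
      using EY by simp
    then have "\<bar>walk_expectation n ?Z - pi\<bar> \<le> walk_expectation n (\<lambda>h. \<bar>?D h\<bar>)"
      using integral_abs_bound[of "walk_law n" ?D] by simp
    also have "\<dots> \<le> 43 * ?e" by (rule ED)
    also have "\<dots> \<le> (43 + 8 * \<bar>K\<bar>) * ?e" using e by (intro mult_right_mono) auto
    finally have 2: "\<bar>walk_expectation n ?Z - pi\<bar> \<le> (43 + 8 * \<bar>K\<bar>) * ?e" .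
    have "walk_expectation n (\<lambda>h. \<bar>?Z h - pi\<bar>) \<le> walk_expectation n (\<lambda>h. \<bar>?D h\<bar> + 4 * \<bar>?y h\<bar>)"
    proof (rule walk_expectation_mono)
      fix h
      have "\<bar>pi * ?y h\<bar> \<le> 4 * \<bar>?y h\<bar>" unfolding abs_mult using pi_less_4 by (intro mult_right_mono) auto
      then show "\<bar>?Z h - pi\<bar> \<le> \<bar>?D h\<bar> + 4 * \<bar>?y h\<bar>" by linarith
    qed
    also have "\<dots> = walk_expectation n (\<lambda>h. \<bar>?D h\<bar>) + 4 * walk_expectation n (\<lambda>h. \<bar>?y h\<bar>)" by simp
    also have "\<dots> \<le> 43 * (1 / sqrt (ln n)) + 4 * (2 * \<bar>K\<bar> / sqrt (ln n))"
    proof (intro add_mono mult_left_mono order_trans[OF ED] order_trans[OF Ey])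
      show "2 * K / sqrt (ln n) \<le> 2 * \<bar>K\<bar> / sqrt (ln n)" using s by (intro divide_right_mono) auto
    qed (use elim in auto)
    also have "\<dots> = (43 + 8 * \<bar>K\<bar>) / sqrt (ln n)" by (simp add: add_divide_distrib)
    finally show ?case using 2 by simp
  qed
  then show ?thesis by (rule that)
qed

text \<open>Quantitative uniform integrability: a p-th moment is split between a first moment, which
  will tend to 0, and an arbitrarily small multiple of an exponential moment, which will stay
  bounded.\<close>

lemma powr_le_linear_plus_exp:
  fixes p c \<eta> :: real
  assumes "1 \<le> p" "0 < c" "0 < \<eta>"
  obtains B where "0 \<le> B" "\<And>t. 0 \<le> t \<Longrightarrow> t powr p \<le> B * t + \<eta> * exp (c * t)"
proof -
  have "((\<lambda>t. t powr p * exp (- (c * t))) \<longlongrightarrow> 0) at_top" using assms by real_asymp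
  then have "\<forall>\<^sub>F t in at_top. t powr p * exp (- (c * t)) < \<eta>"
    using assms by (auto dest: order_tendstoD)
  then obtain t0 where t0: "\<And>t. t \<ge> t0 \<Longrightarrow> t powr p * exp (- (c * t)) < \<eta>"
    by (auto simp: eventually_at_top_linorder)
  define u where "u = max 1 t0"
  show ?thesis
  proof
    show "0 \<le> u powr (p - 1)" by simp
    fix t :: real assume t: "0 \<le> t"
    show "t powr p \<le> u powr (p - 1) * t + \<eta> * exp (c * t)"
    proof (cases "t \<le> u")
      case True
      have "t powr p = t powr (p - 1) * t"
        using t by (cases "t = 0") (auto simp: powr_diff)
      also have "\<dots> \<le> u powr (p - 1) * t"
        using True t assms by (intro mult_right_mono powr_mono2) auto
      finally show ?thesis using assms by (simp add: add_increasing2)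
    next
      case False
      then have "t powr p * exp (- (c * t)) < \<eta>" by (intro t0) (auto simp: u_def)
      then have "t powr p \<le> \<eta> * exp (c * t)" by (simp add: exp_minus field_simps)
      then show ?thesis using t by (simp add: add_increasing)
    qed
  qed
qed

lemma scaled_range_Lp:
  assumes "1 \<le> (p :: real)"
  shows "(\<lambda>n. walk_expectation n (\<lambda>h. \<bar>scaled_range n h - pi\<bar> powr p)) \<longlonglongrightarrow> 0"
proof -
  obtain K where K: "\<forall>\<^sub>F n in sequentially.
    walk_expectation n (\<lambda>h. exp (sqrt (ln n) / 2 * \<bar>scaled_mart n h\<bar>)) \<le> K"
    by (rule scaled_mart_exp_moment)
  obtain C where C: "\<forall>\<^sub>F n in sequentially.
     walk_expectation n (\<lambda>h. \<bar>scaled_range n h - pi\<bar>) \<le> C / sqrt (ln n) \<and>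
     \<bar>walk_expectation n (scaled_range n) - pi\<bar> \<le> C * (ln (ln n) / ln n)"
    by (rule scaled_range_rates)
  have "\<forall>\<^sub>F n in sequentially. 2 \<le> sqrt (ln (real n))" by real_asymp
  \<comment> \<open>The deviation is at most \<open>18 * (1 + |scaled_mart n h|)\<close> with
    \<open>18 = 14 + 4\<close>; once \<open>sqrt (ln n) >= 2\<close>, the exponential moment of the
    martingale covers the exponent.\<close>
  then have E: "\<forall>\<^sub>F n in sequentially. walk_expectation n (\<lambda>h. exp (1 / 18 * \<bar>scaled_range n h - pi\<bar>)) \<le> exp 1 * K"
    using K scaled_range_approx
  proof eventually_elim
    case (elim n)
    let ?y = "scaled_mart n"
    have "walk_expectation n (\<lambda>h. exp (1 / 18 * \<bar>scaled_range n h - pi\<bar>))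
      \<le> walk_expectation n (\<lambda>h. exp 1 * exp (sqrt (ln n) / 2 * \<bar>?y h\<bar>))"
    proof (rule walk_expectation_mono)
      fix h assume h: "h \<in> set_pmf (walk_law n)"
      have "\<bar>pi * ?y h\<bar> \<le> 4 * \<bar>?y h\<bar>" unfolding abs_mult using pi_less_4 by (intro mult_right_mono) auto
      moreover have "\<bar>scaled_range n h - pi - pi * ?y h\<bar> \<le> 14 * (1 + \<bar>?y h\<bar>)" using elim h by auto
      moreover have "\<bar>z\<bar> \<le> 18 * (1 + y)" if "\<bar>w\<bar> \<le> 4 * y" "\<bar>z - w\<bar> \<le> 14 * (1 + y)" for z w y :: real
        using that unfolding distrib_left by linarith
      ultimately have "\<bar>scaled_range n h - pi\<bar> \<le> 18 * (1 + \<bar>?y h\<bar>)" by blast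
      moreover have "2 / 2 * \<bar>?y h\<bar> \<le> sqrt (ln n) / 2 * \<bar>?y h\<bar>"
        using elim by (intro mult_right_mono divide_right_mono) auto
      moreover have "1 / 18 * z \<le> 1 + w" if "z \<le> 18 * (1 + y)" "2 / 2 * y \<le> w" for z y w :: real
        using that by simp
      ultimately have "1 / 18 * \<bar>scaled_range n h - pi\<bar> \<le> 1 + sqrt (ln n) / 2 * \<bar>?y h\<bar>" by blast
      then show "exp (1 / 18 * \<bar>scaled_range n h - pi\<bar>) \<le> exp 1 * exp (sqrt (ln n) / 2 * \<bar>?y h\<bar>)"
        unfolding exp_add[symmetric] by simp
    qed
    then show ?case using elim by (simp add: mult_left_mono order_trans)
  qed
  show ?thesis
  proof (rule tendstoI)
    fix r :: real assume r: "0 < r"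
    define \<eta> where "\<eta> = r / (2 * (exp 1 * \<bar>K\<bar> + 1))"
    have d: "0 < exp 1 * \<bar>K\<bar> + 1" by (simp add: add_nonneg_pos)
    have \<eta>: "0 < \<eta>" "\<eta> * (exp 1 * \<bar>K\<bar>) \<le> r / 2"
    proof -
      show "0 < \<eta>" using r d by (simp add: \<eta>_def)
      then have "\<eta> * (exp 1 * \<bar>K\<bar>) \<le> \<eta> * (exp 1 * \<bar>K\<bar> + 1)" by (intro mult_left_mono) auto
      also have "\<dots> = r / 2" using d unfolding \<eta>_def by (simp add: field_simps)
      finally show "\<eta> * (exp 1 * \<bar>K\<bar>) \<le> r / 2" .
    qed
    obtain B where B: "0 \<le> B" "\<And>t. 0 \<le> t \<Longrightarrow> t powr p \<le> B * t + \<eta> * exp (1 / 18 * t)"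
      using powr_le_linear_plus_exp[OF assms, of "1/18" \<eta>] \<eta> by auto
    have "\<forall>\<^sub>F n in sequentially. B * (C / sqrt (ln (real n))) < r / 2"
      using r by real_asymp
    then show "\<forall>\<^sub>F n in sequentially. dist (walk_expectation n (\<lambda>h. \<bar>scaled_range n h - pi\<bar> powr p)) 0 < r"
      using E C
    proof eventually_elim
      case (elim n)
      have "walk_expectation n (\<lambda>h. \<bar>scaled_range n h - pi\<bar> powr p)
        \<le> walk_expectation n (\<lambda>h. B * \<bar>scaled_range n h - pi\<bar> + \<eta> * exp (1 / 18 * \<bar>scaled_range n h - pi\<bar>))"
        by (intro walk_expectation_mono B) auto
      also have "\<dots> = B * walk_expectation n (\<lambda>h. \<bar>scaled_range n h - pi\<bar>)
          + \<eta> * walk_expectation n (\<lambda>h. exp (1 / 18 * \<bar>scaled_range n h - pi\<bar>))" by simp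
      also have "\<dots> \<le> B * (C / sqrt (ln n)) + \<eta> * (exp 1 * \<bar>K\<bar>)"
      proof (intro add_mono mult_left_mono)
        show "walk_expectation n (\<lambda>h. exp (1 / 18 * \<bar>scaled_range n h - pi\<bar>)) \<le> exp 1 * \<bar>K\<bar>"
          by (rule order_trans[OF elim(2)]) (simp add: mult_left_mono)
      qed (use elim B \<eta> in auto)
      also have "\<dots> < r" using elim \<eta> by linarith
      finally have "walk_expectation n (\<lambda>h. \<bar>scaled_range n h - pi\<bar> powr p) < r" .
      moreover have "0 \<le> walk_expectation n (\<lambda>h. \<bar>scaled_range n h - pi\<bar> powr p)"
        by (rule integral_nonneg_AE) auto
      ultimately show ?case by simp
    qed
  qed
qed

text \<open>The threshold \<open>4 * \<epsilon>\<close> is divided into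
  \<open>pi * \<epsilon>\<close> for the martingale and \<open>(4 - pi) * \<epsilon>\<close> for the
  deterministic error.\<close>

lemma scaled_range_tail:
  fixes \<epsilon> :: real
  assumes "0 < \<epsilon>" "\<epsilon> \<le> 1"
  obtains c :: real where "0 < c"
    "\<forall>\<^sub>F n in sequentially. walk_prob n {h. 4 * \<epsilon> < \<bar>scaled_range n h - pi\<bar>} \<le> 2 * n powr (- c) + 8 / (real n)\<^sup>2"
proof -
  obtain c :: real where c: "0 < c"
    "\<forall>\<^sub>F n in sequentially. walk_prob n {h. \<epsilon> \<le> \<bar>scaled_mart n h\<bar>} \<le> 2 * n powr (- c)"
    using scaled_mart_tail[OF assms] by blast
  have "\<forall>\<^sub>F n in sequentially. 21 * (ln (ln (real n)) / ln n) * 2 \<le> (4 - pi) * \<epsilon>"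
  proof -
    have "0 < (4 - pi) * \<epsilon>" using assms pi_less_4 by simp
    moreover have "((\<lambda>n. 21 * (ln (ln (real n)) / ln n) * 2) \<longlongrightarrow> 0) sequentially" by real_asymp
    ultimately have "\<forall>\<^sub>F n in sequentially. 21 * (ln (ln (real n)) / ln n) * 2 < (4 - pi) * \<epsilon>"
      by (rule order_tendstoD(2)[rotated])
    then show ?thesis by eventually_elim simp
  qed
  moreover have "\<forall>\<^sub>F n in sequentially. 1 \<le> ln (real n)" "\<forall>\<^sub>F n in sequentially. 0 \<le> ln (ln (real n))" by real_asymp+
  ultimately have "\<forall>\<^sub>F n in sequentially. walk_prob n {h. 4 * \<epsilon> < \<bar>scaled_range n h - pi\<bar>} \<le> 2 * n powr (- c) + 8 / (real n)\<^sup>2"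
    using c(2) scaled_range_approx
  proof eventually_elim
    case (elim n)
    let ?A = "{h. \<epsilon> \<le> \<bar>scaled_mart n h\<bar>}" and ?B = "{h. \<not> diffusive n h}"
    have "walk_prob n {h. 4 * \<epsilon> < \<bar>scaled_range n h - pi\<bar>} \<le> walk_prob n (?A \<union> ?B)"
    proof (rule measure_pmf.finite_measure_mono_AE)
      have "h \<in> ?A \<union> ?B" if h: "h \<in> set_pmf (walk_law n)" and big: "4 * \<epsilon> < \<bar>scaled_range n h - pi\<bar>" for h
      proof (cases "diffusive n h \<and> \<bar>scaled_mart n h\<bar> < \<epsilon>")
        case True
        let ?y = "scaled_mart n h" and ?e = "21 * (ln (ln (real n)) / ln n)"
        have "\<bar>scaled_range n h - pi - pi * ?y\<bar> \<le> ?e * (1 + \<bar>?y\<bar>)" using elim h True by auto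
        also have "\<dots> \<le> ?e * 2" using True assms elim by (intro mult_left_mono) auto
        finally have "\<bar>scaled_range n h - pi - pi * ?y\<bar> \<le> (4 - pi) * \<epsilon>" using elim by linarith
        moreover have "\<bar>pi * ?y\<bar> \<le> pi * \<epsilon>" unfolding abs_mult using True by (intro mult_mono) auto
        ultimately have "\<bar>scaled_range n h - pi\<bar> \<le> (4 - pi) * \<epsilon> + pi * \<epsilon>" by linarith
        then show ?thesis using big by (simp add: algebra_simps)
      qed auto
      then show "AE h in walk_law n. h \<in> {h. 4 * \<epsilon> < \<bar>scaled_range n h - pi\<bar>} \<longrightarrow> h \<in> ?A \<union> ?B"
        unfolding AE_measure_pmf_iff by blast
    qed auto
    also have "\<dots> \<le> walk_prob n ?A + walk_prob n ?B" by (rule measure_Un_le) auto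
    also have "\<dots> \<le> 2 * n powr (- c) + 8 / (real n)\<^sup>2"
      using elim by (intro add_mono walk_prob_not_diffusive) auto
    finally show ?case .
  qed
  with c(1) show ?thesis by (rule that)
qed

section \<open>Transfer to the walk\<close>

lemma nat_root_exists:
  fixes m n :: nat
  assumes "1 \<le> m"
  shows "\<exists>k. k ^ m \<le> n \<and> n < (k + 1) ^ m"
proof -
  have le: "k \<le> n" if "k ^ m \<le> n" for k
    using that assms self_le_power[of k m] by (cases "k = 0") auto
  have "\<exists>k. k ^ m \<le> n \<and> (\<forall>j. j ^ m \<le> n \<longrightarrow> j \<le> k)"
    by (rule Nat.ex_has_greatest_nat[of "\<lambda>k. k ^ m \<le> n" 0 n]) (use assms le in \<open>auto simp: power_0_left\<close>)
  then show ?thesis by (metis Suc_eq_plus1 Suc_n_not_le_n not_le_imp_less)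
qed

text \<open>Polynomially spaced times suffice: consecutive ones have ratio tending to one.\<close>

lemma eventually_close_from_powers:
  fixes R :: "nat \<Rightarrow> real" and \<epsilon> :: real and m :: nat
  assumes mono: "mono R" and R: "\<And>n. 0 \<le> R n" and \<epsilon>: "0 < \<epsilon>" "\<epsilon> \<le> 1/2" and m: "1 \<le> m"
    and close: "\<forall>\<^sub>F k in sequentially. \<bar>ln (real (k ^ m)) / real (k ^ m) * R (k ^ m) - pi\<bar> \<le> 4 * \<epsilon>"
  shows "\<forall>\<^sub>F n in sequentially. \<bar>ln (real n) / real n * R n - pi\<bar> \<le> 12 * \<epsilon>"
proof -
  let ?Z = "\<lambda>n. ln (real n) / real n * R n"
  have "((\<lambda>k. ((real k + 1) / real k) ^ m) \<longlongrightarrow> 1 ^ m) sequentially"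
    by (intro tendsto_power) real_asymp
  then have "\<forall>\<^sub>F k in sequentially. ((real k + 1) / real k) ^ m < 1 + \<epsilon>"
    by (rule order_tendstoD) (use \<epsilon> in simp)
  from eventually_conj[OF close this] obtain K where
    "\<forall>k\<ge>K. \<bar>?Z (k ^ m) - pi\<bar> \<le> 4 * \<epsilon> \<and> ((real k + 1) / real k) ^ m < 1 + \<epsilon>"
    unfolding eventually_sequentially by (elim exE)
  then have K: "\<bar>?Z (k ^ m) - pi\<bar> \<le> 4 * \<epsilon>" "((real k + 1) / real k) ^ m < 1 + \<epsilon>" if "K \<le> k" for k
    using that by blast+
  define N where "N = (max K 1) ^ m"
  have "\<bar>?Z n - pi\<bar> \<le> 12 * \<epsilon>" if n: "N \<le> n" for n
  proof -
    obtain k where k: "k ^ m \<le> n" "n < (k + 1) ^ m" using nat_root_exists[OF m] by blast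
    have "(max K 1) ^ m < (k + 1) ^ m" using n k unfolding N_def by linarith
    then have "max K 1 < k + 1" by (rule power_less_imp_less_base) simp
    then have kK: "K \<le> k" "1 \<le> k" by auto
    define a b q where "a = k ^ m" and "b = (k + 1) ^ m" and "q = ((real k + 1) / real k) ^ m"
    have a: "1 \<le> a" using kK by (simp add: a_def)
    have qa: "real b = q * real a" using kK by (simp add: a_def b_def q_def power_divide add.commute)
    have q: "1 \<le> q" "q \<le> 1 + \<epsilon>"
      using K(2)[OF kK(1)] kK by (auto intro!: one_le_power simp: q_def le_divide_eq)
    have Za: "\<bar>?Z a - pi\<bar> \<le> 4 * \<epsilon>" and Zb: "\<bar>?Z b - pi\<bar> \<le> 4 * \<epsilon>"
      unfolding a_def b_def by (rule K(1), use kK in simp)+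
    have ab: "a \<le> n" "n \<le> b" using k by (simp_all add: a_def b_def)
    have Rm: "R a \<le> R n" "R n \<le> R b" using mono ab by (auto dest: monoD)
    have n1: "1 \<le> n" and b1: "1 \<le> b" using a ab by linarith+
    \<comment> \<open>\<open>ln n / n\<close> is not increasing, so \<open>ln\<close> and
      \<open>R\<close> are compared with their values at \<open>b\<close> and the denominator with
      \<open>a\<close>. This costs the ratio \<open>q\<close> of neighbouring powers; the lower
      bound exchanges the roles of \<open>a\<close> and \<open>b\<close>.\<close>
    have "?Z n = ln n * R n / n" by simp
    also have "\<dots> \<le> ln b * R b / a"
    proof (intro frac_le mult_mono)
      show "ln (real n) \<le> ln (real b)" using n1 ab by simp
      show "real a \<le> real n" using ab by simp
    qed (use a n1 b1 R Rm in \<open>auto intro!: mult_nonneg_nonneg\<close>)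
    also have "\<dots> = ?Z b * q" unfolding qa using a q(1) by (simp add: field_simps)
    also have "\<dots> \<le> (pi + 4 * \<epsilon>) * (1 + \<epsilon>)"
      using Zb q \<epsilon> by (intro mult_mono) auto
    also have "\<dots> \<le> pi + 12 * \<epsilon>"
    proof -
      have "pi * \<epsilon> \<le> 4 * \<epsilon>" using pi_less_4 \<epsilon> by (intro mult_right_mono) auto
      moreover have "\<epsilon> * \<epsilon> \<le> \<epsilon> * 1" using \<epsilon> by (intro mult_left_mono) auto
      ultimately show ?thesis by (simp add: algebra_simps)
    qed
    finally have up: "?Z n \<le> pi + 12 * \<epsilon>" .
    have "pi - 12 * \<epsilon> \<le> (pi - 4 * \<epsilon>) * (1 - \<epsilon>)"
    proof -
      have "pi * \<epsilon> \<le> 4 * \<epsilon>" using pi_less_4 \<epsilon> by (intro mult_right_mono) auto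
      moreover have "0 \<le> \<epsilon> * \<epsilon>" by simp
      moreover have "(pi - 4 * \<epsilon>) * (1 - \<epsilon>) = pi - pi * \<epsilon> - 4 * \<epsilon> + 4 * (\<epsilon> * \<epsilon>)"
        by (simp add: algebra_simps)
      ultimately show ?thesis using \<epsilon> by linarith
    qed
    also have "\<dots> \<le> ?Z a * (1 / q)"
    proof (rule mult_mono)
      have "(1 - \<epsilon>) * q \<le> (1 - \<epsilon>) * (1 + \<epsilon>)" using q \<epsilon> by (intro mult_left_mono) auto
      also have "\<dots> \<le> 1" by (simp add: algebra_simps)
      finally show "1 - \<epsilon> \<le> 1 / q" using q by (simp add: le_divide_eq)
      show "0 \<le> ?Z a" using a R by simp
    qed (use Za \<epsilon> in auto)
    also have "\<dots> = ln a * R a / b" unfolding qa by simp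
    also have "\<dots> \<le> ln n * R n / n"
    proof (intro frac_le mult_mono)
      show "ln (real a) \<le> ln (real n)" using a ab by simp
      show "real n \<le> real b" using ab by simp
    qed (use a n1 b1 R Rm in \<open>auto intro!: mult_nonneg_nonneg\<close>)
    finally have "pi - 12 * \<epsilon> \<le> ?Z n" by simp
    with up show ?thesis by linarith
  qed
  then show ?thesis unfolding eventually_sequentially by blast
qed

section \<open>Identification of the law of histories\<close>

primrec history :: "(nat \<Rightarrow> 'a \<Rightarrow> int \<times> int) \<Rightarrow> nat \<Rightarrow> 'a \<Rightarrow> (int \<times> int) list" where
  "history S 0 \<omega> = [S 0 \<omega>]"
| "history S (Suc n) \<omega> = S (Suc n) \<omega> # history S n \<omega>"

lemma set_history: "set (history S n \<omega>) = {S i \<omega> | i. i \<le> n}"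
proof (induction n)
  case (Suc n)
  have "{S i \<omega> | i. i \<le> Suc n} = insert (S (Suc n) \<omega>) {S i \<omega> | i. i \<le> n}"
    by (auto simp: le_Suc_eq)
  with Suc show ?case by simp
qed simp

lemma set_tl_history: "set (tl (history S n \<omega>)) = {S i \<omega> | i. i < n}"
  by (cases n) (simp_all add: set_history less_Suc_eq_le)

lemma hd_history [simp]: "hd (history S n \<omega>) = S n \<omega>"
  by (cases n) simp_all

lemma history_not_Nil [simp]: "history S n \<omega> \<noteq> []"
  by (cases n) simp_all

lemma range_size_history: "range_size S n \<omega> = card (set (tl (history S n \<omega>)))"
  by (simp add: range_size_def set_tl_history)

text \<open>Prepending is injective in the step and keeps the earlier history as tail, so only
  \<open>h = l\<close> contributes to the mixture.\<close>

lemma pmf_walk_law_Suc: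
  "pmf (walk_law (Suc n)) (x # l) = pmf (walk_law n) l * pmf (departure_law l) (x - hd l)"
proof -
  have eq: "pmf (map_pmf (\<lambda>e. (hd h + e) # h) (departure_law h)) (x # l)
      = indicator {l} h * pmf (departure_law l) (x - hd l)" for h
  proof (cases "h = l")
    case True
    have "inj (\<lambda>e. (hd l + e) # l)" by (auto simp: inj_def)
    from pmf_map_inj'[OF this, of "departure_law l" "x - hd l"] show ?thesis using True by simp
  next
    case False
    then have "x # l \<notin> set_pmf (map_pmf (\<lambda>e. (hd h + e) # h) (departure_law h))" by auto
    then have "pmf (map_pmf (\<lambda>e. (hd h + e) # h) (departure_law h)) (x # l) = 0"
      by (simp only: set_pmf_iff not_not)
    then show ?thesis using False by simp
  qed
  show ?thesis by (simp add: pmf_bind eq measure_pmf_single)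
qed

context walk_M212
begin

lemma history_in_filtration:
  "k \<le> n \<Longrightarrow> {\<omega> \<in> space M. history S k \<omega> = l} \<in> sets (natural_filtration M S n)"
proof (induction k arbitrary: l)
  have basic: "S i -` A \<inter> space M \<in> sets (natural_filtration M S n)" if "i \<le> n" for i A
  proof -
    have "{S i -` A \<inter> space M | i A. i \<le> n} \<subseteq> Pow (space M)" by auto
    then show ?thesis using that unfolding natural_filtration_def by auto
  qed
  {
    case 0
    have "{\<omega> \<in> space M. history S 0 \<omega> = l} = (if length l = 1 then S 0 -` {hd l} \<inter> space M else {})"
      by (cases l) auto
    then show ?case using basic[of 0] by simp
  next
    case (Suc k)
    show ?case
    proof (cases l)
      case (Cons x l')
      then have "{\<omega> \<in> space M. history S (Suc k) \<omega> = l}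
        = (S (Suc k) -` {x} \<inter> space M) \<inter> {\<omega> \<in> space M. history S k \<omega> = l'}" by auto
      then show ?thesis using basic[of "Suc k" "{x}"] Suc by auto
    qed auto
  }
qed

lemma history_measurable [measurable]: "history S n \<in> measurable M (count_space UNIV)"
proof -
  have "history S n -` {l} \<inter> space M \<in> sets M" for l
  proof -
    have "history S n -` {l} \<inter> space M = {\<omega> \<in> space M. history S n \<omega> = l}" by auto
    then show ?thesis
      using history_in_filtration[of n n l] subalgebra_natural_filtration[of n] by (auto simp: subalgebra_def)
  qed
  then show ?thesis by (simp add: measurable_count_space_eq2_countable)
qed

text \<open>The event of a fixed history lies in the sigma-algebra at time n, and on it the
  conditional step law is almost surely the constant \<open>pmf (departure_law l) e\<close>;
  integrating over the event removes the conditional expectation.\<close>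

lemma prob_history_step:
  assumes A: "A = {\<omega> \<in> space M. history S n \<omega> = l}" and B: "B = {\<omega> \<in> space M. S (Suc n) \<omega> - S n \<omega> = e}"
  shows "prob (A \<inter> B) = prob A * pmf (departure_law l) e"
proof -
  let ?F = "natural_filtration M S n"
  interpret sigma_finite_subalgebra M ?F
    using subalgebra_natural_filtration
    by (intro finite_measure_subalgebra_is_sigma_finite) (simp add: finite_measure_subalgebra_def finite_measure_subalgebra_axioms_def finite_measure_axioms)
  have [measurable]: "S k \<in> measurable M (count_space UNIV)" for k by (rule measurable_walk)
  have AF: "A \<in> sets ?F" unfolding A by (rule history_in_filtration) simp
  have AM: "A \<in> sets M" using AF subalg by (auto simp: subalgebra_def)
  have "(\<lambda>\<omega>. S (Suc n) \<omega> - S n \<omega>) \<in> measurable M (count_space UNIV)"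
    by (rule measurable_compose_countable'[where f = "\<lambda>i \<omega>. S (Suc n) \<omega> - i" and g = "S n" and I = UNIV]) measurable
  then have BM: "B \<in> sets M" unfolding B by measurable
  have "prob (A \<inter> B) = (\<integral>\<omega>. indicator A \<omega> * indicator B \<omega> \<partial>M)"
    using AM BM by (simp add: indicator_inter_arith[symmetric])
  also have "\<dots> = (\<integral>\<omega>. indicator A \<omega> * real_cond_exp M ?F (indicator B) \<omega> \<partial>M)"
    by (rule real_cond_exp_intg_fpos(2)[symmetric])
      (use AF AM BM in \<open>auto intro!: integrable_const_bound[where B = 1] simp: indicator_def\<close>)
  also have "\<dots> = (\<integral>\<omega>. indicator A \<omega> * pmf (departure_law l) e \<partial>M)"
  proof (rule integral_cong_AE)
    show "AE \<omega> in M. indicator A \<omega> * real_cond_exp M ?F (indicator B) \<omega> = indicator A \<omega> * pmf (departure_law l) e"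
      using walk_step[of n e]
    proof eventually_elim
      case (elim \<omega>)
      show ?case
      proof (cases "\<omega> \<in> A")
        case True
        then have l: "l = history S n \<omega>" by (simp add: A)
        have "departure_law l = step_law (S n \<omega> \<notin> {S i \<omega> | i. i < n})"
          by (simp add: l departure_law_def set_tl_history)
        then show ?thesis using elim by (simp add: B)
      qed simp
    qed
  qed (use AM in auto)
  also have "\<dots> = prob A * pmf (departure_law l) e" using AM by simp
  finally show ?thesis .
qed

lemma prob_history: "prob {\<omega> \<in> space M. history S n \<omega> = l} = pmf (walk_law n) l"
proof (induction n arbitrary: l)
  case 0
  have "{\<omega> \<in> space M. history S 0 \<omega> = l} = (if l = [0] then space M else {})"
    using walk_start by (auto simp: zero_prod_def)
  then show ?case by (simp add: prob_space)
next
  case (Suc n)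
  show ?case
  proof (cases l)
    case Nil
    have "[] \<notin> set_pmf (walk_law (Suc n))" using walk_law_not_Nil by blast
    then show ?thesis using Nil by (simp add: set_pmf_iff del: walk_law.simps)
  next
    case (Cons x l')
    have "{\<omega> \<in> space M. history S (Suc n) \<omega> = l}
      = {\<omega> \<in> space M. history S n \<omega> = l'} \<inter> {\<omega> \<in> space M. S (Suc n) \<omega> - S n \<omega> = x - hd l'}"
      using Cons by auto
    then show ?thesis
      using prob_history_step[OF refl refl, of n l' "x - hd l'"] Suc Cons
      by (simp add: pmf_walk_law_Suc del: walk_law.simps)
  qed
qed

text \<open>Agreement on singletons suffices, as histories form a countable type. From here on
  estimates for \<open>walk_law n\<close> carry over to the process.\<close>

lemma distr_history: "distr M (count_space UNIV) (history S n) = measure_pmf (walk_law n)"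
proof (rule measure_eqI_countable[where A = UNIV])
  fix l :: "(int \<times> int) list"
  have "history S n -` {l} \<inter> space M = {\<omega> \<in> space M. history S n \<omega> = l}" by auto
  then show "emeasure (distr M (count_space UNIV) (history S n)) {l} = emeasure (measure_pmf (walk_law n)) {l}"
    using prob_history[of n l] by (simp add: emeasure_distr emeasure_eq_measure emeasure_pmf_single)
qed auto

lemma integral_history: "(\<integral>\<omega>. f (history S n \<omega>) \<partial>M) = walk_expectation n f"
  using integral_distr[OF history_measurable, of f n] by (simp add: distr_history)

lemma integrable_history: "integrable M (\<lambda>\<omega>. f (history S n \<omega>) :: real)"
  using integrable_distr_eq[OF history_measurable, of f n] by (simp add: distr_history)

lemma prob_history_Collect: "prob {\<omega> \<in> space M. P (history S n \<omega>)} = walk_prob n {h. P h}"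
proof -
  have "measure (distr M (count_space UNIV) (history S n)) {h. P h} = prob (history S n -` {h. P h} \<inter> space M)"
    by (rule measure_distr) auto
  also have "history S n -` {h. P h} \<inter> space M = {\<omega> \<in> space M. P (history S n \<omega>)}" by auto
  finally show ?thesis by (simp add: distr_history)
qed

lemma scaled_range_history: "ln (real n) / real n * real (range_size S n \<omega>) = scaled_range n (history S n \<omega>)"
  by (simp add: scaled_range_def range_size_history)

lemma mono_range_size: "mono (\<lambda>n. real (range_size S n \<omega>))"
proof (rule monoI)
  fix m n :: nat assume "m \<le> n"
  then show "real (range_size S m \<omega>) \<le> real (range_size S n \<omega>)"
    unfolding range_size_def by (auto intro!: card_mono)
qed

section \<open>Limit theorems for the range of the process\<close>

lemma AE_eventually_close:
  assumes "0 < \<epsilon>" "\<epsilon> \<le> 1/2"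
  shows "AE \<omega> in M. \<forall>\<^sub>F n in sequentially. \<bar>ln (real n) / real n * real (range_size S n \<omega>) - pi\<bar> \<le> 12 * \<epsilon>"
proof -
  obtain c :: real where c: "0 < c"
    "\<forall>\<^sub>F n in sequentially. walk_prob n {h. 4 * \<epsilon> < \<bar>scaled_range n h - pi\<bar>} \<le> 2 * n powr (- c) + 8 / (real n)\<^sup>2"
    using scaled_range_tail[of \<epsilon>] assms by auto
  \<comment> \<open>With \<open>c * m >= 2\<close> the bound \<open>2 * n powr (- c)\<close> at
    \<open>n = k ^ m\<close> is at most \<open>2 / k^2\<close>; together with \<open>8 / k^2\<close>
    this is summable in \<open>k\<close>, as Borel-Cantelli needs.\<close>
  define m where "m = nat \<lceil>2 / c\<rceil> + 1"
  have m: "1 \<le> m" "2 \<le> c * real m"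
  proof -
    have "2 / c \<le> real m" unfolding m_def by linarith
    then show "2 \<le> c * real m" using c by (simp add: field_simps)
  qed (simp add: m_def)
  let ?E = "\<lambda>n. {\<omega> \<in> space M. 4 * \<epsilon> < \<bar>scaled_range n (history S n \<omega>) - pi\<bar>}"
  have E: "?E n \<in> sets M" for n
    using measurable_sets[OF history_measurable[of n], of "{h. 4 * \<epsilon> < \<bar>scaled_range n h - pi\<bar>}"]
    by (simp add: vimage_def Int_def conj_commute)
  have "filterlim (\<lambda>k::nat. k ^ m) at_top sequentially"
  proof (rule filterlim_at_top_mono[OF filterlim_ident], intro always_eventually allI)
    show "k \<le> k ^ m" for k :: nat using m(1) by (cases "k = 0") (auto intro: self_le_power)
  qed
  from eventually_compose_filterlim[OF c(2) this]
  have "\<forall>\<^sub>F k in sequentially. prob (?E (k ^ m)) \<le> 10 * (1 / real k ^ 2)"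
    using eventually_gt_at_top[of 0]
  proof eventually_elim
    case (elim k)
    have k: "1 \<le> real k" using elim by simp
    have "real (k ^ m) powr (- c) = real k powr (- (c * m))"
      using k by (simp add: powr_realpow[symmetric] powr_powr mult.commute)
    also have "\<dots> \<le> real k powr (- 2)" using k m by (intro powr_mono) auto
    also have "\<dots> = 1 / real k ^ 2" using k by (simp add: powr_minus inverse_eq_divide)
    finally have 1: "real (k ^ m) powr (- c) \<le> 1 / real k ^ 2" .
    have "real k ^ 2 \<le> real (k ^ m) ^ 2"
      using k m by (intro power_mono) (auto intro: self_le_power)
    then have "8 / real (k ^ m) ^ 2 \<le> 8 / real k ^ 2" using k by (intro divide_left_mono) auto
    then have "walk_prob (k ^ m) {h. 4 * \<epsilon> < \<bar>scaled_range (k ^ m) h - pi\<bar>} \<le> 10 * (1 / real k ^ 2)"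
      using elim(1) 1 by linarith
    then show ?case
      unfolding prob_history_Collect[of "\<lambda>h. 4 * \<epsilon> < \<bar>scaled_range (k ^ m) h - pi\<bar>" "k ^ m"]
      by simp
  qed
  then have bound: "\<forall>\<^sub>F k in sequentially. norm (prob (?E (k ^ m))) \<le> 10 * (1 / real k ^ 2)"
    by simp
  have "summable (\<lambda>k. inverse (real k ^ 2))" by (rule inverse_power_summable) simp
  then have "summable (\<lambda>k. 10 * (1 / real k ^ 2))" by (intro summable_mult) (simp only: inverse_eq_divide)
  with bound have sum: "summable (\<lambda>k. prob (?E (k ^ m)))" by (rule summable_comparison_test_ev)
  have "AE \<omega> in M. \<forall>\<^sub>F k in sequentially. \<omega> \<in> space M - ?E (k ^ m)"
    by (rule borel_cantelli_AE1[OF E _ sum]) (simp add: emeasure_eq_measure)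
  then show ?thesis
  proof eventually_elim
    case (elim \<omega>)
    have "\<forall>\<^sub>F k in sequentially. \<bar>ln (real (k ^ m)) / real (k ^ m) * real (range_size S (k ^ m) \<omega>) - pi\<bar> \<le> 4 * \<epsilon>"
      using elim unfolding scaled_range_history by eventually_elim auto
    then show ?case
      by (intro eventually_close_from_powers[OF mono_range_size _ assms m(1)]) auto
  qed
qed

lemma AE_range_limit:
  "AE \<omega> in M. (\<lambda>n. ln (real n) / real n * real (range_size S n \<omega>)) \<longlonglongrightarrow> pi"
proof -
  \<comment> \<open>Countably many tolerances suffice; the shift by 2 keeps them at most 1/2, as
    \<open>AE_eventually_close\<close> requires.\<close>
  have "AE \<omega> in M. \<forall>i. \<forall>\<^sub>F n in sequentially.
      \<bar>ln (real n) / real n * real (range_size S n \<omega>) - pi\<bar> \<le> 12 * (1 / real (i + 2))"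
    unfolding AE_all_countable by (intro allI AE_eventually_close) (auto simp: field_simps)
  then show ?thesis
  proof eventually_elim
    case (elim \<omega>)
    show ?case
    proof (rule tendstoI)
      fix r :: real assume r: "0 < r"
      obtain i :: nat where "12 / r < real i" using reals_Archimedean2 by blast
      then have "12 * (1 / real (i + 2)) < r" using r by (simp add: field_simps)
      then show "\<forall>\<^sub>F n in sequentially. dist (ln (real n) / real n * real (range_size S n \<omega>)) pi < r"
        using elim[rule_format, of i] by (auto simp: dist_real_def elim!: eventually_mono)
    qed
  qed
qed

lemma Lp_range_limit:
  assumes "1 \<le> (p :: real)"
  shows "converges_in_Lp M p (\<lambda>n \<omega>. ln (real n) / real n * real (range_size S n \<omega>)) (\<lambda>\<omega>. pi)"
proof -
  have "(\<lambda>\<omega>. scaled_range n (history S n \<omega>)) \<in> borel_measurable M" for n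
    by (rule borel_measurable_integrable[OF integrable_history])
  moreover have "integrable M (\<lambda>\<omega>. \<bar>scaled_range n (history S n \<omega>)\<bar> powr p)" for n
    by (rule integrable_history[of "\<lambda>h. \<bar>scaled_range n h\<bar> powr p"])
  moreover have "integral\<^sup>L M (\<lambda>\<omega>. \<bar>scaled_range n (history S n \<omega>) - pi\<bar> powr p)
      = walk_expectation n (\<lambda>h. \<bar>scaled_range n h - pi\<bar> powr p)" for n
    by (rule integral_history[of "\<lambda>h. \<bar>scaled_range n h - pi\<bar> powr p"])
  ultimately show ?thesis
    unfolding converges_in_Lp_def scaled_range_history
    using scaled_range_Lp[OF assms] by simp
qed

lemma range_rates:
  "\<exists>C::real. \<forall>\<^sub>F n in sequentially.
        integral\<^sup>L M (\<lambda>\<omega>. \<bar>ln (real n) / real n * real (range_size S n \<omega>) - pi\<bar>)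
          \<le> C / sqrt (ln (real n))
        \<and> \<bar>ln (real n) / real n * integral\<^sup>L M (\<lambda>\<omega>. real (range_size S n \<omega>)) - pi\<bar>
          \<le> C * (ln (ln (real n)) / ln (real n))"
proof -
  obtain C :: real where C: "\<forall>\<^sub>F n in sequentially.
     walk_expectation n (\<lambda>h. \<bar>scaled_range n h - pi\<bar>) \<le> C / sqrt (ln n) \<and>
     \<bar>walk_expectation n (scaled_range n) - pi\<bar> \<le> C * (ln (ln n) / ln n)"
    by (rule scaled_range_rates)
  have 1: "ln (real n) / real n * integral\<^sup>L M (\<lambda>\<omega>. real (range_size S n \<omega>)) = walk_expectation n (scaled_range n)" for n
    unfolding integral_history[of "scaled_range n" n, symmetric] scaled_range_history[symmetric] by simp
  have 2: "integral\<^sup>L M (\<lambda>\<omega>. \<bar>ln (real n) / real n * real (range_size S n \<omega>) - pi\<bar>)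
      = walk_expectation n (\<lambda>h. \<bar>scaled_range n h - pi\<bar>)" for n
    unfolding scaled_range_history by (rule integral_history[of "\<lambda>h. \<bar>scaled_range n h - pi\<bar>"])
  show ?thesis unfolding 1 2 using C by (rule exI)
qed

end

theorem proposition4p1:
  fixes M :: "'a measure" and S :: "nat \<Rightarrow> 'a \<Rightarrow> int \<times> int"
  assumes "walk_M212 M S"
  shows "(AE \<omega> in M. (\<lambda>n. ln (real n) / real n * real (range_size S n \<omega>)) \<longlonglongrightarrow> pi)
    \<and> (\<forall>p::real. p \<ge> 1 \<longrightarrow>
        converges_in_Lp M p (\<lambda>n \<omega>. ln (real n) / real n * real (range_size S n \<omega>)) (\<lambda>\<omega>. pi))
    \<and> (\<exists>C::real. \<forall>\<^sub>F n in sequentially.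
        integral\<^sup>L M (\<lambda>\<omega>. \<bar>ln (real n) / real n * real (range_size S n \<omega>) - pi\<bar>)
          \<le> C / sqrt (ln (real n))
        \<and> \<bar>ln (real n) / real n * integral\<^sup>L M (\<lambda>\<omega>. real (range_size S n \<omega>)) - pi\<bar>
          \<le> C * (ln (ln (real n)) / ln (real n)))"
proof -
  interpret walk_M212 M S by (rule assms)
  show ?thesis
  proof (intro conjI allI impI)
    show "AE \<omega> in M. (\<lambda>n. ln (real n) / real n * real (range_size S n \<omega>)) \<longlonglongrightarrow> pi"
      by (rule AE_range_limit)
  qed (rule Lp_range_limit range_rates; assumption?)+
qed

end
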